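(* Suppose that the following statement (A) holds for every $n \geq 1$: (A) for every $C^1$ map $F:\mathbb{R}^n\to\mathbb{R}^n$ for which there exists $\varepsilon>0$ such that $|\lambda|\geq\varepsilon$ for every $x\in\mathbb{R}^n$ and every (complex) eigenvalue $\lambda$ of the Jacobian matrix $F'(x)$, the map $F$ is injective. Then the following statement (B) (the Jacobian Conjecture) holds: (B) for every field $k$ of characteristic $0$, every $n\geq 1$, and every polynomial map $F:k^n\to k^n$ whose Jacobian determinant is a nonzero constant, i.e. $\det JF(x)\equiv C\in k^{*}$ for all $x\in k^n$, the map $F$ has an inverse map $k^n\to k^n$ that is a polynomial map.
   Context: A map $F=(F_1,\dots,F_n):k^n\to k^n$ is a polynomial map if each $F_i$ is given by a polynomial in $k[x_1,\dots,x_n]$. $JF(x)$ denotes the Jacobian matrix $(\partial F_i/\partial x_j)(x)$, and $k^{*}=k\setminus\{0\}$. The proposition is an implication between two statements, each quantified over all dimensions $n$. *)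

theory Defs
  imports
    "HOL-Analysis.Derivative"
    "HOL-Analysis.Abstract_Euclidean_Space"
    "HOL-Library.Poly_Mapping"
    "Jordan_Normal_Form.Char_Poly"
begin

text \<open>
  The dimension \<open>n\<close> is quantified inside the hypothesis of the theorem, so it cannot be a type.
  Throughout, \<open>k\<^sup>n\<close> is \<open>carrier_vec n\<close>, and coordinates are numbered \<open>0, \<dots>, n - 1\<close>.
\<close>

subsection \<open>\<open>C\<^sup>1\<close> maps from \<open>\<real>\<^sup>n\<close> to \<open>\<real>\<^sup>n\<close>\<close>

text \<open>The \<open>i\<close>-th component of \<open>F\<close> along the line through \<open>x\<close> parallel to the \<open>j\<close>-th axis.\<close>

definition coord_line ::
    "nat \<Rightarrow> (real Matrix.vec \<Rightarrow> real Matrix.vec) \<Rightarrow> nat \<Rightarrow> nat \<Rightarrow> real Matrix.vec \<Rightarrow> real \<Rightarrow> real"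
  where "coord_line n F i j x t = Matrix.vec_index (F (x + t \<cdot>\<^sub>v unit_vec n j)) i"

definition jacobian ::
    "nat \<Rightarrow> (real Matrix.vec \<Rightarrow> real Matrix.vec) \<Rightarrow> real Matrix.vec \<Rightarrow> real Matrix.mat"
  where "jacobian n F x = Matrix.mat n n (\<lambda>(i, j). deriv (coord_line n F i j x) 0)"

text \<open>
  All partial derivatives exist everywhere and are continuous. The type of vectors carries no
  topology, so continuity is expressed on \<^const>\<open>Euclidean_space\<close>, whose points are the sequences
  vanishing from index \<open>n\<close> on; \<open>Matrix.vec n\<close> identifies it with \<open>carrier_vec n\<close>.
\<close>

definition C1_map :: "nat \<Rightarrow> (real Matrix.vec \<Rightarrow> real Matrix.vec) \<Rightarrow> bool"
  where "C1_map n F \<longleftrightarrow>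
    F \<in> carrier_vec n \<rightarrow> carrier_vec n \<and>
    (\<forall>i<n. \<forall>j<n.
      (\<forall>x\<in>carrier_vec n. coord_line n F i j x field_differentiable at 0) \<and>
      continuous_map (Euclidean_space n) euclideanreal
        (\<lambda>x. deriv (coord_line n F i j (Matrix.vec n x)) 0))"

subsection \<open>Polynomials in several variables and polynomial maps\<close>

text \<open>
  A polynomial maps each monomial to its coefficient; a monomial maps the index of each variable
  to its exponent.
\<close>

type_synonym 'a mpoly = "(nat \<Rightarrow>\<^sub>0 nat) \<Rightarrow>\<^sub>0 'a"

definition mpolys :: "nat \<Rightarrow> 'a::zero mpoly set"
  where "mpolys n = {p. \<forall>m\<in>Poly_Mapping.keys p. Poly_Mapping.keys m \<subseteq> {..<n}}"

definition mpoly_eval :: "'a::comm_semiring_1 mpoly \<Rightarrow> 'a Matrix.vec \<Rightarrow> 'a"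
  where "mpoly_eval p x =
    (\<Sum>m\<in>Poly_Mapping.keys p. Poly_Mapping.lookup p m *
      (\<Prod>i\<in>Poly_Mapping.keys m. Matrix.vec_index x i ^ Poly_Mapping.lookup m i))"

text \<open>
  The truncated subtraction of exponents is harmless: if \<open>x\<^sub>j\<close> does not occur in \<open>m\<close>, then the
  coefficient is zero.
\<close>

definition mpoly_pderiv :: "nat \<Rightarrow> 'a::comm_semiring_1 mpoly \<Rightarrow> 'a mpoly"
  where "mpoly_pderiv j p =
    (\<Sum>m\<in>Poly_Mapping.keys p. Poly_Mapping.single (m - Poly_Mapping.single j 1)
      (of_nat (Poly_Mapping.lookup m j) * Poly_Mapping.lookup p m))"

definition polynomial_map_by ::
    "nat \<Rightarrow> (nat \<Rightarrow> 'a::comm_semiring_1 mpoly) \<Rightarrow> ('a Matrix.vec \<Rightarrow> 'a Matrix.vec) \<Rightarrow> bool"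
  where "polynomial_map_by n P F \<longleftrightarrow>
    (\<forall>i<n. P i \<in> mpolys n) \<and>
    (\<forall>x\<in>carrier_vec n. F x = Matrix.vec n (\<lambda>i. mpoly_eval (P i) x))"

definition polynomial_jacobian ::
    "nat \<Rightarrow> (nat \<Rightarrow> 'a::comm_semiring_1 mpoly) \<Rightarrow> 'a Matrix.vec \<Rightarrow> 'a Matrix.mat"
  where "polynomial_jacobian n P x =
    Matrix.mat n n (\<lambda>(i, j). mpoly_eval (mpoly_pderiv j (P i)) x)"

end

theory Submission
  imports Defs
    "HOL-Library.Function_Algebras"
    "HOL-Computational_Algebra.Fundamental_Theorem_Algebra"
    "HOL-Computational_Algebra.Polynomial_Factorial"
    "HOL-Computational_Algebra.Field_as_Ring"
    "HOL-Homology.Invariance_of_Domain"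
begin

text \<open>
  Let \<open>F = h\<^sub>0 + h\<^sub>1 + \<dots>\<close> be a complex polynomial map with constant nonzero Jacobian determinant, split
  into homogeneous parts and normalised so that its linear part is the identity. Adding blocks of
  variables that carry the parts of degree at least two one by one gives a polynomial map whose
  Jacobian matrix has the single eigenvalue \<open>1\<close> and which is injective only if \<open>F\<close> is. Regarded as a
  map of a real vector space it satisfies the hypothesis of (A), so \<open>F\<close> is injective.

  An injective polynomial map of \<open>\<complex>\<^sup>n\<close> is birational: for a generic \<open>x\<close>, a coordinate of \<open>x\<close> outside the
  field generated by \<open>F(x)\<close> could be moved by a field embedding that fixes \<open>F(x)\<close>. It is also open, and
  a denominator of the inverse of least degree, composed with \<open>F\<close>, has no zeros and is therefore
  constant. Hence the inverse is polynomial. For an arbitrary field of characteristic zero, embed the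
  coefficients into \<open>\<complex>\<close>; the coefficients of a left inverse solve a linear system over the original
  field.
\<close>

text \<open>Constancy of the determinant alone does not keep the eigenvalues away from zero. The
  extra blocks separate the degrees, so that an eigenvector for an eigenvalue other than 1 can be
  read as a kernel vector of the original Jacobian matrix at a rescaled point.

  Two obstacles shape the rest. A field of characteristic zero may be larger than \<complex>, so
  embeddings are taken on countable subrings only, and identities pass between the two fields
  through points with natural coordinates, which every subring contains. And the number of variables
  is a term, so polynomials are functions on sequences, and elimination treats one variable at a
  time with coefficients in a ring of functions. Unique factorisation in several variables is
  thereby avoided: pseudo-division and a least degree replace common divisors, and Gauss's lemma is
  used on lines, where the coefficients are polynomials in one variable.

  The linear system yields a left inverse over the original field. That it is also a right inverse
  comes from a second embedding, whose domain contains the coefficients of both maps.\<close>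

hide_const (open) up_ring.coeff up_ring.monom module.smult

section \<open>Polynomials with coefficients in a subring\<close>

text \<open>A predicate on sets rather than a type: it is applied to countable subrings of a field,
  to sets of functions with pointwise operations, and to sets of polynomials over either.\<close>

definition is_subring :: "'a::comm_ring_1 set \<Rightarrow> bool"
  where "is_subring R \<longleftrightarrow> 1 \<in> R \<and> (\<forall>a\<in>R. \<forall>b\<in>R. a - b \<in> R \<and> a * b \<in> R)"

lemma is_subringD:
  assumes "is_subring R"
  shows "1 \<in> R" "0 \<in> R" "a \<in> R \<Longrightarrow> b \<in> R \<Longrightarrow> a - b \<in> R"
    "a \<in> R \<Longrightarrow> b \<in> R \<Longrightarrow> a * b \<in> R" "a \<in> R \<Longrightarrow> - a \<in> R"
    "a \<in> R \<Longrightarrow> b \<in> R \<Longrightarrow> a + b \<in> R" "a \<in> R \<Longrightarrow> a ^ n \<in> R"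
    "of_nat n \<in> R"
proof -
  show 1: "1 \<in> R" and d: "\<And>a b. a \<in> R \<Longrightarrow> b \<in> R \<Longrightarrow> a - b \<in> R"
    and m: "\<And>a b. a \<in> R \<Longrightarrow> b \<in> R \<Longrightarrow> a * b \<in> R"
    using assms by (auto simp: is_subring_def)
  show z: "0 \<in> R" using d[OF 1 1] by simp
  show u: "\<And>a. a \<in> R \<Longrightarrow> - a \<in> R" using d[OF z] by simp
  show p: "\<And>a b. a \<in> R \<Longrightarrow> b \<in> R \<Longrightarrow> a + b \<in> R" using d[OF _ u] by fastforce
  show "a \<in> R \<Longrightarrow> a ^ n \<in> R" by (induction n) (auto simp: 1 m)
  show "of_nat n \<in> R" by (induction n) (auto simp: 1 z p)
qed

lemma is_subring_sum:
  assumes "is_subring R" "\<And>i. i \<in> A \<Longrightarrow> f i \<in> R"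
  shows "(\<Sum>i\<in>A. f i) \<in> R"
  using assms(2) by (induction A rule: infinite_finite_induct) (auto intro: is_subringD[OF assms(1)])

lemma is_subring_prod:
  assumes "is_subring R" "\<And>i. i \<in> A \<Longrightarrow> f i \<in> R"
  shows "(\<Prod>i\<in>A. f i) \<in> R"
  using assms(2) by (induction A rule: infinite_finite_induct) (auto intro: is_subringD[OF assms(1)])

lemma is_subring_UNIV [simp]: "is_subring UNIV"
  by (simp add: is_subring_def)

definition coeffs_in :: "'a::comm_ring_1 set \<Rightarrow> 'a poly set"
  where "coeffs_in R = {p. \<forall>i. coeff p i \<in> R}"

lemma coeffs_inI [intro?]: "(\<And>i. coeff p i \<in> R) \<Longrightarrow> p \<in> coeffs_in R"
  by (simp add: coeffs_in_def)

lemma coeffs_inD: "p \<in> coeffs_in R \<Longrightarrow> coeff p i \<in> R"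
  by (simp add: coeffs_in_def)

lemma coeffs_in_mono: "R \<subseteq> R' \<Longrightarrow> p \<in> coeffs_in R \<Longrightarrow> p \<in> coeffs_in R'"
  by (auto simp: coeffs_in_def)

lemma is_subring_coeffs_in:
  assumes "is_subring R"
  shows "is_subring (coeffs_in R)"
  unfolding is_subring_def
  by (auto simp: coeffs_in_def coeff_mult intro!: is_subring_sum[OF assms] is_subringD[OF assms])

lemma coeffs_in_smult: "is_subring R \<Longrightarrow> c \<in> R \<Longrightarrow> p \<in> coeffs_in R \<Longrightarrow> smult c p \<in> coeffs_in R"
  by (auto simp: coeffs_in_def intro: is_subringD)

lemma coeffs_in_monom: "is_subring R \<Longrightarrow> c \<in> R \<Longrightarrow> monom c n \<in> coeffs_in R"
  by (auto simp: coeffs_in_def intro: is_subringD)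

lemma coeffs_in_pCons: "c \<in> R \<Longrightarrow> p \<in> coeffs_in R \<Longrightarrow> pCons c p \<in> coeffs_in R"
  by (auto simp: coeffs_in_def coeff_pCons split: nat.split)

lemma coeffs_in_0: "is_subring R \<Longrightarrow> 0 \<in> coeffs_in R"
  by (auto simp: coeffs_in_def intro: is_subringD)

lemma countable_coeffs_in:
  assumes "countable R"
  shows "countable (coeffs_in R)"
proof -
  have "coeffs_in R \<subseteq> Poly ` lists R"
  proof
    fix p assume p: "p \<in> coeffs_in R"
    have "coeffs p \<in> lists R"
      using p by (auto simp: coeffs_def coeffs_in_def)
    then show "p \<in> Poly ` lists R"
      by (metis Poly_coeffs image_eqI)
  qed
  then show ?thesis
    using assms by (meson countable_image countable_lists countable_subset)
qed

text \<open>Each step multiplies by the leading coefficient instead of dividing by it, so nothing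
  leaves \<open>R\<close>, which may have zero divisors. The bound on \<open>r\<close> is stated
  through its coefficients because it must force \<open>r = 0\<close> when \<open>g\<close> is
  constant, where no degree is smaller.\<close>

lemma pseudo_division:
  fixes f g :: "'a::comm_ring_1 poly"
  assumes R: "is_subring R" and g: "g \<in> coeffs_in R" "g \<noteq> 0" and f: "f \<in> coeffs_in R"
  obtains k q r where "q \<in> coeffs_in R" "r \<in> coeffs_in R"
    "smult (lead_coeff g ^ k) f = g * q + r" "\<And>i. i \<ge> degree g \<Longrightarrow> coeff r i = 0"
proof -
  note R' = is_subringD[OF R] and C = is_subringD[OF is_subring_coeffs_in[OF R]]
  have lc: "lead_coeff g \<in> R" using g by (auto intro: coeffs_inD)
  have "\<exists>k q r. q \<in> coeffs_in R \<and> r \<in> coeffs_in R \<and> smult (lead_coeff g ^ k) f = g * q + r \<and>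
      (\<forall>i\<ge>degree g. coeff r i = 0)" if "f \<in> coeffs_in R" "\<forall>i\<ge>n. coeff f i = 0" for f n
    using that
  proof (induction n arbitrary: f)
    case 0
    then show ?case
      by (intro exI[of _ 0] exI[of _ "0 :: 'a poly"]) (auto intro: C simp: poly_eq_iff)
  next
    case (Suc n)
    show ?case
    proof (cases "n < degree g")
      case True
      then show ?thesis using Suc.prems
        by (intro exI[of _ 0] exI[of _ "0 :: 'a poly"] exI[of _ f]) (auto intro: C)
    next
      case False
      define h where "h = monom (coeff f n) (n - degree g)"
      define f1 where "f1 = smult (lead_coeff g) f - h * g"
      have h: "h \<in> coeffs_in R"
        unfolding h_def using Suc.prems by (intro coeffs_in_monom R) (auto intro: coeffs_inD)
      have f1: "f1 \<in> coeffs_in R"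
        unfolding f1_def by (intro C coeffs_in_smult R lc h g Suc.prems)
      have "coeff f1 i = 0" if i: "i \<ge> n" for i
      proof (cases "i = n")
        case True
        with False show ?thesis
          by (simp add: f1_def h_def coeff_monom_mult)
      next
        case False
        then have "i > n" using i by simp
        moreover have "coeff g (i - (n - degree g)) = 0"
          using \<open>\<not> n < degree g\<close> \<open>i > n\<close> by (intro coeff_eq_0) auto
        ultimately show ?thesis
          using Suc.prems by (simp add: f1_def h_def coeff_monom_mult)
      qed
      then obtain k q r where *: "q \<in> coeffs_in R" "r \<in> coeffs_in R"
          "smult (lead_coeff g ^ k) f1 = g * q + r" "\<forall>i\<ge>degree g. coeff r i = 0"
        using Suc.IH[OF f1] by blast
      have "smult (lead_coeff g ^ Suc k) f = smult (lead_coeff g ^ k) (f1 + h * g)"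
        by (simp add: f1_def mult.commute)
      also have "\<dots> = g * (q + smult (lead_coeff g ^ k) h) + r"
        by (simp add: *(3) smult_add_right algebra_simps)
      finally show ?thesis
        using * by (intro exI[of _ "Suc k"] exI[of _ "q + smult (lead_coeff g ^ k) h"] exI[of _ r] conjI)
          (auto intro!: C R' lc coeffs_in_smult[OF R] h)
    qed
  qed
  from this[OF f, of "Suc (degree f)"] show ?thesis
    using that by (metis coeff_eq_0 Suc_le_eq)
qed

section \<open>Polynomial functions\<close>

text \<open>Polynomials are represented by the functions they induce on sequences: the number of
  variables can then vary inside a proof, and substitution is composition. Over a field of
  characteristic zero the function determines the polynomial.\<close>

inductive_set poly_funs :: "'a::comm_ring_1 set \<Rightarrow> nat set \<Rightarrow> ((nat \<Rightarrow> 'a) \<Rightarrow> 'a) set"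
  for S V where
  const: "c \<in> S \<Longrightarrow> (\<lambda>x. c) \<in> poly_funs S V"
| var: "i \<in> V \<Longrightarrow> (\<lambda>x. x i) \<in> poly_funs S V"
| add: "f \<in> poly_funs S V \<Longrightarrow> g \<in> poly_funs S V \<Longrightarrow> (\<lambda>x. f x + g x) \<in> poly_funs S V"
| mult: "f \<in> poly_funs S V \<Longrightarrow> g \<in> poly_funs S V \<Longrightarrow> (\<lambda>x. f x * g x) \<in> poly_funs S V"

lemma poly_funs_mono: "f \<in> poly_funs S V \<Longrightarrow> S \<subseteq> S' \<Longrightarrow> V \<subseteq> V' \<Longrightarrow> f \<in> poly_funs S' V'"
  by (induction rule: poly_funs.induct) (auto intro: poly_funs.intros)

lemma poly_funs_cong: "f \<in> poly_funs S V \<Longrightarrow> (\<And>i. i \<in> V \<Longrightarrow> x i = y i) \<Longrightarrow> f x = f y"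
  by (induction rule: poly_funs.induct) auto

lemma poly_funs_diff:
  assumes "is_subring S" "f \<in> poly_funs S V" "g \<in> poly_funs S V"
  shows "(\<lambda>x. f x - g x) \<in> poly_funs S V"
proof -
  have "(\<lambda>x. f x + (\<lambda>x. - 1) x * g x) \<in> poly_funs S V"
    using assms is_subringD[OF assms(1)] by (intro poly_funs.intros) auto
  then show ?thesis by simp
qed

lemma is_subring_poly_funs:
  assumes "is_subring S"
  shows "is_subring (poly_funs S V)"
  unfolding is_subring_def
  by (auto simp: one_fun_def fun_diff_def times_fun_def
      intro!: poly_funs.intros poly_funs_diff[OF assms] is_subringD[OF assms])

lemma poly_funs_power:
  assumes "is_subring S" "f \<in> poly_funs S V"
  shows "(\<lambda>x. f x ^ n) \<in> poly_funs S V"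
proof (induction n)
  case 0
  then show ?case using is_subringD[OF assms(1)] by (auto intro: poly_funs.const)
next
  case (Suc n)
  then show ?case using assms by (auto intro: poly_funs.mult)
qed

lemma poly_funs_sum:
  assumes "is_subring S" "\<And>i. i \<in> A \<Longrightarrow> f i \<in> poly_funs S V"
  shows "(\<lambda>x. \<Sum>i\<in>A. f i x) \<in> poly_funs S V"
  using assms(2)
  by (induction A rule: infinite_finite_induct)
    (auto intro: poly_funs.intros is_subringD[OF assms(1)])

lemma poly_funs_prod:
  assumes "is_subring S" "\<And>i. i \<in> A \<Longrightarrow> f i \<in> poly_funs S V"
  shows "(\<lambda>x. \<Prod>i\<in>A. f i x) \<in> poly_funs S V"
  using assms(2)
  by (induction A rule: infinite_finite_induct)
    (auto intro: poly_funs.intros is_subringD[OF assms(1)])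

lemma poly_funs_subst:
  assumes "f \<in> poly_funs S V" "\<And>i. i \<in> V \<Longrightarrow> g i \<in> poly_funs S W"
  shows "(\<lambda>x. f (\<lambda>i. g i x)) \<in> poly_funs S W"
  using assms(1) by (induction rule: poly_funs.induct) (auto intro: poly_funs.intros assms(2))

lemma poly_funs_mem:
  assumes "is_subring S" "f \<in> poly_funs S V" "\<And>i. i \<in> V \<Longrightarrow> x i \<in> S"
  shows "f x \<in> S"
  using assms(2) by (induction rule: poly_funs.induct) (auto intro: assms(3) is_subringD[OF assms(1)])

text \<open>The functions that serve as coefficients form a ring with zero divisors. Freezing them
  at a point gives a polynomial over the base ring, in the applications a domain, where roots,
  degrees and divisibility behave.\<close>

definition spec :: "(('b \<Rightarrow> 'a) \<Rightarrow> 'c::comm_ring_1) poly \<Rightarrow> ('b \<Rightarrow> 'a) \<Rightarrow> 'c poly"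
  where "spec p x = map_poly (\<lambda>c. c x) p"

lemma coeff_spec [simp]: "coeff (spec p x) i = coeff p i x"
  by (simp add: spec_def coeff_map_poly)

lemma sum_apply: "(\<Sum>i\<in>A. f i) x = (\<Sum>i\<in>A. f i x)"
  for f :: "'b \<Rightarrow> 'c \<Rightarrow> 'd::comm_monoid_add"
  by (induction A rule: infinite_finite_induct) auto

lemma spec_simps [simp]:
  "spec 0 x = 0" "spec 1 x = 1" "spec (p + q) x = spec p x + spec q x" "spec (p - q) x = spec p x - spec q x"
  "spec (smult c p) x = smult (c x) (spec p x)" "spec (p * q) x = spec p x * spec q x"
  "spec (pCons c p) x = pCons (c x) (spec p x)"
  by (auto simp: poly_eq_iff coeff_mult sum_apply coeff_pCons coeff_1 one_fun_def split: nat.split)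

lemma spec_cong:
  "p \<in> coeffs_in (poly_funs S V) \<Longrightarrow> (\<And>i. i \<in> V \<Longrightarrow> x i = y i) \<Longrightarrow> spec p x = spec p y"
  by (auto simp: poly_eq_iff intro: poly_funs_cong[OF coeffs_inD])

lemma degree_spec: "lead_coeff p x \<noteq> 0 \<Longrightarrow> degree (spec p x) = degree p"
  by (intro antisym degree_le le_degree) (auto simp: coeff_eq_0)

lemma poly_spec: "poly (spec p x) s = (\<Sum>i\<le>degree p. coeff p i x * s ^ i)"
proof -
  have "degree (spec p x) \<le> degree p"
    by (auto intro: degree_le simp: coeff_eq_0)
  then show ?thesis
    unfolding poly_altdef coeff_spec
    by (intro sum.mono_neutral_left) (auto simp: coeff_eq_0 not_le simp flip: coeff_spec)
qed

text \<open>For \<open>v \<notin> V\<close> the coefficients do not depend on \<open>x v\<close>, so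
  \<open>spec p x\<close> stays fixed while that coordinate moves. Elimination and inductions on the
  number of variables rest on this.\<close>

lemma poly_funs_expand:
  assumes S: "is_subring S" and f: "f \<in> poly_funs S (insert v V)"
  obtains p where "p \<in> coeffs_in (poly_funs S V)" "\<And>x. f x = poly (spec p x) (x v)"
proof -
  let ?R = "poly_funs S V"
  have R: "is_subring ?R" using S by (rule is_subring_poly_funs)
  note C = is_subringD[OF is_subring_coeffs_in[OF R]] is_subringD[OF R]
  have "\<exists>p \<in> coeffs_in ?R. \<forall>x. f x = poly (spec p x) (x v)"
    using f
  proof (induction rule: poly_funs.induct)
    case (const c)
    then show ?case
      by (intro bexI[of _ "[:\<lambda>x. c:]"] coeffs_in_pCons coeffs_in_0 R) (auto intro: poly_funs.const)
  next
    case (var i)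
    show ?case
    proof (cases "i = v")
      case True
      then show ?thesis
        by (intro bexI[of _ "[:0, 1:]"] coeffs_in_pCons coeffs_in_0 R C) (auto simp: zero_fun_def one_fun_def)
    next
      case False
      then show ?thesis using var
        by (intro bexI[of _ "[:\<lambda>x. x i:]"] coeffs_in_pCons coeffs_in_0 R) (auto intro: poly_funs.var)
    qed
  next
    case (add f g)
    then show ?case using C(6) by (metis poly_add spec_simps(3))
  next
    case (mult f g)
    then show ?case using C(4) by (metis poly_mult spec_simps(6))
  qed
  then show ?thesis using that by blast
qed

lemma poly_funs_poly_spec:
  assumes S: "is_subring S" and p: "p \<in> coeffs_in (poly_funs S V)" and g: "g \<in> poly_funs S V"
  shows "(\<lambda>x. poly (spec p x) (g x)) \<in> poly_funs S V"
proof -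
  have "(\<lambda>x. poly (spec p x) (g x)) = (\<lambda>x. \<Sum>i\<le>degree p. coeff p i x * g x ^ i)"
    by (simp add: poly_spec)
  also have "\<dots> \<in> poly_funs S V"
    using p by (intro poly_funs_sum S poly_funs.mult poly_funs_power g) (auto intro: coeffs_inD)
  finally show ?thesis .
qed

lemma poly_eqI_nonzero:
  fixes p q :: "'a::{idom,ring_char_0} poly"
  assumes "\<And>t. t \<noteq> 0 \<Longrightarrow> poly p t = poly q t"
  shows "p = q"
proof -
  have "UNIV - {0} \<subseteq> {t. poly (p - q) t = 0}" using assms by auto
  moreover have "infinite (UNIV - {0 :: 'a})" by (simp add: infinite_UNIV_char_0)
  ultimately have "infinite {t. poly (p - q) t = 0}" by (rule infinite_super)
  then have "p - q = 0" by (metis poly_roots_finite)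
  then show ?thesis by simp
qed

text \<open>Natural numbers lie in every subring and are preserved by every embedding, so checking
  an identity on them transfers it between fields. With one variable singled out, infinitely many
  natural roots kill every coefficient.\<close>

lemma poly_funs_eq_0_on_Nats:
  fixes f :: "(nat \<Rightarrow> 'a::{idom,ring_char_0}) \<Rightarrow> 'a"
  assumes "finite V" "f \<in> poly_funs UNIV V" "\<And>x. (\<And>i. x i \<in> \<nat>) \<Longrightarrow> f x = 0"
  shows "f x = 0"
  using assms
proof (induction V arbitrary: f x rule: finite_induct)
  case empty
  have "f x = f (\<lambda>_. 0)" by (rule poly_funs_cong[OF empty(1)]) auto
  then show ?case using empty(2)[of "\<lambda>_. 0"] by simp
next
  case (insert v V)
  obtain p where p: "p \<in> coeffs_in (poly_funs UNIV V)" "\<And>x. f x = poly (spec p x) (x v)"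
    using poly_funs_expand[OF is_subring_UNIV insert.prems(1)] by blast
  have "spec p x = 0" if x: "\<And>i. x i \<in> \<nat>" for x
  proof (rule ccontr)
    assume nz: "spec p x \<noteq> 0"
    have "poly (spec p x) (of_nat m) = 0" for m
    proof -
      have "spec p (x(v := of_nat m)) = spec p x"
        using p(1) insert.hyps by (intro spec_cong) auto
      moreover have "f (x(v := of_nat m)) = 0"
        using x by (intro insert.prems(2)) auto
      ultimately show ?thesis by (simp add: p(2))
    qed
    then have "range (of_nat :: nat \<Rightarrow> 'a) \<subseteq> {t. poly (spec p x) t = 0}" by auto
    moreover have "infinite (range (of_nat :: nat \<Rightarrow> 'a))"
      by (simp add: infinite_UNIV_nat finite_image_iff inj_of_nat)
    ultimately show False using poly_roots_finite[OF nz] finite_subset by blast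
  qed
  then have "coeff p i x = 0" if "\<And>i. x i \<in> \<nat>" for x i
    using that by (metis coeff_0 coeff_spec)
  then have "coeff p i x = 0" for x i
    using insert.IH[OF coeffs_inD[OF p(1)]] by blast
  then have "spec p x = 0" by (simp add: poly_eq_iff)
  then show ?case by (simp add: p(2))
qed

lemma poly_funs_line:
  assumes "f \<in> poly_funs UNIV V"
  obtains p where "\<And>t. f (\<lambda>i. a i + t * b i) = poly p t"
proof -
  have "\<exists>p. \<forall>t. f (\<lambda>i. a i + t * b i) = poly p t"
    using assms
  proof (induction rule: poly_funs.induct)
    case (const c)
    show ?case by (intro exI[of _ "[:c:]"]) auto
  next
    case (var i)
    show ?case by (intro exI[of _ "[:a i, b i:]"]) auto
  next
    case (add f g)
    then show ?case by (metis poly_add)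
  next
    case (mult f g)
    then show ?case by (metis poly_mult)
  qed
  then show ?thesis using that by blast
qed

text \<open>On the line through \<open>a\<close> and \<open>b\<close> both functions become nonzero
  polynomials in one variable. This is the absence of zero divisors among polynomial
  functions.\<close>

lemma poly_funs_mult_nonzero:
  fixes f g :: "(nat \<Rightarrow> 'a::{idom,ring_char_0}) \<Rightarrow> 'a"
  assumes "f \<in> poly_funs UNIV V" "g \<in> poly_funs UNIV V" "f a \<noteq> 0" "g b \<noteq> 0"
  obtains x where "f x \<noteq> 0" "g x \<noteq> 0"
proof -
  obtain p where p: "\<And>t. f (\<lambda>i. a i + t * (b i - a i)) = poly p t"
    using poly_funs_line[OF assms(1), of a "\<lambda>i. b i - a i"] by blast
  obtain q where q: "\<And>t. g (\<lambda>i. a i + t * (b i - a i)) = poly q t"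
    using poly_funs_line[OF assms(2), of a "\<lambda>i. b i - a i"] by blast
  have "poly p 0 \<noteq> 0" "poly q 1 \<noteq> 0"
    using p[of 0] q[of 1] assms by auto
  then have "p * q \<noteq> 0" by auto
  then have "poly (p * q) \<noteq> (\<lambda>x. 0)" using poly_all_0_iff_0 by metis
  then obtain t where "poly p t \<noteq> 0" "poly q t \<noteq> 0" by (auto simp: fun_eq_iff)
  then show ?thesis using that p q by metis
qed

lemma poly_funs_cancel:
  fixes f g :: "(nat \<Rightarrow> 'a::{idom,ring_char_0}) \<Rightarrow> 'a"
  assumes "f \<in> poly_funs UNIV V" "g \<in> poly_funs UNIV V" "\<And>x. g x * f x = 0" "g b \<noteq> 0"
  shows "f a = 0"
proof (rule ccontr)
  assume "f a \<noteq> 0"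
  from poly_funs_mult_nonzero[OF assms(1,2) this assms(4)] assms(3) show False by (metis mult_eq_0_iff)
qed

section \<open>Embeddings of countable subrings into the complex numbers\<close>

text \<open>\<open>\<sigma>\<close> is a total function, but only its values on \<open>S\<close> are
  constrained. Countability belongs to the notion so that after each extension some complex number
  still avoids the roots of all nonzero polynomials over the image.\<close>

definition ring_emb :: "'a::comm_ring_1 set \<Rightarrow> ('a \<Rightarrow> 'b::comm_ring_1) \<Rightarrow> bool"
  where "ring_emb S \<sigma> \<longleftrightarrow> is_subring S \<and> countable S \<and> \<sigma> 1 = 1 \<and>
    (\<forall>a\<in>S. \<forall>b\<in>S. \<sigma> (a - b) = \<sigma> a - \<sigma> b \<and> \<sigma> (a * b) = \<sigma> a * \<sigma> b) \<and>
    (\<forall>a\<in>S. \<sigma> a = 0 \<longrightarrow> a = 0)"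

lemma ring_embD:
  assumes "ring_emb S \<sigma>"
  shows "is_subring S" "countable S" "\<sigma> 1 = 1" "\<sigma> 0 = 0"
    "a \<in> S \<Longrightarrow> b \<in> S \<Longrightarrow> \<sigma> (a - b) = \<sigma> a - \<sigma> b"
    "a \<in> S \<Longrightarrow> b \<in> S \<Longrightarrow> \<sigma> (a * b) = \<sigma> a * \<sigma> b"
    "a \<in> S \<Longrightarrow> b \<in> S \<Longrightarrow> \<sigma> (a + b) = \<sigma> a + \<sigma> b"
    "a \<in> S \<Longrightarrow> \<sigma> (- a) = - \<sigma> a"
    "a \<in> S \<Longrightarrow> \<sigma> (a ^ n) = \<sigma> a ^ n"
    "a \<in> S \<Longrightarrow> \<sigma> a = 0 \<longleftrightarrow> a = 0"
    "\<sigma> (of_nat n) = of_nat n"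
proof -
  show S: "is_subring S" "countable S" and one: "\<sigma> 1 = 1"
    and diff: "\<And>a b. a \<in> S \<Longrightarrow> b \<in> S \<Longrightarrow> \<sigma> (a - b) = \<sigma> a - \<sigma> b"
    and mult: "\<And>a b. a \<in> S \<Longrightarrow> b \<in> S \<Longrightarrow> \<sigma> (a * b) = \<sigma> a * \<sigma> b"
    using assms by (auto simp: ring_emb_def)
  note S' = is_subringD[OF S(1)]
  show zero: "\<sigma> 0 = 0" using diff[OF S'(1) S'(1)] by simp
  show neg: "\<And>a. a \<in> S \<Longrightarrow> \<sigma> (- a) = - \<sigma> a" using diff[OF S'(2)] zero by simp
  show add: "\<And>a b. a \<in> S \<Longrightarrow> b \<in> S \<Longrightarrow> \<sigma> (a + b) = \<sigma> a + \<sigma> b"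
    using diff[OF _ S'(5)] neg by fastforce
  show "a \<in> S \<Longrightarrow> \<sigma> (a ^ n) = \<sigma> a ^ n" by (induction n) (auto simp: one mult S')
  show "a \<in> S \<Longrightarrow> \<sigma> a = 0 \<longleftrightarrow> a = 0" using assms zero by (auto simp: ring_emb_def)
  show "\<sigma> (of_nat n) = of_nat n" by (induction n) (auto simp: zero one add S')
qed

lemma ring_emb_sum:
  assumes "ring_emb S \<sigma>" "\<And>i. i \<in> A \<Longrightarrow> f i \<in> S"
  shows "\<sigma> (\<Sum>i\<in>A. f i) = (\<Sum>i\<in>A. \<sigma> (f i))"
  using assms(2)
  by (induction A rule: infinite_finite_induct)
    (simp_all add: ring_embD[OF assms(1)] is_subring_sum[OF ring_embD(1)[OF assms(1)]])

lemma ring_emb_prod: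
  assumes "ring_emb S \<sigma>" "\<And>i. i \<in> A \<Longrightarrow> f i \<in> S"
  shows "\<sigma> (\<Prod>i\<in>A. f i) = (\<Prod>i\<in>A. \<sigma> (f i))"
  using assms(2)
  by (induction A rule: infinite_finite_induct)
    (simp_all add: ring_embD[OF assms(1)] is_subring_prod[OF ring_embD(1)[OF assms(1)]])

lemma ring_emb_inj:
  assumes "ring_emb S \<sigma>" "a \<in> S" "b \<in> S" "\<sigma> a = \<sigma> b"
  shows "a = b"
proof -
  have "\<sigma> (a - b) = 0" using assms ring_embD(5)[OF assms(1)] by simp
  then have "a - b = 0"
    using assms ring_embD(10)[OF assms(1)] is_subringD(3)[OF ring_embD(1)[OF assms(1)]] by blast
  then show ?thesis by simp
qed

lemma ring_emb_map_poly:
  assumes \<sigma>: "ring_emb S \<sigma>" and p: "p \<in> coeffs_in S"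
  shows "q \<in> coeffs_in S \<Longrightarrow> map_poly \<sigma> (p + q) = map_poly \<sigma> p + map_poly \<sigma> q"
    "q \<in> coeffs_in S \<Longrightarrow> map_poly \<sigma> (p - q) = map_poly \<sigma> p - map_poly \<sigma> q"
    "q \<in> coeffs_in S \<Longrightarrow> map_poly \<sigma> (p * q) = map_poly \<sigma> p * map_poly \<sigma> q"
    "c \<in> S \<Longrightarrow> map_poly \<sigma> (smult c p) = smult (\<sigma> c) (map_poly \<sigma> p)"
    "map_poly \<sigma> p = 0 \<longleftrightarrow> p = 0" "degree (map_poly \<sigma> p) = degree p"
proof -
  note D = ring_embD[OF \<sigma>] and S = is_subringD[OF ring_embD(1)[OF \<sigma>]]
  have c: "coeff (map_poly \<sigma> q) i = \<sigma> (coeff q i)" for q i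
    by (simp add: coeff_map_poly D)
  have m: "coeff q i \<in> S" if "q \<in> coeffs_in S" for q i
    using that by (rule coeffs_inD)
  show "map_poly \<sigma> (p + q) = map_poly \<sigma> p + map_poly \<sigma> q" if "q \<in> coeffs_in S" for q
    using p that by (intro poly_eqI) (simp add: c D m)
  show "map_poly \<sigma> (p - q) = map_poly \<sigma> p - map_poly \<sigma> q" if "q \<in> coeffs_in S" for q
    using p that by (intro poly_eqI) (simp add: c D m)
  show "map_poly \<sigma> (p * q) = map_poly \<sigma> p * map_poly \<sigma> q" if "q \<in> coeffs_in S" for q
    using p that by (intro poly_eqI) (simp add: c coeff_mult ring_emb_sum[OF \<sigma>] D S m)
  show "c \<in> S \<Longrightarrow> map_poly \<sigma> (smult c p) = smult (\<sigma> c) (map_poly \<sigma> p)"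
    using p by (intro poly_eqI) (simp add: c D m)
  have z: "\<sigma> (coeff p i) = 0 \<longleftrightarrow> coeff p i = 0" for i
    using p by (simp add: D m)
  show "map_poly \<sigma> p = 0 \<longleftrightarrow> p = 0" by (simp add: poly_eq_iff c z)
  show "degree (map_poly \<sigma> p) = degree p" by (simp add: degree_def c z)
qed

lemma ring_emb_pderiv:
  fixes p :: "'a::idom poly" and \<sigma> :: "'a \<Rightarrow> 'b::idom"
  assumes \<sigma>: "ring_emb S \<sigma>" and p: "p \<in> coeffs_in S"
  shows "map_poly \<sigma> (pderiv p) = pderiv (map_poly \<sigma> p)"
proof -
  note D = ring_embD[OF \<sigma>] and S = is_subringD(8)[OF ring_embD(1)[OF \<sigma>]]
  have "\<sigma> (of_nat (Suc n) * coeff p (Suc n)) = of_nat (Suc n) * \<sigma> (coeff p (Suc n))" for n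
    using p by (simp only: D(6)[OF S coeffs_inD] D(11))
  then show "map_poly \<sigma> (pderiv p) = pderiv (map_poly \<sigma> p)"
    by (intro poly_eqI) (simp add: coeff_map_poly D(4) coeff_pderiv del: of_nat_Suc)
qed

text \<open>The larger ring consists of the values at \<open>\<alpha>\<close> of polynomials over
  \<open>S\<close>. One direction of \<open>iff\<close> makes the map that sends such a value to the
  value of the image polynomial at \<open>\<beta>\<close> well defined, the other makes it
  injective.\<close>

lemma ring_emb_adjoin:
  fixes \<sigma> :: "'a::comm_ring_1 \<Rightarrow> 'b::comm_ring_1"
  assumes \<sigma>: "ring_emb S \<sigma>"
    and iff: "\<And>p. p \<in> coeffs_in S \<Longrightarrow> poly p \<alpha> = 0 \<longleftrightarrow> poly (map_poly \<sigma> p) \<beta> = 0"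
  obtains S' \<sigma>' where "ring_emb S' \<sigma>'" "S \<subseteq> S'" "\<alpha> \<in> S'" "\<And>a. a \<in> S \<Longrightarrow> \<sigma>' a = \<sigma> a" "\<sigma>' \<alpha> = \<beta>"
proof -
  note D = ring_embD[OF \<sigma>] and S = is_subringD[OF ring_embD(1)[OF \<sigma>]]
  note C = is_subringD[OF is_subring_coeffs_in[OF D(1)]]
  define S' where "S' = (\<lambda>p. poly p \<alpha>) ` coeffs_in S"
  define \<sigma>' where "\<sigma>' z = poly (map_poly \<sigma> (SOME p. p \<in> coeffs_in S \<and> poly p \<alpha> = z)) \<beta>" for z
  have ev: "\<sigma>' (poly p \<alpha>) = poly (map_poly \<sigma> p) \<beta>" if p: "p \<in> coeffs_in S" for p
  proof -
    define q where "q = (SOME q. q \<in> coeffs_in S \<and> poly q \<alpha> = poly p \<alpha>)"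
    have q: "q \<in> coeffs_in S \<and> poly q \<alpha> = poly p \<alpha>"
      unfolding q_def by (rule someI[of _ p]) (use p in simp)
    then have "poly (map_poly \<sigma> (q - p)) \<beta> = 0"
      using iff[of "q - p"] C p by simp
    then show ?thesis
      using q p by (simp add: \<sigma>'_def q_def[symmetric] ring_emb_map_poly(2)[OF \<sigma>])
  qed
  have S'I: "poly p \<alpha> \<in> S'" if "p \<in> coeffs_in S" for p
    using that by (auto simp: S'_def)
  have sub: "is_subring S'"
    unfolding is_subring_def
  proof (intro conjI ballI)
    show "1 \<in> S'" using S'I[OF C(1)] by simp
    fix a b assume "a \<in> S'" "b \<in> S'"
    then obtain p q where "p \<in> coeffs_in S" "q \<in> coeffs_in S" "a = poly p \<alpha>" "b = poly q \<alpha>"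
      by (auto simp: S'_def)
    then show "a - b \<in> S'" "a * b \<in> S'"
      using S'I[OF C(3)[of p q]] S'I[OF C(4)[of p q]] by simp_all
  qed
  have "ring_emb S' \<sigma>'"
    unfolding ring_emb_def
  proof (intro conjI ballI sub)
    show "countable S'" unfolding S'_def using countable_coeffs_in[OF D(2)] by simp
    show "\<sigma>' 1 = 1" using ev[OF C(1)] D by simp
  next
    fix a b assume "a \<in> S'" "b \<in> S'"
    then obtain p q where pq: "p \<in> coeffs_in S" "q \<in> coeffs_in S" "a = poly p \<alpha>" "b = poly q \<alpha>"
      by (auto simp: S'_def)
    show "\<sigma>' (a - b) = \<sigma>' a - \<sigma>' b" "\<sigma>' (a * b) = \<sigma>' a * \<sigma>' b"
      using ev[OF C(3)[of p q]] ev[OF C(4)[of p q]] ev[of p] ev[of q] pq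
      by (simp_all add: ring_emb_map_poly[OF \<sigma>])
  next
    fix a assume "a \<in> S'"
    then show "\<sigma>' a = 0 \<longrightarrow> a = 0"
      using ev iff by (auto simp: S'_def)
  qed
  moreover have c: "[:a:] \<in> coeffs_in S" if "a \<in> S" for a
    using that by (intro coeffs_in_pCons coeffs_in_0 D)
  moreover have "[:0, 1:] \<in> coeffs_in S"
    by (intro coeffs_in_pCons coeffs_in_0 D S)
  moreover have mp: "map_poly \<sigma> [:a:] = [:\<sigma> a:]" "map_poly \<sigma> [:0, 1:] = [:0, 1:]" for a
    by (intro poly_eqI, simp add: coeff_map_poly coeff_pCons D split: nat.split)+
  ultimately show ?thesis
    using that[of S' \<sigma>'] S'I[of "[:0, 1:]"] ev[of "[:0, 1:]"] S'I[OF c] ev[OF c]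
    by (fastforce simp: mp)
qed

text \<open>
  If \<open>\<alpha>\<close> is algebraic over \<open>S\<close>, then \<open>\<beta>\<close> is a root of the image of a minimal polynomial; the roots of
  that image are distinct because the characteristic is zero.
\<close>

lemma exists_conjugate:
  fixes \<sigma> :: "'a::field_char_0 \<Rightarrow> complex"
  assumes \<sigma>: "ring_emb S \<sigma>"
  obtains \<beta> where "\<And>p. p \<in> coeffs_in S \<Longrightarrow> poly p \<alpha> = 0 \<longleftrightarrow> poly (map_poly \<sigma> p) \<beta> = 0"
    "(\<And>p q. p \<in> S \<Longrightarrow> q \<in> S \<Longrightarrow> q \<noteq> 0 \<Longrightarrow> q * \<alpha> \<noteq> p) \<Longrightarrow> \<beta> \<noteq> \<beta>0"
proof (cases "\<forall>p\<in>coeffs_in S. poly p \<alpha> = 0 \<longrightarrow> p = 0")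
  case True
  \<comment> \<open>In the transcendental case any number outside the countably many roots of the
    image polynomials will do; \<open>\<beta>0\<close> joins the exceptions.\<close>
  let ?B = "insert \<beta>0 (\<Union>p\<in>coeffs_in S - {0}. {t. poly (map_poly \<sigma> p) t = 0})"
  have "countable ?B"
  proof (intro countable_insert countable_UN)
    show "countable (coeffs_in S - {0})"
      using countable_coeffs_in[OF ring_embD(2)[OF \<sigma>]] by (rule countable_subset[rotated]) auto
    show "countable {t. poly (map_poly \<sigma> p) t = 0}" if "p \<in> coeffs_in S - {0}" for p
      using that by (intro countable_finite poly_roots_finite) (simp add: ring_emb_map_poly[OF \<sigma>])
  qed
  moreover have "\<not> countable (UNIV :: complex set)"
    using uncountable_UNIV_complex by simp
  ultimately obtain \<beta> where "\<beta> \<notin> ?B" by (metis UNIV_eq_I)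
  moreover have "poly p \<alpha> = 0 \<longleftrightarrow> poly (map_poly \<sigma> p) \<beta> = 0" if "p \<in> coeffs_in S" for p
    using that True \<open>\<beta> \<notin> ?B\<close> by (cases "p = 0") auto
  ultimately show ?thesis using that by blast
next
  case False
  note D = ring_embD[OF \<sigma>] and S = is_subringD[OF ring_embD(1)[OF \<sigma>]]
  note C = is_subringD[OF is_subring_coeffs_in[OF D(1)]]
  define m where "m = (LEAST m. \<exists>p\<in>coeffs_in S. p \<noteq> 0 \<and> poly p \<alpha> = 0 \<and> degree p = m)"
  have "\<exists>m. \<exists>p\<in>coeffs_in S. p \<noteq> 0 \<and> poly p \<alpha> = 0 \<and> degree p = m" using False by blast
  from LeastI_ex[OF this] obtain p0 where p0: "p0 \<in> coeffs_in S" "p0 \<noteq> 0" "poly p0 \<alpha> = 0" "degree p0 = m"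
    unfolding m_def by blast
  have min: "p = 0" if "p \<in> coeffs_in S" "poly p \<alpha> = 0" "degree p < m" for p
    using that not_less_Least unfolding m_def by blast
  have min': "p = 0" if p: "p \<in> coeffs_in S" "poly p \<alpha> = 0" "\<And>i. i \<ge> m \<Longrightarrow> coeff p i = 0" for p
    using min[of p] p by (metis leading_coeff_0_iff not_le)
  have m0: "m > 0"
  proof (rule ccontr)
    assume "\<not> m > 0"
    then obtain c where "p0 = [:c:]" using p0(4) degree_eq_zeroE by auto
    then show False using p0 by simp
  qed
  have root: "poly p \<alpha> = 0 \<longleftrightarrow> poly (map_poly \<sigma> p) \<beta> = 0"
    if \<beta>: "poly (map_poly \<sigma> p0) \<beta> = 0" and p: "p \<in> coeffs_in S" for p \<beta>
  proof -
    define c where "c = lead_coeff p0"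
    have c: "c \<in> S" "c \<noteq> 0" using p0 by (auto simp: c_def intro: coeffs_inD)
    have red: "\<exists>k. \<exists>r\<in>coeffs_in S. c ^ k * poly p \<alpha> = poly r \<alpha> \<and>
        \<sigma> c ^ k * poly (map_poly \<sigma> p) \<beta> = poly (map_poly \<sigma> r) \<beta> \<and> (\<forall>i\<ge>m. coeff r i = 0)"
      if p: "p \<in> coeffs_in S" for p
    proof -
      obtain k q r where *: "q \<in> coeffs_in S" "r \<in> coeffs_in S" "smult (c ^ k) p = p0 * q + r"
        "\<And>i. i \<ge> degree p0 \<Longrightarrow> coeff r i = 0"
        unfolding c_def using pseudo_division[OF D(1) p0(1,2) p] by metis
      have "smult (\<sigma> c ^ k) (map_poly \<sigma> p) = map_poly \<sigma> (smult (c ^ k) p)"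
        using c p by (simp add: ring_emb_map_poly[OF \<sigma>] D S)
      also have "\<dots> = map_poly \<sigma> p0 * map_poly \<sigma> q + map_poly \<sigma> r"
        using * p0 by (simp add: ring_emb_map_poly[OF \<sigma>] C)
      finally have "\<sigma> c ^ k * poly (map_poly \<sigma> p) \<beta> = poly (map_poly \<sigma> r) \<beta>"
        using \<beta> by (metis add_0 mult_zero_left poly_add poly_mult poly_smult)
      moreover have "c ^ k * poly p \<alpha> = poly r \<alpha>"
        using *(3) p0(3) by (metis add_0 mult_zero_left poly_add poly_mult poly_smult)
      ultimately show ?thesis using * p0(4) by blast
    qed
    have 1: "poly (map_poly \<sigma> p) \<beta> = 0" if p: "p \<in> coeffs_in S" "poly p \<alpha> = 0" for p
    proof -
      obtain k r where r: "r \<in> coeffs_in S" "c ^ k * poly p \<alpha> = poly r \<alpha>"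
        "\<sigma> c ^ k * poly (map_poly \<sigma> p) \<beta> = poly (map_poly \<sigma> r) \<beta>" "\<forall>i\<ge>m. coeff r i = 0"
        using red[OF p(1)] by blast
      then have "r = 0" using min' p by simp
      then show ?thesis using r c by (simp add: D)
    qed
    \<comment> \<open>Euclid's argument: if the image of \<open>p\<close> vanishes at
      \<open>\<beta>\<close>, so does the image of the remainder of \<open>p0\<close> modulo
      \<open>p\<close>. By induction the remainder vanishes at \<open>\<alpha>\<close>, hence is
      zero by minimality. Then \<open>p\<close> divides a multiple of \<open>p0\<close>, and since
      \<open>p\<close> is nonzero at \<open>\<alpha>\<close>, the cofactor \<open>q\<close>
      annihilates \<open>\<alpha>\<close> with too small a degree.\<close>
    have 2: "poly (map_poly \<sigma> p) \<beta> \<noteq> 0" if "p \<in> coeffs_in S" "poly p \<alpha> \<noteq> 0" "\<forall>i\<ge>n. coeff p i = 0" "n \<le> m" for p n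
      using that
    proof (induction n arbitrary: p rule: less_induct)
      case (less n)
      show ?case
      proof
        assume z: "poly (map_poly \<sigma> p) \<beta> = 0"
        have nz: "p \<noteq> 0" using less.prems by auto
        have dn: "degree p < n" using less.prems(3) nz by (metis leading_coeff_0_iff not_le)
        have lc: "lead_coeff p \<in> S" using less.prems by (auto intro: coeffs_inD)
        obtain k q r where *: "q \<in> coeffs_in S" "r \<in> coeffs_in S" "smult (lead_coeff p ^ k) p0 = p * q + r"
          "\<And>i. i \<ge> degree p \<Longrightarrow> coeff r i = 0"
          using pseudo_division[OF D(1) less.prems(1) nz p0(1)] by metis
        have "map_poly \<sigma> (smult (lead_coeff p ^ k) p0) = map_poly \<sigma> p * map_poly \<sigma> q + map_poly \<sigma> r"
          using * less.prems by (simp add: ring_emb_map_poly[OF \<sigma>] C)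
        moreover have "map_poly \<sigma> (smult (lead_coeff p ^ k) p0) = smult (\<sigma> (lead_coeff p ^ k)) (map_poly \<sigma> p0)"
          using lc p0 by (simp add: ring_emb_map_poly[OF \<sigma>] D S)
        ultimately have "poly (map_poly \<sigma> r) \<beta> = 0"
          using \<beta> z by (metis add_0 mult_zero_left mult_zero_right poly_add poly_mult poly_smult)
        then have r\<alpha>: "poly r \<alpha> = 0"
          using less.IH[OF dn *(2)] * dn less.prems(4) by (metis less_imp_le_nat order_trans)
        have "r = 0"
          using *(4) dn less.prems(4) by (intro min'[OF *(2) r\<alpha>]) auto
        have "poly p \<alpha> * poly q \<alpha> = 0"
          using *(3) p0(3) r\<alpha> by (metis add.right_neutral mult_zero_right poly_add poly_mult poly_smult)
        then have q\<alpha>: "poly q \<alpha> = 0" using less.prems by simp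
        have eq: "smult (lead_coeff p ^ k) p0 = p * q" using * \<open>r = 0\<close> by simp
        have "q \<noteq> 0" using eq nz p0 by auto
        have "degree p > 0"
        proof (rule ccontr)
          assume "\<not> degree p > 0"
          then obtain a where a: "p = [:a:]" using degree_eq_zeroE by auto
          then have "a \<in> S" using less.prems(1) by (metis coeff_pCons_0 coeffs_inD)
          then show False using z a nz by (simp add: map_poly_pCons D)
        qed
        moreover have "degree p0 = degree p + degree q"
          using arg_cong[OF eq, of degree] nz \<open>q \<noteq> 0\<close> by (simp add: degree_mult_eq)
        ultimately have "degree q < m" using p0(4) by simp
        then show False using min[OF *(1) q\<alpha>] \<open>q \<noteq> 0\<close> by simp
      qed
    qed
    show ?thesis
    proof
      assume z: "poly (map_poly \<sigma> p) \<beta> = 0"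
      obtain k r where r: "r \<in> coeffs_in S" "c ^ k * poly p \<alpha> = poly r \<alpha>"
        "\<sigma> c ^ k * poly (map_poly \<sigma> p) \<beta> = poly (map_poly \<sigma> r) \<beta>" "\<forall>i\<ge>m. coeff r i = 0"
        using red[OF p] by blast
      have "poly r \<alpha> = 0" using 2[OF r(1) _ r(4)] r(3) z by auto
      then show "poly p \<alpha> = 0" using r(2) c by simp
    qed (rule 1[OF p])
  qed
  have deg: "degree (map_poly \<sigma> p0) = m" using p0 by (simp add: ring_emb_map_poly[OF \<sigma>])
  then have "\<not> constant (poly (map_poly \<sigma> p0))" using m0 by (simp add: constant_degree)
  then obtain \<beta>1 where \<beta>1: "poly (map_poly \<sigma> p0) \<beta>1 = 0" using fundamental_theorem_of_algebra by blast
  show ?thesis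
  proof (cases "m = 1")
    case True
    \<comment> \<open>With a linear minimal polynomial \<open>\<alpha>\<close> is a quotient of
      elements of \<open>S\<close>, and then no value has to be avoided.\<close>
    have "\<exists>p\<in>S. \<exists>q\<in>S. q \<noteq> 0 \<and> q * \<alpha> = p"
    proof (intro bexI conjI)
      have "p0 = [:coeff p0 0, coeff p0 1:]"
        using p0(4) True by (intro poly_eqI) (auto simp: coeff_pCons coeff_eq_0 split: nat.split)
      then have "poly p0 \<alpha> = coeff p0 0 + \<alpha> * coeff p0 1" by (metis (no_types) poly_pCons poly_0 mult_zero_right add.right_neutral)
      then show "coeff p0 1 * \<alpha> = - coeff p0 0" using p0(3) by (simp add: eq_neg_iff_add_eq_0 mult.commute add.commute)
      show "coeff p0 1 \<noteq> 0" using p0 True by (metis leading_coeff_0_iff)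
    qed (use p0 in \<open>auto intro!: S intro: coeffs_inD\<close>)
    then show ?thesis using that[of \<beta>1] root[OF \<beta>1] by blast
  next
    case False
    have "\<exists>\<beta>. poly (map_poly \<sigma> p0) \<beta> = 0 \<and> \<beta> \<noteq> \<beta>0"
    proof (cases "poly (map_poly \<sigma> p0) \<beta>0 = 0")
      case True
      have pd: "pderiv p0 \<in> coeffs_in S"
        using p0(1) by (intro coeffs_inI) (simp only: coeff_pderiv, intro S, auto intro: coeffs_inD)
      have "poly (pderiv p0) \<alpha> \<noteq> 0"
        using min[OF pd] p0(4) m0 by (auto simp: degree_pderiv pderiv_eq_0_iff)
      then have nz: "poly (pderiv (map_poly \<sigma> p0)) \<beta>0 \<noteq> 0"
        using root[OF True pd] p0(1) by (simp add: ring_emb_pderiv[OF \<sigma>])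
      obtain h where h: "map_poly \<sigma> p0 = [:- \<beta>0, 1:] * h"
        using True by (metis dvdE poly_eq_0_iff_dvd)
      \<comment> \<open>The derivative of \<open>(X - \<beta>0) * h\<close> at
        \<open>\<beta>0\<close> is the value of \<open>h\<close> there, so the roots of
        \<open>h\<close> differ from \<open>\<beta>0\<close>.\<close>
      have h0: "poly h \<beta>0 \<noteq> 0" using nz unfolding h pderiv_mult by (simp add: pderiv_pCons)
      have "h \<noteq> 0" using h0 by auto
      then have "degree h = m - 1" using deg by (simp add: h degree_mult_eq del: mult_pCons_left)
      then have "\<not> constant (poly h)" using m0 \<open>m \<noteq> 1\<close> by (simp add: constant_degree)
      then obtain \<beta> where "poly h \<beta> = 0" using fundamental_theorem_of_algebra by blast
      then show ?thesis using h h0 by (metis mult_zero_right poly_mult)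
    qed (use \<beta>1 in auto)
    then show ?thesis using that root by blast
  qed
qed

lemma ring_emb_extend:
  fixes \<sigma> :: "'a::field_char_0 \<Rightarrow> complex"
  assumes "ring_emb S \<sigma>"
  obtains S' \<sigma>' where "ring_emb S' \<sigma>'" "S \<subseteq> S'" "\<alpha> \<in> S'" "\<And>a. a \<in> S \<Longrightarrow> \<sigma>' a = \<sigma> a"
    "(\<And>p q. p \<in> S \<Longrightarrow> q \<in> S \<Longrightarrow> q \<noteq> 0 \<Longrightarrow> q * \<alpha> \<noteq> p) \<Longrightarrow> \<sigma>' \<alpha> \<noteq> \<beta>0"
proof -
  obtain \<beta> where \<beta>: "\<And>p. p \<in> coeffs_in S \<Longrightarrow> poly p \<alpha> = 0 \<longleftrightarrow> poly (map_poly \<sigma> p) \<beta> = 0"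
    "(\<And>p q. p \<in> S \<Longrightarrow> q \<in> S \<Longrightarrow> q \<noteq> 0 \<Longrightarrow> q * \<alpha> \<noteq> p) \<Longrightarrow> \<beta> \<noteq> \<beta>0"
    using exists_conjugate[OF assms] by metis
  show ?thesis
    by (rule ring_emb_adjoin[OF assms \<beta>(1)]) (use that \<beta>(2) in \<open>auto\<close>)
qed

lemma ring_emb_extend_finite:
  fixes \<sigma> :: "'a::field_char_0 \<Rightarrow> complex"
  assumes "finite A" "ring_emb S \<sigma>"
  obtains S' \<sigma>' where "ring_emb S' \<sigma>'" "S \<subseteq> S'" "A \<subseteq> S'" "\<And>a. a \<in> S \<Longrightarrow> \<sigma>' a = \<sigma> a"
proof -
  have "\<exists>S' \<sigma>'. ring_emb S' \<sigma>' \<and> S \<subseteq> S' \<and> A \<subseteq> S' \<and> (\<forall>a\<in>S. \<sigma>' a = \<sigma> a)"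
    using assms(1)
  proof (induction A)
    case empty
    then show ?case using assms(2) by blast
  next
    case (insert \<alpha> A)
    then obtain S1 \<sigma>1 where 1: "ring_emb S1 \<sigma>1" "S \<subseteq> S1" "A \<subseteq> S1" "\<forall>a\<in>S. \<sigma>1 a = \<sigma> a" by blast
    obtain S2 \<sigma>2 where 2: "ring_emb S2 \<sigma>2" "S1 \<subseteq> S2" "\<alpha> \<in> S2" "\<And>a. a \<in> S1 \<Longrightarrow> \<sigma>2 a = \<sigma>1 a"
      using ring_emb_extend[OF 1(1)] by metis
    show ?case
      by (intro exI[of _ S2] exI[of _ \<sigma>2] conjI ballI) (use 1 2 in auto)
  qed
  then show ?thesis using that by blast
qed

lemma ring_emb_Ints:
  obtains \<sigma> where "ring_emb (\<int> :: 'a::field_char_0 set) (\<sigma> :: 'a \<Rightarrow> complex)"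
proof
  define \<sigma> :: "'a \<Rightarrow> complex" where "\<sigma> a = of_int (THE i. a = of_int i)" for a
  have \<sigma>: "\<sigma> (of_int i) = of_int i" for i
    by (simp add: \<sigma>_def)
  show "ring_emb \<int> \<sigma>"
    unfolding ring_emb_def is_subring_def
  proof (intro conjI ballI)
    show "countable (\<int> :: 'a set)" unfolding Ints_def by simp
    show "\<sigma> 1 = 1" using \<sigma>[of 1] by simp
    fix a b :: 'a assume "a \<in> \<int>" "b \<in> \<int>"
    then obtain i j where "a = of_int i" "b = of_int j" by (metis Ints_cases)
    then show "\<sigma> (a - b) = \<sigma> a - \<sigma> b" "\<sigma> (a * b) = \<sigma> a * \<sigma> b"
      by (simp_all add: \<sigma> flip: of_int_diff of_int_mult)
  next
    fix a :: 'a assume "a \<in> \<int>"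
    then obtain i where "a = of_int i" by (metis Ints_cases)
    then show "\<sigma> a = 0 \<longrightarrow> a = 0" by (simp add: \<sigma>)
  qed auto
qed

lemma exists_ring_emb:
  fixes A :: "'a::field_char_0 set"
  assumes "finite A"
  obtains S and \<sigma> :: "'a \<Rightarrow> complex" where "ring_emb S \<sigma>" "A \<subseteq> S"
  using ring_emb_Ints ring_emb_extend_finite[OF assms] by metis

section \<open>Injective polynomial maps are birational\<close>

text \<open>Points are sequences; the coordinates from \<open>n\<close> on carry no meaning and are
  ignored on both sides.\<close>

definition coord_inj :: "nat \<Rightarrow> (nat \<Rightarrow> (nat \<Rightarrow> 'a) \<Rightarrow> 'a) \<Rightarrow> bool"
  where "coord_inj n F \<longleftrightarrow> (\<forall>x y. (\<forall>j<n. F j x = F j y) \<longrightarrow> (\<forall>i<n. x i = y i))"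

lemma coord_injD:
  assumes "coord_inj n F" "\<And>j. j < n \<Longrightarrow> F j x = F j y" "i < n"
  shows "x i = y i"
  using assms by (auto simp: coord_inj_def)

lemma ring_emb_ident: "is_subring S \<Longrightarrow> countable S \<Longrightarrow> ring_emb S (\<lambda>a. a)"
  by (simp add: ring_emb_def is_subring_def)

lemma countable_subring_extend:
  fixes S :: "complex set"
  assumes "is_subring S" "countable S" "finite A"
  obtains S' where "is_subring S'" "countable S'" "S \<subseteq> S'" "A \<subseteq> S'"
  using ring_emb_extend_finite[OF assms(3) ring_emb_ident[OF assms(1,2)]] ring_embD(1,2) by metis

text \<open>The coordinates are chosen one after another, each outside the countably many roots of
  nonzero polynomials over a countable ring that contains \<open>S\<close> and the earlier
  coordinates. They are algebraically independent over \<open>S\<close>, so an equation at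
  \<open>x\<close> is an identity.\<close>

lemma generic_point:
  fixes S :: "complex set"
  assumes S: "is_subring S" "countable S"
  obtains x where "\<And>f z. f \<in> poly_funs S {..<n} \<Longrightarrow> f x = 0 \<Longrightarrow> f z = 0"
proof -
  have "\<exists>x. \<forall>f\<in>poly_funs S {..<n}. f x = 0 \<longrightarrow> (\<forall>z. f z = 0)"
  proof (induction n)
    case 0
    have "f x = f z" if "f \<in> poly_funs S {..<0}" for f x z
      using that by (rule poly_funs_cong) simp
    then show ?case by metis
  next
    case (Suc n)
    then obtain x where x: "\<And>f z. f \<in> poly_funs S {..<n} \<Longrightarrow> f x = 0 \<Longrightarrow> f z = 0" by blast
    obtain S' where S': "is_subring S'" "countable S'" "S \<subseteq> S'" "x ` {..<n} \<subseteq> S'"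
      using countable_subring_extend[OF S, of "x ` {..<n}"] by auto
    have "countable (\<Union>p\<in>coeffs_in S' - {0}. {t. poly p t = 0})"
    proof (intro countable_UN)
      show "countable (coeffs_in S' - {0})"
        using countable_coeffs_in[OF S'(2)] by (rule countable_subset[rotated]) auto
    qed (auto intro: countable_finite poly_roots_finite)
    then obtain t where t: "t \<notin> (\<Union>p\<in>coeffs_in S' - {0}. {t. poly p t = 0})"
      using uncountable_UNIV_complex by (metis UNIV_eq_I)
    have "f z = 0" if f: "f \<in> poly_funs S {..<Suc n}" "f (x(n := t)) = 0" for f z
    proof -
      obtain p where p: "p \<in> coeffs_in (poly_funs S {..<n})" "\<And>x. f x = poly (spec p x) (x n)"
        using poly_funs_expand[OF S(1), of f n "{..<n}"] f(1) by (metis lessThan_Suc)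
      have "spec p (x(n := t)) = spec p x"
        using p(1) by (rule spec_cong) auto
      then have "poly (spec p x) t = 0" using p(2) f(2) by simp
      moreover have "spec p x \<in> coeffs_in S'"
      proof
        fix i
        have "coeff p i \<in> poly_funs S' {..<n}"
          using coeffs_inD[OF p(1)] S'(3) poly_funs_mono by blast
        then show "coeff (spec p x) i \<in> S'"
          unfolding coeff_spec by (rule poly_funs_mem[OF S'(1)]) (use S'(4) in auto)
      qed
      ultimately have "spec p x = 0" using t by blast
      then have "coeff p i x = 0" for i by (metis coeff_0 coeff_spec)
      then have "coeff p i z = 0" for i using x coeffs_inD[OF p(1)] by blast
      then have "spec p z = 0" by (simp add: poly_eq_iff)
      then show "f z = 0" by (simp add: p(2))
    qed
    then show ?case by blast
  qed
  then show ?thesis using that by blast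
qed

lemma ring_emb_poly_funs:
  assumes \<sigma>: "ring_emb S' \<sigma>" and "S \<subseteq> S'" "\<And>a. a \<in> S \<Longrightarrow> \<sigma> a = a" and x: "\<And>i. i \<in> V \<Longrightarrow> x i \<in> S'"
    and f: "f \<in> poly_funs S V"
  shows "\<sigma> (f x) = f (\<lambda>i. \<sigma> (x i))"
proof -
  have m: "g x \<in> S'" if "g \<in> poly_funs S V" for g
    by (rule poly_funs_mem[OF ring_embD(1)[OF \<sigma>] poly_funs_mono[OF that \<open>S \<subseteq> S'\<close> order_refl]]) (rule x)
  show ?thesis
    using f by (induction rule: poly_funs.induct) (simp_all add: assms(3) ring_embD[OF \<sigma>] m)
qed

text \<open>
  For a generic point \<open>x\<close>, an \<open>x\<^sub>i\<close> outside the field generated by \<open>F(x)\<close> could be moved by an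
  embedding that fixes \<open>F(x)\<close>, and this would give a second preimage of \<open>F(x)\<close>.
\<close>

lemma inj_polynomial_map_birational:
  fixes S :: "complex set"
  assumes S: "is_subring S" "countable S"
    and F: "\<And>j. j < n \<Longrightarrow> F j \<in> poly_funs S {..<n}"
    and inj: "coord_inj n F"
    and i: "i < n"
  obtains Q P y where "Q \<in> poly_funs UNIV {..<n}" "P \<in> poly_funs UNIV {..<n}" "Q y \<noteq> 0"
    "\<And>z. Q (\<lambda>j. F j z) * z i = P (\<lambda>j. F j z)"
proof -
  obtain x where x: "\<And>f z. f \<in> poly_funs S {..<n} \<Longrightarrow> f x = 0 \<Longrightarrow> f z = 0"
    using generic_point[OF S] by metis
  define y where "y = (\<lambda>j. F j x)"
  \<comment> \<open>The ring generated by \<open>S\<close> and the coordinates of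
    \<open>F(x)\<close>.\<close>
  define Sy where "Sy = (\<lambda>f. f y) ` poly_funs S {..<n}"
  obtain S1 where S1: "is_subring S1" "countable S1" "S \<subseteq> S1" "x ` {..<n} \<subseteq> S1"
    using countable_subring_extend[OF S, of "x ` {..<n}"] by auto
  have Fx: "f x \<in> S1" if "f \<in> poly_funs S {..<n}" for f
    by (rule poly_funs_mem[OF S1(1) poly_funs_mono[OF that S1(3) order_refl]]) (use S1(4) in auto)
  have "f y \<in> S1" if "f \<in> poly_funs S {..<n}" for f
    by (rule poly_funs_mem[OF S1(1) poly_funs_mono[OF that S1(3) order_refl]])
      (use Fx[OF F] in \<open>auto simp: y_def\<close>)
  then have "Sy \<subseteq> S1" by (auto simp: Sy_def)
  then have "countable Sy" using S1(2) countable_subset by blast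
  moreover have "is_subring Sy"
    unfolding is_subring_def
  proof (intro conjI ballI)
    note R = is_subringD[OF is_subring_poly_funs[OF S(1), of "{..<n}"]]
    show "1 \<in> Sy" unfolding Sy_def by (rule image_eqI[OF _ R(1)]) (simp add: one_fun_def)
    fix a b assume "a \<in> Sy" "b \<in> Sy"
    then obtain f g where "f \<in> poly_funs S {..<n}" "g \<in> poly_funs S {..<n}" "a = f y" "b = g y"
      by (auto simp: Sy_def)
    then show "a - b \<in> Sy" "a * b \<in> Sy"
      unfolding Sy_def using R(3)[of f g] R(4)[of f g]
      by (auto intro: image_eqI[of _ _ "f - g"] image_eqI[of _ _ "f * g"])
  qed
  ultimately have emb: "ring_emb Sy (\<lambda>a. a)" by (intro ring_emb_ident)
  have "\<exists>p\<in>Sy. \<exists>q\<in>Sy. q \<noteq> 0 \<and> q * x i = p"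
  proof (rule ccontr)
    assume *: "\<not> ?thesis"
    \<comment> \<open>The coordinate \<open>x i\<close> is adjoined first, while the domain is still
      \<open>Sy\<close>, because only there is it known not to be a quotient; the remaining
      coordinates follow.\<close>
    obtain S2 \<sigma>2 where 2: "ring_emb S2 \<sigma>2" "Sy \<subseteq> S2" "x i \<in> S2" "\<And>a. a \<in> Sy \<Longrightarrow> \<sigma>2 a = a"
      "(\<And>p q. p \<in> Sy \<Longrightarrow> q \<in> Sy \<Longrightarrow> q \<noteq> 0 \<Longrightarrow> q * x i \<noteq> p) \<Longrightarrow> \<sigma>2 (x i) \<noteq> x i"
      by (rule ring_emb_extend[OF emb, of "x i" "x i"]) blast
    obtain S3 \<sigma>3 where 3: "ring_emb S3 \<sigma>3" "S2 \<subseteq> S3" "x ` {..<n} \<subseteq> S3" "\<And>a. a \<in> S2 \<Longrightarrow> \<sigma>3 a = \<sigma>2 a"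
      using ring_emb_extend_finite[OF _ 2(1), of "x ` {..<n}"] by auto
    have S_Sy: "S \<subseteq> Sy"
      unfolding Sy_def by (auto intro: image_eqI[OF _ poly_funs.const])
    have fx: "\<sigma>3 a = a" if "a \<in> Sy" for a
      using that 2(2,4) 3(4) by (metis subsetD)
    have "F j (\<lambda>i. \<sigma>3 (x i)) = F j x" if j: "j < n" for j
    proof -
      have "\<sigma>3 (F j x) = F j (\<lambda>i. \<sigma>3 (x i))"
        by (rule ring_emb_poly_funs[OF 3(1) _ _ _ F[OF j]]) (use S_Sy fx 2(2) 3(2,3) in auto)
      moreover have "F j x \<in> Sy"
        unfolding Sy_def by (rule image_eqI[OF _ poly_funs.var]) (use j in \<open>auto simp: y_def\<close>)
      ultimately show ?thesis using fx by auto
    qed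
    from coord_injD[OF inj this i] have "\<sigma>3 (x i) = x i" .
    then show False using * 2(3,5) 3(4) by metis
  qed
  then obtain p q where pq: "p \<in> poly_funs S {..<n}" "q \<in> poly_funs S {..<n}" "q y \<noteq> 0" "q y * x i = p y"
    by (auto simp: Sy_def)
  \<comment> \<open>The relation has coefficients in \<open>S\<close> and holds at the generic
    point, hence everywhere.\<close>
  have "(\<lambda>z. q (\<lambda>j. F j z) * z i - p (\<lambda>j. F j z)) \<in> poly_funs S {..<n}"
    using i by (intro poly_funs_diff S poly_funs.mult poly_funs_subst[OF pq(1)] poly_funs_subst[OF pq(2)]
        poly_funs.var F) auto
  from x[OF this] pq(4) have "q (\<lambda>j. F j z) * z i - p (\<lambda>j. F j z) = 0" for z
    by (simp add: y_def)
  then show ?thesis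
    using that[of q p y] pq(3) poly_funs_mono[OF pq(1)] poly_funs_mono[OF pq(2)] by auto
qed

section \<open>Complex polynomial maps with eigenvalues bounded away from zero\<close>

definition spectral_injectivity :: bool
  where "spectral_injectivity \<longleftrightarrow> (\<forall>n\<ge>1. \<forall>F.
    C1_map n F \<and>
    (\<exists>\<epsilon>>0. \<forall>x\<in>carrier_vec n. \<forall>\<mu>::complex.
      eigenvalue (map_mat complex_of_real (jacobian n F x)) \<mu> \<longrightarrow> cmod \<mu> \<ge> \<epsilon>)
    \<longrightarrow> inj_on F (carrier_vec n))"

lemma continuous_on_poly_funs:
  fixes f :: "(nat \<Rightarrow> 'a::{real_normed_algebra_1,comm_ring_1}) \<Rightarrow> 'a"
  assumes "f \<in> poly_funs S V" "\<And>i. i \<in> V \<Longrightarrow> continuous_on A (g i)"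
  shows "continuous_on A (\<lambda>X. f (\<lambda>i. g i X))"
  using assms(1) by (induction rule: poly_funs.induct) (auto intro: continuous_intros assms(2))

lemma sum_lessThan_double:
  fixes f :: "nat \<Rightarrow> 'a::comm_monoid_add"
  shows "(\<Sum>j<2 * N. f j) = (\<Sum>b<N. f (2 * b) + f (2 * b + 1))"
  by (induction N) (auto simp: add_ac)

definition complex_coords :: "(nat \<Rightarrow> real) \<Rightarrow> nat \<Rightarrow> complex"
  where "complex_coords X a = Complex (X (2 * a)) (X (2 * a + 1))"

definition real_coord :: "nat \<Rightarrow> (nat \<Rightarrow> complex) \<Rightarrow> real"
  where "real_coord i z = (if even i then Re (z (i div 2)) else Im (z (i div 2)))"

lemma continuous_on_complex_coords: "continuous_on UNIV (\<lambda>X. complex_coords X a)"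
  by (simp add: complex_coords_def Complex_eq continuous_intros)

text \<open>When \<complex> is identified with pairs of reals, the complexified real Jacobian matrix
  is similar to the direct sum of \<open>J\<close> and its conjugate. Its eigenvalues are those of
  \<open>J\<close> and their conjugates, so the bound \<open>1\<close> for \<open>J\<close> serves
  as \<open>\<epsilon>\<close>.\<close>

lemma spectral_injectivity_complex:
  assumes A: spectral_injectivity and N: "N \<ge> 1"
    and G: "\<And>a. a < N \<Longrightarrow> G a \<in> poly_funs UNIV {..<N}"
    and J: "\<And>a b. a < N \<Longrightarrow> b < N \<Longrightarrow> J a b \<in> poly_funs UNIV {..<N}"
    and deriv: "\<And>a b x. a < N \<Longrightarrow> b < N \<Longrightarrow>
      ((\<lambda>t. G a (x(b := t))) has_field_derivative J a b x) (at (x b))"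
    and eig: "\<And>x \<zeta> \<mu> c. (\<And>a. a < N \<Longrightarrow> (\<Sum>b<N. J a b x * \<zeta> b) = \<mu> * \<zeta> a) \<Longrightarrow>
      c < N \<Longrightarrow> \<zeta> c \<noteq> 0 \<Longrightarrow> cmod \<mu> \<ge> 1"
    and eq: "\<And>a. a < N \<Longrightarrow> G a x = G a y" and c: "c < N"
  shows "x c = y c"
proof -
  define m where "m = 2 * N"
  define cz where "cz X = complex_coords (Matrix.vec_index X)" for X :: "real Matrix.vec"
  \<comment> \<open>An odd real coordinate moves its complex coordinate in the direction of
    \<open>\<i>\<close>.\<close>
  define u :: "nat \<Rightarrow> complex" where "u j = (if even j then 1 else \<i>)" for j
  define Gr where "Gr X = Matrix.vec m (\<lambda>i. real_coord i (\<lambda>a. G a (cz X)))" for X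
  define Jr where "Jr i j z = real_coord i (\<lambda>a. J a (j div 2) z * u j)" for i j z
  have G_cong: "G a z = G a z'" if "a < N" "\<And>b. b < N \<Longrightarrow> z b = z' b" for a z z'
    using that by (intro poly_funs_cong[OF G]) auto
  have line: "((coord_line m Gr i j x) has_field_derivative Jr i j (cz x)) (at 0)"
    if i: "i < m" and j: "j < m" and x: "x \<in> carrier_vec m" for i j x
  proof -
    define a b z where "a = i div 2" and "b = j div 2" and "z = cz x"
    have ab: "a < N" "b < N" using i j by (auto simp: a_def b_def m_def)
    have "cz (x + t \<cdot>\<^sub>v unit_vec m j) b' = (z(b := z b + of_real t * u j)) b'" if "b' < N" for t b'
      using that x j by (auto simp: cz_def complex_coords_def z_def b_def u_def m_def complex_eq_iff)
    then have eq: "G a (cz (x + t \<cdot>\<^sub>v unit_vec m j)) = G a (z(b := z b + of_real t * u j))" for t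
      using ab by (intro G_cong) auto
    have inner: "((\<lambda>t. z b + of_real t * u j) has_vector_derivative u j) (at 0)"
      by (auto intro!: derivative_eq_intros simp: has_vector_derivative_def scaleR_conv_of_real)
    have "((\<lambda>w. G a (z(b := w))) has_field_derivative J a b z) (at (z b + of_real 0 * u j))"
      using deriv[OF ab, of z] by simp
    from field_vector_diff_chain_at[OF inner this]
    have d: "((\<lambda>t. G a (z(b := z b + of_real t * u j))) has_vector_derivative u j * J a b z) (at 0)"
      by (simp add: o_def)
    have cl: "coord_line m Gr i j x = (\<lambda>t. real_coord i (\<lambda>a. G a (cz (x + t \<cdot>\<^sub>v unit_vec m j))))"
      using i by (auto simp: coord_line_def Gr_def)
    show ?thesis
    proof (cases "even i")
      case True
      have "((\<lambda>t. Re (G a (z(b := z b + of_real t * u j)))) has_vector_derivative Re (u j * J a b z)) (at 0)"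
        using d by (rule bounded_linear.has_vector_derivative[OF bounded_linear_Re])
      then show ?thesis
        using True unfolding cl
        by (simp add: has_real_derivative_iff_has_vector_derivative real_coord_def eq a_def[symmetric]
            Jr_def b_def[symmetric] z_def[symmetric] mult.commute)
    next
      case False
      have "((\<lambda>t. Im (G a (z(b := z b + of_real t * u j)))) has_vector_derivative Im (u j * J a b z)) (at 0)"
        using d by (rule bounded_linear.has_vector_derivative[OF bounded_linear_Im])
      then show ?thesis
        using False unfolding cl
        by (simp add: has_real_derivative_iff_has_vector_derivative real_coord_def eq a_def[symmetric]
            Jr_def b_def[symmetric] z_def[symmetric] mult.commute)
    qed
  qed
  have "C1_map m Gr"
    unfolding C1_map_def
  proof (intro conjI allI impI ballI)
    show "Gr \<in> carrier_vec m \<rightarrow> carrier_vec m" by (auto simp: Gr_def)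
    fix i j assume ij: "i < m" "j < m"
    show "coord_line m Gr i j x field_differentiable at 0" if "x \<in> carrier_vec m" for x
      using line[OF ij that] field_differentiable_def by blast
    define a b where "a = i div 2" and "b = j div 2"
    have ab: "a < N" "b < N" using ij by (auto simp: a_def b_def m_def)
    have "deriv (coord_line m Gr i j (Matrix.vec m X)) 0 = Jr i j (complex_coords X)" for X
    proof -
      have "J a b (cz (Matrix.vec m X)) = J a b (complex_coords X)"
        by (rule poly_funs_cong[OF J[OF ab]]) (auto simp: cz_def complex_coords_def m_def)
      then have "Jr i j (cz (Matrix.vec m X)) = Jr i j (complex_coords X)"
        by (auto simp: Jr_def real_coord_def a_def b_def)
      then show ?thesis
        using DERIV_imp_deriv[OF line[OF ij, of "Matrix.vec m X"]] by simp
    qed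
    moreover have "continuous_on UNIV (\<lambda>X. J a b (complex_coords X))"
      using continuous_on_poly_funs[OF J[OF ab] continuous_on_complex_coords] by simp
    then have "continuous_on UNIV (\<lambda>X. Jr i j (complex_coords X))"
      by (cases "even i") (auto simp: Jr_def real_coord_def a_def b_def intro!: continuous_intros)
    ultimately show "continuous_map (Euclidean_space m) euclideanreal
        (\<lambda>X. deriv (coord_line m Gr i j (Matrix.vec m X)) 0)"
      unfolding continuous_map_Euclidean_space_iff by (auto intro: continuous_on_subset)
  qed
  moreover have "cmod \<mu> \<ge> 1"
    if x: "x \<in> carrier_vec m" and ev: "eigenvalue (map_mat complex_of_real (jacobian m Gr x)) \<mu>" for x \<mu>
  proof -
    define M where "M = map_mat complex_of_real (jacobian m Gr x)"
    have M: "M \<in> carrier_mat m m" by (simp add: M_def jacobian_def)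
    obtain v where v: "v \<in> carrier_vec m" "v \<noteq> 0\<^sub>v m" "M *\<^sub>v v = \<mu> \<cdot>\<^sub>v v"
      using ev M by (auto simp: eigenvalue_def eigenvector_def M_def[symmetric])
    define e where "e j = Matrix.vec_index v j" for j
    define K where "K a b = J a b (cz x)" for a b
    have entry: "M $$ (i, j) = of_real (Jr i j (cz x))" if "i < m" "j < m" for i j
      using that x DERIV_imp_deriv[OF line[OF that x]] by (simp add: M_def jacobian_def)
    have row: "(\<Sum>j<m. of_real (Jr i j (cz x)) * e j) = \<mu> * e i" if i: "i < m" for i
    proof -
      have "(M *\<^sub>v v) $ i = (\<Sum>j<m. M $$ (i, j) * e j)"
        using i M v(1) by (auto simp: scalar_prod_def e_def atLeast0LessThan intro!: sum.cong)
      also have "\<dots> = (\<Sum>j<m. of_real (Jr i j (cz x)) * e j)"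
        using i entry by (intro sum.cong) auto
      finally show ?thesis using v i by (simp add: e_def)
    qed
    have re: "(\<Sum>b<N. of_real (Re (K a b)) * e (2 * b) - of_real (Im (K a b)) * e (2 * b + 1)) = \<mu> * e (2 * a)"
      and im: "(\<Sum>b<N. of_real (Im (K a b)) * e (2 * b) + of_real (Re (K a b)) * e (2 * b + 1)) = \<mu> * e (2 * a + 1)"
      if a: "a < N" for a
      using row[of "2 * a"] row[of "2 * a + 1"] a
      by (simp_all add: m_def sum_lessThan_double Jr_def real_coord_def u_def K_def)
    \<comment> \<open>\<open>p\<close> and \<open>q\<close> are the components of the eigenvector on
      which the real matrix acts as \<open>J\<close> and as the conjugate of \<open>J\<close>.
      Conjugating the equation for \<open>q\<close> gives one for \<open>J\<close> with
      \<open>cnj \<mu>\<close>, which has the same modulus.\<close>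
    define p where "p b = e (2 * b) + \<i> * e (2 * b + 1)" for b
    define q where "q b = e (2 * b) - \<i> * e (2 * b + 1)" for b
    have P: "(\<Sum>b<N. J a b (cz x) * p b) = \<mu> * p a" if a: "a < N" for a
    proof -
      have "K a b * p b = (of_real (Re (K a b)) * e (2 * b) - of_real (Im (K a b)) * e (2 * b + 1)) +
          \<i> * (of_real (Im (K a b)) * e (2 * b) + of_real (Re (K a b)) * e (2 * b + 1))" for b
        by (subst (1) complex_eq[of "K a b"]) (simp add: p_def algebra_simps)
      then show ?thesis
        using re[OF a] im[OF a]
        by (simp add: K_def[symmetric] sum.distrib sum_distrib_left[symmetric]) (simp add: p_def algebra_simps)
    qed
    have Q: "(\<Sum>b<N. J a b (cz x) * cnj (q b)) = cnj \<mu> * cnj (q a)" if a: "a < N" for a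
    proof -
      have "cnj (K a b) * q b = (of_real (Re (K a b)) * e (2 * b) - of_real (Im (K a b)) * e (2 * b + 1)) -
          \<i> * (of_real (Im (K a b)) * e (2 * b) + of_real (Re (K a b)) * e (2 * b + 1))" for b
        by (subst (1) complex_eq[of "K a b"]) (simp add: q_def algebra_simps)
      then have "(\<Sum>b<N. cnj (K a b) * q b) = \<mu> * q a"
        using re[OF a] im[OF a]
        by (simp add: sum_subtractf sum_distrib_left[symmetric]) (simp add: q_def algebra_simps)
      from arg_cong[OF this, of cnj] show ?thesis by (simp add: K_def)
    qed
    obtain i where i: "i < m" "e i \<noteq> 0"
      using v(1,2) eq_vecI[of v "0\<^sub>v m"] by (auto simp: e_def)
    define b where "b = i div 2"
    have b: "b < N" using i by (auto simp: b_def m_def)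
    have "p b \<noteq> 0 \<or> q b \<noteq> 0"
    proof (rule ccontr)
      assume "\<not> ?thesis"
      then have "p b + q b = 0" "p b - q b = 0" by auto
      then have "e (2 * b) = 0" "e (2 * b + 1) = 0" by (auto simp: p_def q_def)
      moreover have "i = 2 * b \<or> i = 2 * b + 1" by (auto simp: b_def)
      ultimately show False using i by auto
    qed
    then show ?thesis
      using eig[OF P b] eig[OF Q b] by auto
  qed
  ultimately have "C1_map m Gr \<and> (\<exists>\<epsilon>>0. \<forall>x\<in>carrier_vec m. \<forall>\<mu>::complex.
      eigenvalue (map_mat complex_of_real (jacobian m Gr x)) \<mu> \<longrightarrow> cmod \<mu> \<ge> \<epsilon>)"
    by (intro conjI exI[of _ "1::real"]) auto
  moreover have "m \<ge> 1" using N by (simp add: m_def)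
  ultimately have inj: "inj_on Gr (carrier_vec m)"
    using A unfolding spectral_injectivity_def by blast
  define vx where "vx z = Matrix.vec m (\<lambda>i. real_coord i z)" for z
  have cz_vx: "cz (vx z) a = z a" if "a < N" for z a
    using that by (auto simp: cz_def vx_def complex_coords_def real_coord_def m_def complex_eq_iff)
  have "G a (cz (vx z)) = G a z" if "a < N" for a z
    using that cz_vx by (intro G_cong) auto
  then have "Gr (vx x) = Gr (vx y)"
    using eq by (auto simp: Gr_def real_coord_def m_def)
  then have "vx x = vx y"
    using inj by (auto simp: inj_on_def vx_def)
  then show ?thesis using cz_vx c by metis
qed

section \<open>Injectivity of Keller maps\<close>

text \<open>The variable of \<open>p\<close> records the degree: \<open>p\<close> is
  \<open>f(T x)\<close> as a polynomial in \<open>T\<close>, coefficient \<open>k\<close> is the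
  homogeneous part of degree \<open>k\<close>, and \<open>T = 1\<close> gives back
  \<open>f\<close>.\<close>

lemma poly_funs_homogeneous:
  assumes "is_subring S" "f \<in> poly_funs S V"
  obtains p where "p \<in> coeffs_in (poly_funs S V)"
    "\<And>k t x. coeff p k (\<lambda>i. t * x i) = t ^ k * coeff p k x" "\<And>x. f x = poly (spec p x) 1"
proof -
  let ?R = "poly_funs S V"
  have R: "is_subring ?R" using assms(1) by (rule is_subring_poly_funs)
  note C = is_subringD[OF is_subring_coeffs_in[OF R]] is_subringD[OF R]
  let ?H = "\<lambda>p f. (\<forall>k t x. coeff p k (\<lambda>i. t * x i) = t ^ k * coeff p k x) \<and> (\<forall>x. f x = poly (spec p x) 1)"
  have "\<exists>p \<in> coeffs_in ?R. ?H p f"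
    using assms(2)
  proof (induction rule: poly_funs.induct)
    case (const c)
    then show ?case
      by (intro bexI[of _ "[:\<lambda>x. c:]"] coeffs_in_pCons coeffs_in_0 R)
        (auto intro: poly_funs.const simp: coeff_pCons split: nat.split)
  next
    case (var i)
    then show ?case
      by (intro bexI[of _ "[:0, \<lambda>x. x i:]"] coeffs_in_pCons coeffs_in_0 R C)
        (auto intro: poly_funs.var simp: coeff_pCons split: nat.split)
  next
    case (add f g)
    then obtain p q where "p \<in> coeffs_in ?R" "q \<in> coeffs_in ?R" "?H p f" "?H q g" by blast
    then show ?case
      by (intro bexI[of _ "p + q"] C) (auto simp: algebra_simps)
  next
    case (mult f g)
    then obtain p q where pq: "p \<in> coeffs_in ?R" "q \<in> coeffs_in ?R"
      "\<And>k t x. coeff p k (\<lambda>i. t * x i) = t ^ k * coeff p k x" "\<forall>x. f x = poly (spec p x) 1"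
      "\<And>k t x. coeff q k (\<lambda>i. t * x i) = t ^ k * coeff q k x" "\<forall>x. g x = poly (spec q x) 1"
      by blast
    have "coeff (p * q) k (\<lambda>i. t * x i) = t ^ k * coeff (p * q) k x" for k t x
    proof -
      have "coeff (p * q) k (\<lambda>i. t * x i) =
          (\<Sum>i\<le>k. t ^ i * coeff p i x * (t ^ (k - i) * coeff q (k - i) x))"
        by (simp add: coeff_mult sum_apply pq(3,5))
      also have "\<dots> = (\<Sum>i\<le>k. t ^ k * (coeff p i x * coeff q (k - i) x))"
      proof (intro sum.cong refl)
        fix i assume "i \<in> {..k}"
        then have "t ^ k = t ^ i * t ^ (k - i)" by (simp flip: power_add)
        then show "t ^ i * coeff p i x * (t ^ (k - i) * coeff q (k - i) x) = t ^ k * (coeff p i x * coeff q (k - i) x)"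
          by (simp add: mult_ac)
      qed
      finally show ?thesis by (simp add: coeff_mult sum_apply sum_distrib_left)
    qed
    then show ?case using pq
      by (intro bexI[of _ "p * q"] C) auto
  qed
  then show ?thesis using that by blast
qed

lemma poly_funs_deriv:
  fixes f :: "(nat \<Rightarrow> 'a::real_normed_field) \<Rightarrow> 'a"
  assumes "f \<in> poly_funs UNIV V"
  obtains g where "\<And>j. g j \<in> poly_funs UNIV V"
    "\<And>j x. ((\<lambda>t. f (x(j := t))) has_field_derivative g j x) (at (x j))" "\<And>j x. j \<notin> V \<Longrightarrow> g j x = 0"
proof -
  let ?D = "\<lambda>f g. \<forall>j. g j \<in> poly_funs UNIV V \<and>
    (\<forall>x. ((\<lambda>t. f (x(j := t))) has_field_derivative g j x) (at (x j))) \<and> (j \<notin> V \<longrightarrow> (\<forall>x. g j x = 0))"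
  have "\<exists>g. ?D f g"
    using assms
  proof (induction rule: poly_funs.induct)
    case (const c)
    show ?case by (intro exI[of _ "\<lambda>j x. 0"]) (auto intro: poly_funs.const)
  next
    case (var i)
    have "((\<lambda>t. (x(j := t)) i) has_field_derivative (if j = i then 1 else 0)) (at (x j))" for x j
      by (cases "j = i") auto
    then show ?case using var
      by (intro exI[of _ "\<lambda>j x. if j = i then 1 else 0"]) (auto intro: poly_funs.const)
  next
    case (add f g)
    then obtain f' g' where
      "?D f f'" "?D g g'" by blast
    moreover from this have "((\<lambda>t. f (x(j := t)) + g (x(j := t))) has_field_derivative
        f' j x + g' j x) (at (x j))" for x j
      by (intro DERIV_add) blast+
    ultimately show ?case
      by (intro exI[of _ "\<lambda>j x. f' j x + g' j x"] allI conjI impI poly_funs.add; (blast | simp))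
  next
    case (mult f g)
    then obtain f' g' where
      "?D f f'" "?D g g'" by blast
    moreover from this have "((\<lambda>t. f (x(j := t)) * g (x(j := t))) has_field_derivative
        f' j x * g x + f x * g' j x) (at (x j))" for x j
      by (auto intro!: derivative_eq_intros)
    ultimately show ?case using mult.hyps
      by (intro exI[of _ "\<lambda>j x. f' j x * g x + f x * g' j x"] allI conjI impI poly_funs.add poly_funs.mult;
          (blast | simp))
  qed
  then obtain g where "?D f g" ..
  then show ?thesis using that[of g] by blast
qed

text \<open>A derivative of a form of degree \<open>k\<close> has degree \<open>k - 1\<close>; the
  extra factor \<open>c\<close> avoids the subtraction and covers \<open>k = 0\<close>.\<close>

lemma homogeneous_deriv:
  fixes h g :: "(nat \<Rightarrow> 'a::real_normed_field) \<Rightarrow> 'a"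
  assumes h: "\<And>t x. h (\<lambda>i. t * x i) = t ^ k * h x"
    and g: "\<And>x. ((\<lambda>t. h (x(j := t))) has_field_derivative g x) (at (x j))"
  shows "c * g (\<lambda>i. c * x i) = c ^ k * g x"
proof -
  have "((\<lambda>t. h ((\<lambda>i. c * x i)(j := c * t))) has_field_derivative g (\<lambda>i. c * x i) * c) (at (x j))"
    by (rule DERIV_chain2[where f = "\<lambda>t. h ((\<lambda>i. c * x i)(j := t))"])
      (use g[of "\<lambda>i. c * x i"] in \<open>auto intro!: derivative_eq_intros\<close>)
  moreover have "h ((\<lambda>i. c * x i)(j := c * t)) = c ^ k * h (x(j := t))" for t
    using h[of c "x(j := t)"] by (simp add: fun_upd_def if_distrib cong: if_cong)
  ultimately have "((\<lambda>t. c ^ k * h (x(j := t))) has_field_derivative g (\<lambda>i. c * x i) * c) (at (x j))"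
    by simp
  moreover have "((\<lambda>t. c ^ k * h (x(j := t))) has_field_derivative c ^ k * g x) (at (x j))"
    using g by (rule DERIV_cmult)
  ultimately show ?thesis
    using DERIV_unique by (metis mult.commute)
qed

text \<open>
  Split \<open>F\<close> into homogeneous parts \<open>F = h\<^sub>0 + h\<^sub>1 + \<dots>\<close> and distribute the parts of degree at least
  two over a chain of new blocks of variables:
  \<open>(Z\<^sub>0, \<dots>, Z\<^sub>M\<^sub>-\<^sub>1) \<mapsto> (h\<^sub>0(Z\<^sub>0) + h\<^sub>1(Z\<^sub>0) - Z\<^sub>1 + h\<^sub>2(Z\<^sub>0), Z\<^sub>1 - Z\<^sub>2 + h\<^sub>3(Z\<^sub>0), \<dots>)\<close>. The components add up to
  \<open>F(Z\<^sub>0)\<close>, and an eigenvalue \<open>1 - \<nu>\<close> with \<open>\<nu> \<noteq> 0\<close> of the Jacobian matrix yields a vector in the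
  kernel of the Jacobian matrix of \<open>F\<close> at \<open>Z\<^sub>0 / \<nu>\<close>.
\<close>

lemma normalised_keller_map_inj:
  assumes A: spectral_injectivity and n: "n \<ge> 1"
    and F: "\<And>i. i < n \<Longrightarrow> F i \<in> poly_funs UNIV {..<n}"
    and dF: "\<And>i j x. i < n \<Longrightarrow> j < n \<Longrightarrow>
      ((\<lambda>t. F i (x(j := t))) has_field_derivative dF i j x) (at (x j))"
    and ker: "\<And>x v i. (\<And>i. i < n \<Longrightarrow> (\<Sum>j<n. dF i j x * v j) = 0) \<Longrightarrow> i < n \<Longrightarrow> v i = 0"
    and dF0: "\<And>i j. i < n \<Longrightarrow> j < n \<Longrightarrow> dF i j (\<lambda>_. 0) = (if i = j then 1 else 0)"
    and eq: "\<And>i. i < n \<Longrightarrow> F i x = F i y" and c: "c < n"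
  shows "x c = (y c :: complex)"
proof -
  have "\<forall>i. \<exists>p. i < n \<longrightarrow> p \<in> coeffs_in (poly_funs UNIV {..<n}) \<and>
    (\<forall>k t x. coeff p k (\<lambda>i. t * x i) = t ^ k * coeff p k x) \<and> (\<forall>x. F i x = poly (spec p x) 1)"
    using poly_funs_homogeneous[OF is_subring_UNIV F] by metis
  then obtain p where p: "\<And>i. i < n \<Longrightarrow> p i \<in> coeffs_in (poly_funs UNIV {..<n})"
    "\<And>i k t x. i < n \<Longrightarrow> coeff (p i) k (\<lambda>i. t * x i) = t ^ k * coeff (p i) k x"
    "\<And>i x. i < n \<Longrightarrow> F i x = poly (spec (p i) x) 1"
    by metis
  define h where "h i k = coeff (p i) k" for i k
  have h: "h i k \<in> poly_funs UNIV {..<n}" if "i < n" for i k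
    using p(1)[OF that] by (auto simp: h_def intro: coeffs_inD)
  have h_hom: "h i k (\<lambda>i. t * x i) = t ^ k * h i k x" if "i < n" for i k t x
    using p(2)[OF that] by (simp add: h_def)
  \<comment> \<open>Large enough that every part of \<open>F\<close> has degree below
    \<open>M + 2\<close>, with at least one block.\<close>
  define M where "M = Suc (\<Sum>i<n. degree (p i))"
  have M: "M \<ge> 1" by (simp add: M_def)
  have F_sum: "F i x = (\<Sum>k<M + 2. h i k x)" if i: "i < n" for i x
  proof -
    have "degree (p i) \<le> (\<Sum>i<n. degree (p i))"
      using i by (intro member_le_sum) auto
    then have d: "k < M + 2" if "h i k x \<noteq> 0" for k
      using that le_degree[of "p i" k] by (fastforce simp: h_def M_def)
    have "F i x = (\<Sum>k\<le>degree (spec (p i) x). h i k x)"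
      using p(3)[OF i] by (simp add: poly_altdef h_def)
    also have "\<dots> = (\<Sum>k<M + 2. h i k x)"
      using d by (intro sum.mono_neutral_cong) (auto simp: h_def coeff_eq_0 simp flip: coeff_spec)
    finally show ?thesis .
  qed
  have "\<forall>i k. \<exists>g. i < n \<longrightarrow> (\<forall>j. g j \<in> poly_funs UNIV {..<n} \<and>
      (\<forall>x. ((\<lambda>t. h i k (x(j := t))) has_field_derivative g j x) (at (x j))) \<and> (j \<notin> {..<n} \<longrightarrow> (\<forall>x. g j x = 0)))"
    using poly_funs_deriv[OF h] by metis
  then obtain D where D: "\<And>i k j. i < n \<Longrightarrow> D i k j \<in> poly_funs UNIV {..<n}"
    "\<And>i k j x. i < n \<Longrightarrow> ((\<lambda>t. h i k (x(j := t))) has_field_derivative D i k j x) (at (x j))"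
    "\<And>i k j x. i < n \<Longrightarrow> j \<ge> n \<Longrightarrow> D i k j x = 0"
    by (metis lessThan_iff not_le)
  have D_hom: "c * D i k j (\<lambda>i. c * x i) = c ^ k * D i k j x" if "i < n" for c i k j x
    using h_hom[OF that] D(2)[OF that] by (rule homogeneous_deriv)
  have dF_sum: "dF i j x = (\<Sum>k<M + 2. D i k j x)" if i: "i < n" "j < n" for i j x
  proof -
    have "((\<lambda>t. F i (x(j := t))) has_field_derivative (\<Sum>k<M + 2. D i k j x)) (at (x j))"
      unfolding F_sum[OF i(1)] using D(2)[OF i(1)] by (intro DERIV_sum) auto
    then show ?thesis using dF[OF i] DERIV_unique by blast
  qed
  have D0: "D i 0 j x = 0" if "i < n" for i j x
    using D_hom[OF that, of 0 0 j x] by simp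
  \<comment> \<open>A form of positive degree vanishes at the origin; scaling by \<open>2\<close> is
    enough to see this.\<close>
  have D2: "D i (Suc (Suc k)) j (\<lambda>_. 0) = 0" if "i < n" for i j k
  proof -
    have "2 * D i (Suc (Suc k)) j (\<lambda>_. 0) = 2 * (2 ^ Suc k * D i (Suc (Suc k)) j (\<lambda>_. 0))"
      using D_hom[OF that, of 2 "Suc (Suc k)" j "\<lambda>_. 0"] by simp
    then have "(2 ^ Suc k - 1) * D i (Suc (Suc k)) j (\<lambda>_. 0) = 0" by (simp add: algebra_simps)
    moreover have "(2 :: complex) ^ Suc k \<noteq> 1"
    proof
      assume "(2 :: complex) ^ Suc k = 1"
      then have "(2 :: nat) ^ Suc k = 1" by (metis of_nat_1 of_nat_eq_iff of_nat_numeral of_nat_power)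
      then show False by simp
    qed
    ultimately show ?thesis by simp
  qed
  \<comment> \<open>The derivative of the linear part is constant along a line through the origin:
    homogeneity shows this for \<open>t \<noteq> 0\<close>, and a polynomial constant there is
    constant. At the origin the other parts contribute nothing, so the value is that of
    \<open>dF\<close>.\<close>
  have D1: "D i 1 j x = (if i = j then 1 else 0)" if i: "i < n" "j < n" for i j x
  proof -
    obtain q where q: "\<And>t. D i 1 j (\<lambda>i. 0 + t * x i) = poly q t"
      by (rule poly_funs_line[OF D(1)[OF i(1), of 1 j], of "\<lambda>_. 0" x]) (rule that)
    have "poly q t = D i 1 j x" if "t \<noteq> 0" for t
      using D_hom[OF i(1), of t 1 j x] that q[of t] by simp
    then have "q = [:D i 1 j x:]" by (intro poly_eqI_nonzero) simp
    then have "D i 1 j x = poly q 0" by simp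
    also have "\<dots> = D i 1 j (\<lambda>_. 0)" using q[of 0] by simp
    also have "\<dots> = (\<Sum>k<M + 2. if k = 1 then D i k j (\<lambda>_. 0) else 0)"
      by (subst sum.delta) auto
    also have "\<dots> = dF i j (\<lambda>_. 0)"
      unfolding dF_sum[OF i]
    proof (intro sum.cong refl)
      fix k
      show "(if k = 1 then D i k j (\<lambda>_. 0) else 0) = D i k j (\<lambda>_. 0)"
        using D0[OF i(1)] D2[OF i(1)] by (cases k; cases "k - 1") auto
    qed
    finally show ?thesis using dF0[OF i] by simp
  qed
  define N where "N = M * n"
  have nN: "n \<le> N" using M by (simp add: N_def)
  have dm: "a div n < M" "a mod n < n" if "a < N" for a
    using less_mult_imp_div_less[of a M n] that n by (simp_all add: N_def)
  \<comment> \<open>Index \<open>a\<close> stands for component \<open>a mod n\<close> of block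
    \<open>a div n\<close>, which receives the part of degree \<open>a div n + 2\<close>. The last
    block has no successor; there \<open>nxt\<close> is zero.\<close>
  define nxt where "nxt a z = (if a + n < N then z (a + n) else 0)" for a and z :: "nat \<Rightarrow> complex"
  define G where "G a z = (if a < n then h a 0 z + h a 1 z else z a) - nxt a z + h (a mod n) (a div n + 2) z" for a z
  define J where "J a b z = (if a < n then D a 0 b z + D a 1 b z else if a = b then 1 else 0) -
      (if a + n < N \<and> a + n = b then 1 else 0) + D (a mod n) (a div n + 2) b z" for a b z
  have up: "f \<in> poly_funs UNIV {..<N}" if "f \<in> poly_funs UNIV {..<n}" for f :: "(nat \<Rightarrow> complex) \<Rightarrow> complex"
    using that nN by (auto intro: poly_funs_mono)
  have G: "G a \<in> poly_funs UNIV {..<N}" if a: "a < N" for a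
  proof -
    have 1: "(\<lambda>z. if a < n then h a 0 z + h a 1 z else z a) \<in> poly_funs UNIV {..<N}"
      using a by (cases "a < n") (simp_all add: poly_funs.add poly_funs.var up h)
    have 2: "(\<lambda>z. nxt a z) \<in> poly_funs UNIV {..<N}"
      by (cases "a + n < N") (auto simp: nxt_def intro: poly_funs.var poly_funs.const)
    show ?thesis
      unfolding G_def[abs_def]
      by (rule poly_funs.add[OF poly_funs_diff[OF is_subring_UNIV 1 2] up[OF h[OF dm(2)[OF a]]]])
  qed
  have J: "J a b \<in> poly_funs UNIV {..<N}" if a: "a < N" "b < N" for a b
  proof -
    have 1: "(\<lambda>z. if a < n then D a 0 b z + D a 1 b z else if a = b then 1 else 0) \<in> poly_funs UNIV {..<N}"
      using a by (cases "a < n") (simp_all add: poly_funs.add poly_funs.const up D)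
    show ?thesis
      unfolding J_def[abs_def]
      by (rule poly_funs.add[OF poly_funs_diff[OF is_subring_UNIV 1 poly_funs.const[OF UNIV_I]]
            up[OF D(1)[OF dm(2)[OF a(1)]]]])
  qed
  have GJ: "((\<lambda>t. G a (z(b := t))) has_field_derivative J a b z) (at (z b))" if a: "a < N" "b < N" for a b z
  proof -
    have "((\<lambda>t. if a < n then h a 0 (z(b := t)) + h a 1 (z(b := t)) else (z(b := t)) a)
        has_field_derivative (if a < n then D a 0 b z + D a 1 b z else if a = b then 1 else 0)) (at (z b))"
      by (cases "a < n"; cases "a = b") (auto intro: DERIV_add D)
    moreover have "((\<lambda>t. nxt a (z(b := t))) has_field_derivative (if a + n < N \<and> a + n = b then 1 else 0)) (at (z b))"
      by (cases "a + n < N"; cases "a + n = b") (auto simp: nxt_def)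
    ultimately show ?thesis
      unfolding G_def J_def using D(2)[OF dm(2)[OF a(1)]] by (intro DERIV_add DERIV_diff)
  qed
  have eig: "cmod \<mu> \<ge> 1"
    if ev: "\<And>a. a < N \<Longrightarrow> (\<Sum>b<N. J a b z * \<zeta> b) = \<mu> * \<zeta> a" and b: "b < N" "\<zeta> b \<noteq> 0" for z \<zeta> \<mu> b
  proof (cases "\<mu> = 1")
    case False
    \<comment> \<open>\<open>\<mu> = 1\<close> meets the bound. For any other \<open>\<mu>\<close>
      the vector \<open>\<zeta>\<close> is shown to vanish, and \<open>w\<close> is the factor that
      rescales the point.\<close>
    define \<nu> where "\<nu> = 1 - \<mu>"
    define w where "w = 1 / \<nu>"
    have \<nu>: "\<nu> \<noteq> 0" and w: "w * \<nu> = 1" using False by (auto simp: \<nu>_def w_def)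
    define Ak where "Ak k i = (\<Sum>b<n. D i k b z * \<zeta> b)" for k i
    have Ak: "(\<Sum>b<N. D i k b z * \<zeta> b) = Ak k i" if "i < n" for i k
      unfolding Ak_def using nN D(3)[OF that] by (intro sum.mono_neutral_right) auto
    have delta: "(\<Sum>b<N. (if a = b then 1 else 0) * \<zeta> b) = \<zeta> a" if "a < N" for a
    proof -
      have "(\<Sum>b<N. (if a = b then 1 else 0) * \<zeta> b) = (\<Sum>b<N. if a = b then \<zeta> b else 0)"
        by (intro sum.cong) auto
      then show ?thesis using that by simp
    qed
    have delta': "(\<Sum>b<N. (if a + n < N \<and> a + n = b then 1 else 0) * \<zeta> b) = nxt a \<zeta>" for a
      using delta[of "a + n"] by (cases "a + n < N") (simp_all add: nxt_def)
    have A1: "Ak 1 i = \<zeta> i" if "i < n" for i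
    proof -
      have "Ak 1 i = (\<Sum>b<n. if i = b then \<zeta> b else 0)"
        unfolding Ak_def using D1[OF that] by (intro sum.cong) auto
      then show ?thesis using that by simp
    qed
    have A0: "Ak 0 i = 0" if "i < n" for i
      unfolding Ak_def by (simp add: D0[OF that])
    have row: "nxt a \<zeta> = \<nu> * \<zeta> a + Ak (a div n + 2) (a mod n)" if a: "a < N" for a
    proof -
      have "(\<Sum>b<N. J a b z * \<zeta> b) = (\<Sum>b<N. (if a < n then D a 0 b z + D a 1 b z else if a = b then 1 else 0) * \<zeta> b)
          - (\<Sum>b<N. (if a + n < N \<and> a + n = b then 1 else 0) * \<zeta> b) + (\<Sum>b<N. D (a mod n) (a div n + 2) b z * \<zeta> b)"
        unfolding J_def by (simp only: ring_distribs sum.distrib sum_subtractf)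
      also have "(\<Sum>b<N. (if a < n then D a 0 b z + D a 1 b z else if a = b then 1 else 0) * \<zeta> b) = \<zeta> a"
        using delta[OF a] A0[of a] A1[of a]
        by (cases "a < n") (simp_all add: ring_distribs sum.distrib Ak)
      finally show ?thesis
        unfolding delta' Ak[OF dm(2)[OF a]] ev[OF a] \<nu>_def by (simp add: algebra_simps)
    qed
    \<comment> \<open>The row equations express each block of \<open>\<zeta>\<close> through the
      previous one. Unrolled up to \<open>k = M\<close>, where no block is left, they give an
      equation for the first block alone.\<close>
    have chain: "(if k < M then \<zeta> (k * n + i) else 0) = \<nu> ^ k * \<zeta> i + (\<Sum>l<k. \<nu> ^ (k - 1 - l) * Ak (l + 2) i)"
      if i: "i < n" and k: "k \<le> M" for i k
      using k
    proof (induction k)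
      case 0
      then show ?case using M by simp
    next
      case (Suc k)
      have a: "k * n + i < N"
      proof -
        have "k * n + i < Suc k * n" using i by simp
        also have "\<dots> \<le> N" using Suc.prems by (simp only: N_def mult_le_mono1)
        finally show ?thesis .
      qed
      have "(if Suc k < M then \<zeta> (Suc k * n + i) else 0) = nxt (k * n + i) \<zeta>"
      proof (cases "Suc k < M")
        case True
        then have "Suc (Suc k) * n \<le> N" by (simp only: N_def mult_le_mono1 Suc_le_eq)
        then show ?thesis using True i by (simp add: nxt_def algebra_simps)
      next
        case False
        then have "M = Suc k" using Suc.prems by simp
        then show ?thesis using i by (simp add: nxt_def N_def)
      qed
      also have "\<dots> = \<nu> * \<zeta> (k * n + i) + Ak (k + 2) i"
        using row[OF a] i by simp
      also have "\<zeta> (k * n + i) = \<nu> ^ k * \<zeta> i + (\<Sum>l<k. \<nu> ^ (k - 1 - l) * Ak (l + 2) i)"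
        using Suc by simp
      also have "\<nu> * (\<nu> ^ k * \<zeta> i + (\<Sum>l<k. \<nu> ^ (k - 1 - l) * Ak (l + 2) i)) + Ak (k + 2) i =
          \<nu> ^ Suc k * \<zeta> i + ((\<Sum>l<k. \<nu> ^ (Suc k - 1 - l) * Ak (l + 2) i) + Ak (k + 2) i)"
      proof -
        have "\<nu> * (\<Sum>l<k. \<nu> ^ (k - 1 - l) * Ak (l + 2) i) = (\<Sum>l<k. \<nu> ^ (Suc k - 1 - l) * Ak (l + 2) i)"
          unfolding sum_distrib_left
        proof (intro sum.cong refl)
          fix l assume "l \<in> {..<k}"
          then have "Suc k - 1 - l = Suc (k - 1 - l)" by auto
          then show "\<nu> * (\<nu> ^ (k - 1 - l) * Ak (l + 2) i) = \<nu> ^ (Suc k - 1 - l) * Ak (l + 2) i" by simp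
        qed
        then show ?thesis by (simp add: algebra_simps)
      qed
      finally show ?case by simp
    qed
    \<comment> \<open>The derivative of the part of degree \<open>k + 1\<close> is homogeneous of
      degree \<open>k\<close>. Hence the chain at \<open>k = M\<close>, multiplied by
      \<open>w ^ M\<close>, says that the Jacobian matrix of \<open>F\<close> at
      \<open>w * z\<close> kills the first block of \<open>\<zeta>\<close>.\<close>
    have "(\<Sum>j<n. dF i j (\<lambda>i. w * z i) * \<zeta> j) = 0" if i: "i < n" for i
    proof -
      have Dw: "D i (Suc k) j (\<lambda>i. w * z i) = w ^ k * D i (Suc k) j z" for k j
        using D_hom[OF i, of w "Suc k" j z] w by auto
      have "(\<Sum>j<n. dF i j (\<lambda>i. w * z i) * \<zeta> j) = (\<Sum>j<n. (\<Sum>k<Suc M. w ^ k * D i (Suc k) j z) * \<zeta> j)"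
        using dF_sum[OF i] D0[OF i]
        by (intro sum.cong) (simp_all add: sum.lessThan_Suc_shift Dw del: sum.lessThan_Suc)
      also have "\<dots> = (\<Sum>k<Suc M. w ^ k * Ak (Suc k) i)"
        unfolding Ak_def sum_distrib_left sum_distrib_right by (subst sum.swap) (simp add: mult_ac)
      also have "\<dots> = \<zeta> i + (\<Sum>l<M. w ^ Suc l * Ak (l + 2) i)"
        using A1[OF i] by (simp add: sum.lessThan_Suc_shift del: sum.lessThan_Suc)
      also have "\<dots> = w ^ M * (\<nu> ^ M * \<zeta> i + (\<Sum>l<M. \<nu> ^ (M - 1 - l) * Ak (l + 2) i))"
      proof -
        have "w ^ Suc l * Ak (l + 2) i = w ^ M * (\<nu> ^ (M - 1 - l) * Ak (l + 2) i)" if "l < M" for l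
        proof -
          have "M = Suc l + (M - 1 - l)" using that by simp
          then have "w ^ M * \<nu> ^ (M - 1 - l) = w ^ Suc l * (w ^ (M - 1 - l) * \<nu> ^ (M - 1 - l))"
            by (metis mult.assoc power_add)
          also have "\<dots> = w ^ Suc l" using w by (simp flip: power_mult_distrib)
          finally show ?thesis by (simp add: mult_ac)
        qed
        then have "(\<Sum>l<M. w ^ Suc l * Ak (l + 2) i) = w ^ M * (\<Sum>l<M. \<nu> ^ (M - 1 - l) * Ak (l + 2) i)"
          unfolding sum_distrib_left by (intro sum.cong) (simp_all only: lessThan_iff)
        moreover have "w ^ M * (\<nu> ^ M * \<zeta> i) = \<zeta> i"
          using w by (simp add: mult.assoc[symmetric] flip: power_mult_distrib)
        ultimately show ?thesis by (simp only: distrib_left)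
      qed
      also have "\<dots> = 0" using chain[OF i, of M] by simp
      finally show ?thesis .
    qed
    from ker[OF this] have \<zeta>0: "\<zeta> i = 0" if "i < n" for i using that by blast
    have "\<zeta> b = 0"
    proof -
      have "Ak k i = 0" for k i by (simp add: Ak_def \<zeta>0)
      then show ?thesis
        using chain[OF dm(2)[OF b(1)], of "b div n"] dm[OF b(1)] \<zeta>0 by simp
    qed
    then show ?thesis using b by simp
  qed simp
  \<comment> \<open>The later blocks are negative tails of the parts of \<open>F\<close>, chosen so
    that the components of \<open>G\<close> outside the first block vanish; the first block then
    collects all of \<open>F\<close>.\<close>
  define lift where "lift v a = (if a < n then v a else - (\<Sum>l\<in>{a div n..<M}. h (a mod n) (l + 2) v))" for v a
  have G_lift: "G a (lift v) = (if a < n then F a v else 0)" if a: "a < N" for a v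
  proof -
    have hl: "h i k (lift v) = h i k v" if "i < n" for i k
      using h[OF that] by (rule poly_funs_cong) (simp add: lift_def)
    have nxt: "nxt a (lift v) = - (\<Sum>l\<in>{Suc (a div n)..<M}. h (a mod n) (l + 2) v)"
    proof (cases "a + n < N")
      case True
      then show ?thesis using n by (simp add: nxt_def lift_def)
    next
      case False
      moreover have "a + n < N" if "Suc (a div n) < M"
      proof -
        have "a + n = Suc (a div n) * n + a mod n" by simp
        also have "\<dots> < Suc (a div n) * n + n"
          using dm(2)[OF a] by (rule add_strict_left_mono)
        also have "\<dots> = Suc (Suc (a div n)) * n" by simp
        also have "\<dots> \<le> N" using that by (simp only: N_def mult_le_mono1 Suc_le_eq)
        finally show ?thesis .
      qed
      ultimately have "{Suc (a div n)..<M} = {}" by auto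
      then show ?thesis using False by (simp add: nxt_def)
    qed
    show ?thesis
    proof (cases "a < n")
      case True
      have "(\<Sum>k<M + 2. h a k v) = h a 0 v + h a 1 v + (\<Sum>l<M. h a (l + 2) v)"
        by (simp add: sum.lessThan_Suc_shift add_ac del: sum.lessThan_Suc)
      moreover have "(\<Sum>l<M. h a (l + 2) v) = h a 2 v + (\<Sum>l\<in>{1..<M}. h a (l + 2) v)"
        using M by (simp add: lessThan_atLeast0 sum.atLeast_Suc_lessThan numeral_2_eq_2)
      ultimately show ?thesis
        using True F_sum[OF True] by (simp add: G_def nxt hl numeral_2_eq_2)
    next
      case False
      then show ?thesis
        using dm[OF a] by (simp add: G_def nxt hl lift_def sum.atLeast_Suc_lessThan)
    qed
  qed
  have "lift x c = lift y c"
  proof (rule spectral_injectivity_complex[OF A, where N = N and G = G and J = J])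
    show "N \<ge> 1" using nN n by simp
    show "c < N" using c nN by simp
    show "G a (lift x) = G a (lift y)" if "a < N" for a
      using G_lift[OF that] eq by simp
    show "cmod \<mu> \<ge> 1" if "\<And>a. a < N \<Longrightarrow> (\<Sum>b<N. J a b z * \<zeta> b) = \<mu> * \<zeta> a" "b < N" "\<zeta> b \<noteq> 0" for z \<zeta> \<mu> b
      using that by (rule eig)
  qed (fact G J GJ)+
  then show ?thesis using c by (simp add: lift_def)
qed

lemma det_nonzero_kernel:
  fixes a :: "nat \<Rightarrow> nat \<Rightarrow> 'a::field"
  assumes "Determinant.det (Matrix.mat n n (\<lambda>(i, j). a i j)) \<noteq> 0"
    and "\<And>i. i < n \<Longrightarrow> (\<Sum>j<n. a i j * v j) = 0" and "i < n"
  shows "v i = 0"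
proof (rule ccontr)
  let ?M = "Matrix.mat n n (\<lambda>(i, j). a i j)"
  assume "v i \<noteq> 0"
  then have "Matrix.vec n v \<noteq> 0\<^sub>v n"
    using assms(3) by (metis index_vec index_zero_vec(1))
  moreover have "?M *\<^sub>v Matrix.vec n v = 0\<^sub>v n"
    using assms(2) by (intro eq_vecI) (auto simp: scalar_prod_def atLeast0LessThan)
  ultimately show False
    using assms(1) det_0_iff_vec_prod_zero_field[of ?M n] by (metis mat_carrier vec_carrier)
qed

text \<open>Multiplication by the inverse of the Jacobian matrix at the origin makes the Jacobian
  matrix there the identity and keeps the determinant nonzero; points with equal images under
  \<open>F\<close> keep equal images.\<close>

theorem keller_map_inj:
  assumes A: spectral_injectivity and n: "n \<ge> 1"
    and F: "\<And>i. i < n \<Longrightarrow> F i \<in> poly_funs UNIV {..<n}"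
    and dF: "\<And>i j x. i < n \<Longrightarrow> j < n \<Longrightarrow>
      ((\<lambda>t. F i (x(j := t))) has_field_derivative dF i j x) (at (x j))"
    and det: "\<And>x. Determinant.det (Matrix.mat n n (\<lambda>(i, j). dF i j x)) \<noteq> 0"
    and eq: "\<And>i. i < n \<Longrightarrow> F i x = F i y" and c: "c < n"
  shows "x c = (y c :: complex)"
proof -
  define J where "J x = Matrix.mat n n (\<lambda>(i, j). dF i j x)" for x
  have J: "J x \<in> carrier_mat n n" for x by (simp add: J_def)
  have "J (\<lambda>_. 0) \<in> Units (ring_mat TYPE(complex) n ())"
    using det by (intro det_non_zero_imp_unit J) (simp add: J_def)
  then obtain B where B: "B \<in> carrier_mat n n" "B * J (\<lambda>_. 0) = 1\<^sub>m n"
    by (auto simp: Units_def ring_mat_def)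
  have "Determinant.det B \<noteq> 0"
    using det_mult[OF B(1) J[of "\<lambda>_. 0"]] B(2) by auto
  define F' where "F' i x = (\<Sum>k<n. B $$ (i, k) * F k x)" for i x
  define dF' where "dF' i j x = (\<Sum>k<n. B $$ (i, k) * dF k j x)" for i j x
  have entry: "(B * J x) $$ (i, j) = dF' i j x" if "i < n" "j < n" for i j x
    using that B(1) by (auto simp: J_def dF'_def scalar_prod_def atLeast0LessThan intro!: sum.cong)
  have BJ: "B * J x = Matrix.mat n n (\<lambda>(i, j). dF' i j x)" for x
    using entry B(1) J[of x] by (intro eq_matI) (auto simp del: index_mult_mat(1))
  show ?thesis
  proof (rule normalised_keller_map_inj[OF A n _ _ _ _ _ c])
    show "F' i \<in> poly_funs UNIV {..<n}" if "i < n" for i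
      unfolding F'_def[abs_def] using F by (intro poly_funs_sum poly_funs.mult poly_funs.const) auto
    show "((\<lambda>t. F' i (x(j := t))) has_field_derivative dF' i j x) (at (x j))" if "i < n" "j < n" for i j x
      unfolding F'_def dF'_def using dF that by (intro DERIV_sum DERIV_cmult) auto
    show "v i = 0" if "\<And>i. i < n \<Longrightarrow> (\<Sum>j<n. dF' i j x * v j) = 0" "i < n" for x v i
    proof (rule det_nonzero_kernel[OF _ that])
      show "Determinant.det (Matrix.mat n n (\<lambda>(i, j). dF' i j x)) \<noteq> 0"
        using det_mult[OF B(1) J[of x]] \<open>Determinant.det B \<noteq> 0\<close> det[of x] by (simp add: J_def flip: BJ)
    qed
    show "dF' i j (\<lambda>_. 0) = (if i = j then 1 else 0)" if "i < n" "j < n" for i j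
      using entry[OF that, of "\<lambda>_. 0"] B(2) that by simp
    show "F' i x = F' i y" if "i < n" for i
      unfolding F'_def using eq by simp
  qed
qed

section \<open>Polynomial functions: topology and divisibility\<close>

lemma poly_funs_tendsto:
  fixes f :: "(nat \<Rightarrow> 'a::{real_normed_algebra_1,comm_ring_1}) \<Rightarrow> 'a"
  assumes "f \<in> poly_funs S V" "\<And>i. i \<in> V \<Longrightarrow> ((\<lambda>t. x t i) \<longlongrightarrow> y i) G"
  shows "((\<lambda>t. f (x t)) \<longlongrightarrow> f y) G"
  using assms(1) by (induction rule: poly_funs.induct) (auto intro: tendsto_intros assms(2))

text \<open>Differences outside \<open>V\<close> must not count, so the limit is taken along the
  filter pulled back from the distance \<open>d\<close> over \<open>V\<close> instead of a topology
  on sequences.\<close>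

lemma poly_funs_eventually_near:
  fixes f :: "(nat \<Rightarrow> 'a::{real_normed_algebra_1,comm_ring_1}) \<Rightarrow> 'a"
  assumes V: "finite V" and f: "f \<in> poly_funs S V" and "\<epsilon> > 0"
  obtains \<delta> where "\<delta> > 0" "\<And>x. (\<And>i. i \<in> V \<Longrightarrow> norm (x i - y i) < \<delta>) \<Longrightarrow> norm (f x - f y) < \<epsilon>"
proof -
  define d where "d x = (\<Sum>i\<in>V. norm (x i - y i))" for x
  define G where "G = filtercomap d (nhds 0)"
  have "((\<lambda>x. x i) \<longlongrightarrow> y i) G" if "i \<in> V" for i
  proof -
    have "(d \<longlongrightarrow> 0) G"
      unfolding G_def by (rule filterlim_filtercomap)
    moreover have "norm (x i - y i) \<le> d x" for x
      unfolding d_def using V that by (intro member_le_sum) auto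
    ultimately have "((\<lambda>x. x i - y i) \<longlongrightarrow> 0) G"
      by (intro Lim_null_comparison[where g = d and f = "\<lambda>x. x i - y i"]) auto
    then show ?thesis by (simp add: LIM_zero_iff)
  qed
  then have "(f \<longlongrightarrow> f y) G"
    using poly_funs_tendsto[OF f, of "\<lambda>x. x" y G] by simp
  then have "eventually (\<lambda>x. norm (f x - f y) < \<epsilon>) G"
    using \<open>\<epsilon> > 0\<close> by (auto simp: tendsto_iff dist_norm)
  then obtain P where P: "eventually P (nhds 0)" "\<And>x. P (d x) \<Longrightarrow> norm (f x - f y) < \<epsilon>"
    unfolding G_def eventually_filtercomap by blast
  then obtain e where e: "e > 0" "\<And>r. \<bar>r\<bar> < e \<Longrightarrow> P r"
    unfolding eventually_nhds_metric by (auto simp: dist_norm)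
  show ?thesis
  proof
    \<comment> \<open>The summand \<open>1\<close> makes the total strictly less than
      \<open>e\<close>, also for empty \<open>V\<close>.\<close>
    show "e / (real (card V) + 1) > 0" using e by simp
    fix x assume *: "\<And>i. i \<in> V \<Longrightarrow> norm (x i - y i) < e / (real (card V) + 1)"
    have "d x \<le> (\<Sum>i\<in>V. e / (real (card V) + 1))"
      unfolding d_def using * by (intro sum_mono) (simp add: less_imp_le)
    also have "\<dots> < e" using e by (simp add: divide_simps)
    finally have "\<bar>d x\<bar> < e" by (simp add: d_def sum_nonneg)
    then show "norm (f x - f y) < \<epsilon>" using e(2) P(2) by blast
  qed
qed

text \<open>On the line from \<open>y\<close> to \<open>x\<close> the function is a polynomial that
  vanishes on a disc, hence identically; \<open>x\<close> is the point with parameter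
  \<open>1\<close>.\<close>

lemma poly_funs_eq_0_on_box:
  fixes f :: "(nat \<Rightarrow> complex) \<Rightarrow> complex"
  assumes V: "finite V" and f: "f \<in> poly_funs UNIV V" and "\<epsilon> > 0"
    and 0: "\<And>x. (\<And>i. i \<in> V \<Longrightarrow> norm (x i - y i) < \<epsilon>) \<Longrightarrow> f x = 0"
  shows "f x = 0"
proof -
  obtain q where q: "\<And>t. f (\<lambda>i. y i + t * (x i - y i)) = poly q t"
    by (rule poly_funs_line[OF f, of y "\<lambda>i. x i - y i"]) (rule that)
  define B where "B = 1 + (\<Sum>i\<in>V. norm (x i - y i))"
  have B: "B > 0" by (simp add: B_def sum_nonneg add_pos_nonneg)
  have "poly q t = 0" if "norm t < \<epsilon> / B" for t
    unfolding q[symmetric]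
  proof (rule 0)
    fix i assume "i \<in> V"
    then have "norm (x i - y i) \<le> (\<Sum>i\<in>V. norm (x i - y i))"
      using V by (intro member_le_sum) auto
    then have "norm (x i - y i) \<le> B" by (simp add: B_def)
    then have "norm (t * (x i - y i)) \<le> norm t * B"
      by (simp add: norm_mult mult_left_mono)
    also have "\<dots> < \<epsilon>" using that B by (simp add: divide_simps)
    finally show "norm (y i + t * (x i - y i) - y i) < \<epsilon>" by simp
  qed
  then have "ball 0 (\<epsilon> / B) \<subseteq> {t. poly q t = 0}" by (auto simp: dist_norm)
  moreover have "infinite (ball (0::complex) (\<epsilon> / B))"
    using \<open>\<epsilon> > 0\<close> B uncountable_ball[of "\<epsilon> / B" "0::complex"] countable_finite by auto
  ultimately have "infinite {t. poly q t = 0}" by (rule infinite_super)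
  then have "q = 0" by (metis poly_roots_finite)
  then show ?thesis using q[of 1] by simp
qed

text \<open>\<open>norm (poly p s)\<close> is the product of the distances from \<open>s\<close> to
  the roots, so a nearest root satisfies the bound.\<close>

lemma monic_poly_root_near:
  fixes p :: "complex poly"
  assumes "lead_coeff p = 1" "degree p \<ge> 1"
  obtains r where "poly p r = 0" "norm (r - s) ^ degree p \<le> norm (poly p s)"
proof -
  have "\<exists>r. poly p r = 0 \<and> norm (r - s) ^ m \<le> norm (poly p s)" if "lead_coeff p = 1" "degree p = Suc m'" "m = Suc m'"
    for p :: "complex poly" and m m'
    using that
  proof (induction m' arbitrary: p m)
    case (Suc m')
    then have "\<not> constant (poly p)" by (simp add: constant_degree)
    then obtain r where r: "poly p r = 0" using fundamental_theorem_of_algebra by blast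
    then obtain q where q: "p = [:- r, 1:] * q" by (metis dvdE poly_eq_0_iff_dvd)
    have q': "q \<noteq> 0" using q Suc.prems by auto
    have "degree q = Suc m'" using Suc.prems q' by (simp add: q degree_mult_eq del: mult_pCons_left)
    moreover have "lead_coeff q = 1"
      using Suc.prems(1) unfolding q lead_coeff_mult by simp
    ultimately obtain r' where r': "poly q r' = 0" "norm (r' - s) ^ Suc m' \<le> norm (poly q s)"
      using Suc.IH by blast
    have ps: "norm (poly p s) = norm (r - s) * norm (poly q s)"
    proof -
      have "poly p s = (s - r) * poly q s" by (simp add: q algebra_simps)
      then show ?thesis by (simp add: norm_mult norm_minus_commute)
    qed
    show ?case
    proof (cases "norm (r - s) \<le> norm (r' - s)")
      case True
      have "norm (r - s) ^ m = norm (r - s) * norm (r - s) ^ Suc m'" using Suc.prems by simp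
      also have "\<dots> \<le> norm (r - s) * norm (r' - s) ^ Suc m'"
        using True by (intro mult_left_mono power_mono) auto
      also have "\<dots> \<le> norm (poly p s)" unfolding ps using r' by (intro mult_left_mono) auto
      finally show ?thesis using r by blast
    next
      case False
      have "norm (r' - s) ^ m = norm (r' - s) * norm (r' - s) ^ Suc m'" using Suc.prems by simp
      also have "\<dots> \<le> norm (r - s) * norm (r' - s) ^ Suc m'"
        using False by (intro mult_right_mono) auto
      also have "\<dots> \<le> norm (poly p s)" unfolding ps using r' by (intro mult_left_mono) auto
      finally show ?thesis using r' q by auto
    qed
  next
    case 0
    then have "p = [:coeff p 0, 1:]"
      by (intro poly_eqI) (auto simp: coeff_pCons coeff_eq_0 split: nat.split)
    then obtain c where p: "p = [:c, 1:]" by blast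
    have "norm (- c - s) = norm (c + s)"
      by (metis minus_add_distrib norm_minus_cancel diff_conv_add_uminus)
    then have "poly p (- c) = 0" "norm (- c - s) ^ m \<le> norm (poly p s)"
      using 0 by (simp_all add: p)
    then show ?case by blast
  qed
  from this[of p "degree p - 1" "degree p"] show ?thesis
    using assms that by auto
qed

text \<open>Gauss's lemma: \<open>Q\<close> is monic, hence primitive, so the contents of
  \<open>D\<close> and \<open>g\<close> multiply to the product of the leading coefficients up to a
  unit. The content of \<open>g\<close> divides its leading coefficient and can be cancelled, which
  leaves that \<open>lead_coeff D\<close> divides the content of \<open>D\<close>.\<close>

lemma lead_coeff_dvd_coeff_of_monic_multiple:
  fixes D g Q :: "complex poly poly"
  assumes "smult a Q = D * g" "a \<noteq> 0" "lead_coeff Q = 1"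
    and a: "a = lead_coeff D * lead_coeff g"
  shows "lead_coeff D dvd coeff D j"
proof -
  have "content Q dvd 1" using assms(3) content_dvd_coeff by metis
  then have "content Q = 1" using is_unit_content_iff by blast
  then have "normalize a = content D * content g"
    using arg_cong[OF assms(1), of content] by (simp add: content_mult)
  then have "lead_coeff D * lead_coeff g dvd content D * content g"
    unfolding a[symmetric] by (metis dvd_refl normalize_dvd_iff dvd_normalize_iff)
  moreover obtain y where y: "lead_coeff g = content g * y"
    by (metis content_dvd_coeff dvdE)
  ultimately have "content g * (lead_coeff D * y) dvd content g * content D"
    by (simp add: mult_ac)
  moreover have "content g \<noteq> 0" using a \<open>a \<noteq> 0\<close> by auto
  ultimately have "lead_coeff D * y dvd content D" by simp
  then have "lead_coeff D dvd content D" by (meson dvd_mult_left)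
  then show ?thesis using content_dvd_coeff dvd_trans by blast
qed

text \<open>This reduces divisibility in several variables to one variable, where Gauss's lemma is
  at hand. The induction pseudo-divides \<open>a\<close> by \<open>e\<close> with respect to one
  variable: lines in its direction kill the remainder, and translates of lines in the other
  variables show that the quotient is divisible by the power of the leading coefficient.\<close>

lemma poly_funs_dvd_of_lines:
  fixes a e :: "(nat \<Rightarrow> complex) \<Rightarrow> complex"
  assumes V: "finite V" and ae: "a \<in> poly_funs UNIV V" "e \<in> poly_funs UNIV V" and e: "e y \<noteq> 0"
    and lines: "\<And>w b p q. (\<And>t. a (\<lambda>i. w i + t * b i) = poly p t) \<Longrightarrow>
      (\<And>t. e (\<lambda>i. w i + t * b i) = poly q t) \<Longrightarrow> q \<noteq> 0 \<Longrightarrow> q dvd p"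
  obtains A where "A \<in> poly_funs UNIV V" "\<And>w. a w = e w * A w"
proof -
  have "\<exists>A \<in> poly_funs UNIV V. \<forall>w. a w = e w * A w"
    using assms
  proof (induction V arbitrary: a e y rule: finite_induct)
    case (empty a e y)
    have const: "a w = a y" "e w = e y" for w
      by (rule poly_funs_cong[OF empty.prems(1)], simp) (rule poly_funs_cong[OF empty.prems(2)], simp)
    have "a w = e w * (a y / e y)" for w
      using const[of w] empty.prems(3) by simp
    then show ?case
      by (intro bexI[of _ "\<lambda>w. a y / e y"] allI poly_funs.const UNIV_I)
  next
    case (insert v V a e y)
    let ?R = "poly_funs UNIV V"
    have R: "is_subring ?R" by (simp add: is_subring_poly_funs)
    obtain p where p: "p \<in> coeffs_in ?R" "\<And>x. a x = poly (spec p x) (x v)"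
      using poly_funs_expand[OF is_subring_UNIV insert.prems(1)] by blast
    obtain q where q: "q \<in> coeffs_in ?R" "\<And>x. e x = poly (spec q x) (x v)"
      using poly_funs_expand[OF is_subring_UNIV insert.prems(2)] by blast
    have "q \<noteq> 0" using q(2)[of y] insert.prems(3) by auto
    define c where "c = lead_coeff q"
    have c: "c \<in> ?R" using q by (auto simp: c_def intro: coeffs_inD)
    have "c \<noteq> 0" using \<open>q \<noteq> 0\<close> by (simp add: c_def)
    then obtain y1 where y1: "c y1 \<noteq> 0" by (auto simp: fun_eq_iff)
    obtain k g r where *: "g \<in> coeffs_in ?R" "r \<in> coeffs_in ?R" "smult (c ^ k) p = q * g + r"
      "\<And>i. i \<ge> degree q \<Longrightarrow> coeff r i = 0"
      unfolding c_def using pseudo_division[OF R q(1) \<open>q \<noteq> 0\<close> p(1)] by metis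
    define C where "C = (\<lambda>x. c x ^ k)"
    have C: "C \<in> ?R" unfolding C_def by (intro poly_funs_power c is_subring_UNIV)
    have "(c ^ j) x = c x ^ j" for j x by (induction j) auto
    then have ck: "(c ^ k) x = C x" for x by (simp add: C_def)
    have eq: "smult (C x) (spec p x) = spec q x * spec g x + spec r x" for x
      using arg_cong[OF *(3), of "\<lambda>p. spec p x"] by (simp add: ck)
    have upd: "spec p' (x(v := s)) = spec p' x" if "p' \<in> coeffs_in ?R" for p' x s
      using that insert.hyps by (intro spec_cong) auto
    have a_upd: "a (x(v := s)) = poly (spec p x) s" and e_upd: "e (x(v := s)) = poly (spec q x) s" for x s
      by (simp_all add: p q upd)
    \<comment> \<open>Lines in the direction of \<open>v\<close>: where the leading coefficient
      survives, \<open>spec q x\<close> divides the remainder and exceeds it in degree.\<close>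
    have "spec r x = 0" if "c x \<noteq> 0" for x
    proof -
      have deg: "degree (spec q x) = degree q"
        using that unfolding c_def by (rule degree_spec)
      have nz: "spec q x \<noteq> 0" using that by (metis c_def coeff_0 coeff_spec)
      have "spec q x dvd spec p x"
      proof (rule insert.prems(4)[OF _ _ nz])
        show "a (\<lambda>i. (x(v := 0)) i + t * (if i = v then 1 else 0)) = poly (spec p x) t" for t
          using a_upd[of x t] by (simp add: fun_upd_def if_distrib cong: if_cong)
        show "e (\<lambda>i. (x(v := 0)) i + t * (if i = v then 1 else 0)) = poly (spec q x) t" for t
          using e_upd[of x t] by (simp add: fun_upd_def if_distrib cong: if_cong)
      qed
      then have "spec q x dvd smult (C x) (spec p x) - spec q x * spec g x"
        by (intro dvd_diff dvd_smult) auto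
      then have "spec q x dvd spec r x" by (simp add: eq)
      moreover have "degree (spec r x) < degree (spec q x)" if "spec r x \<noteq> 0"
        using that *(4) unfolding deg by (metis coeff_spec leading_coeff_0_iff not_le zero_fun_def)
      ultimately show ?thesis using dvd_imp_degree_le not_le by blast
    qed
    then have "coeff r i x = 0" if "c x \<noteq> 0" for i x
      using that by (metis coeff_0 coeff_spec)
    then have "coeff r i x = 0" for i x
      using poly_funs_cancel[OF coeffs_inD[OF *(2)] c _ y1] by (metis mult_eq_0_iff)
    then have "spec r x = 0" for x by (simp add: poly_eq_iff)
    then have eq': "smult (C x) (spec p x) = spec q x * spec g x" for x using eq[of x] by simp
    have "C y1 \<noteq> 0" using y1 by (simp add: C_def)
    \<comment> \<open>It remains to divide the coefficients of \<open>g\<close> by \<open>C\<close>;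
      by the induction hypothesis this may be tested on lines.\<close>
    have "\<exists>A \<in> ?R. \<forall>w. coeff g j w = C w * A w" for j
    proof (rule insert.IH[OF coeffs_inD[OF *(1)] C \<open>C y1 \<noteq> 0\<close>])
      fix w b :: "nat \<Rightarrow> complex" and pj qc :: "complex poly"
      assume pj: "\<And>t. coeff g j (\<lambda>i. w i + t * b i) = poly pj t"
        and qc: "\<And>t. C (\<lambda>i. w i + t * b i) = poly qc t" and nz: "qc \<noteq> 0"
      have "\<forall>i. \<exists>h. \<forall>t. coeff g i (\<lambda>i. w i + t * b i) = poly h t"
        using poly_funs_line[OF coeffs_inD[OF *(1)]] by metis
      then obtain G where G: "\<And>i t. coeff g i (\<lambda>i. w i + t * b i) = poly (G i) t" by metis
      have "poly (G j) = poly pj"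
        using G[of j] pj by (intro ext) simp
      then have "G j = pj" by (simp add: poly_eq_poly_eq_iff)
      define d where "d = degree g"
      have g_line: "poly (spec g (\<lambda>i. w i + t * b i)) s = poly (\<Sum>i\<le>d. smult (s ^ i) (G i)) t" for s t
        by (simp add: poly_spec d_def poly_sum G mult.commute)
      \<comment> \<open>The line is moved to height \<open>s\<close> in the coordinate
        \<open>v\<close>. There \<open>e\<close> divides \<open>a\<close> and cancels from the
        relation \<open>C a = e g\<close>, unless it vanishes on the whole line, which is excluded
        for all but finitely many \<open>s\<close> by a look at the parameter
        \<open>t0\<close>.\<close>
      have "infinite {s. qc dvd (\<Sum>i\<le>d. smult (s ^ i) (G i))}"
      proof -
        obtain t0 where t0: "poly qc t0 \<noteq> 0" using nz by (metis poly_all_0_iff_0)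
        define x0 where "x0 = (\<lambda>i. w i + t0 * b i)"
        have "c x0 ^ k \<noteq> 0" using t0 qc[of t0] by (simp add: C_def x0_def)
        show ?thesis
        proof (cases "k = 0")
          \<comment> \<open>With exponent zero \<open>C\<close> is \<open>1\<close>, although
            \<open>c x0\<close> may vanish.\<close>
          case True
          have "poly qc t = poly 1 t" for t using qc[of t] True by (simp add: C_def)
          then have "qc = 1" using poly_eq_poly_eq_iff by blast
          then show ?thesis by (simp add: infinite_UNIV_char_0)
        next
          case False
          then have "c x0 \<noteq> 0" using \<open>c x0 ^ k \<noteq> 0\<close> by (metis power_eq_0_iff gr0I)
          then have "spec q x0 \<noteq> 0" by (metis c_def coeff_0 coeff_spec)
          then have fin: "finite {s. poly (spec q x0) s = 0}" by (rule poly_roots_finite)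
          have "qc dvd (\<Sum>i\<le>d. smult (s ^ i) (G i))" if s: "poly (spec q x0) s \<noteq> 0" for s
          proof -
            define w' b' where "w' = w(v := s)" and "b' = b(v := 0)"
            have line: "(\<lambda>i. w' i + t * b' i) = (\<lambda>i. w i + t * b i)(v := s)" for t
              by (auto simp: w'_def b'_def fun_eq_iff)
            obtain P where P: "\<And>t. a (\<lambda>i. w' i + t * b' i) = poly P t"
              by (rule poly_funs_line[OF insert.prems(1), of w' b']) (rule that)
            obtain E where E: "\<And>t. e (\<lambda>i. w' i + t * b' i) = poly E t"
              by (rule poly_funs_line[OF insert.prems(2), of w' b']) (rule that)
            have "poly E t0 \<noteq> 0" using s E[of t0] unfolding line e_upd x0_def by simp
            then have "E \<noteq> 0" by auto
            then have "E dvd P" by (rule insert.prems(4)[OF P E])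
            then obtain H where H: "P = E * H" by (elim dvdE)
            have "poly (qc * P) t = poly (E * (\<Sum>i\<le>d. smult (s ^ i) (G i))) t" for t
            proof -
              have "poly (qc * P) t = C (\<lambda>i. w i + t * b i) * poly (spec p (\<lambda>i. w i + t * b i)) s"
                using P[of t] unfolding line a_upd by (simp add: qc)
              also have "\<dots> = poly (spec q (\<lambda>i. w i + t * b i)) s * poly (spec g (\<lambda>i. w i + t * b i)) s"
                using arg_cong[OF eq', of "\<lambda>p. poly p s"] by simp
              also have "poly (spec q (\<lambda>i. w i + t * b i)) s = poly E t"
                using E[of t] unfolding line e_upd by simp
              finally show ?thesis by (simp add: g_line)
            qed
            then have "qc * P = E * (\<Sum>i\<le>d. smult (s ^ i) (G i))" using poly_eq_poly_eq_iff by blast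
            then have "E * (qc * H) = E * (\<Sum>i\<le>d. smult (s ^ i) (G i))" by (simp add: H mult_ac)
            then have "qc * H = (\<Sum>i\<le>d. smult (s ^ i) (G i))" using \<open>E \<noteq> 0\<close> by simp
            then show ?thesis by (metis dvd_triv_left)
          qed
          then have sub: "UNIV - {s. poly (spec q x0) s = 0} \<subseteq> {s. qc dvd (\<Sum>i\<le>d. smult (s ^ i) (G i))}" by auto
          show ?thesis
            by (rule infinite_super[OF sub Diff_infinite_finite[OF fin infinite_UNIV_char_0]])
        qed
      qed
      \<comment> \<open>The remainders modulo \<open>qc\<close> combine linearly with powers of
        \<open>s\<close>. The combination vanishes for infinitely many \<open>s\<close>, so each
        remainder vanishes, coefficient by coefficient.\<close>
      have rem: "(\<Sum>i\<le>d. smult (s ^ i) (G i mod qc)) = (\<Sum>i\<le>d. smult (s ^ i) (G i)) mod qc" for s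
        by (induction d) (simp_all add: poly_mod_add_left mod_smult_left)
      have "G i mod qc = 0" if "i \<le> d" for i
      proof (rule poly_eqI)
        fix l
        define u where "u = (\<Sum>i\<le>d. monom (coeff (G i mod qc) l) i)"
        have "poly u s = 0" if "qc dvd (\<Sum>i\<le>d. smult (s ^ i) (G i))" for s
        proof -
          have "(\<Sum>i\<le>d. smult (s ^ i) (G i mod qc)) = 0" using that by (simp add: rem)
          from arg_cong[OF this, of "\<lambda>p. coeff p l"] show ?thesis
            by (simp add: u_def poly_sum poly_monom coeff_sum mult.commute)
        qed
        then have "{s. qc dvd (\<Sum>i\<le>d. smult (s ^ i) (G i))} \<subseteq> {s. poly u s = 0}" by auto
        then have "infinite {s. poly u s = 0}"
          using \<open>infinite {s. qc dvd _ s}\<close> by (rule infinite_super)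
        then have "u = 0" by (metis poly_roots_finite)
        then have "coeff u i = 0" by simp
        then show "coeff (G i mod qc) l = coeff 0 l" using \<open>i \<le> d\<close> by (simp add: u_def coeff_sum)
      qed
      moreover have "G j = 0" if "j > d"
        using that G[of j] poly_eq_poly_eq_iff[of "G j" 0] by (auto simp: d_def coeff_eq_0 fun_eq_iff)
      ultimately have "qc dvd G j" by (cases "j \<le> d") auto
      then show "qc dvd pj" using \<open>G j = pj\<close> by simp
    qed
    then have "\<forall>j. \<exists>A. A \<in> ?R \<and> (\<forall>w. coeff g j w = C w * A w)" by blast
    from choice[OF this] obtain A where A: "\<And>j. A j \<in> ?R" "\<And>j w. coeff g j w = C w * A j w" by blast
    define h where "h = (\<lambda>w. \<Sum>j\<le>degree g. A j w * w v ^ j)"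
    have h: "h \<in> poly_funs UNIV (insert v V)"
      unfolding h_def
      by (intro poly_funs_sum poly_funs.mult poly_funs_power poly_funs.var is_subring_UNIV poly_funs_mono[OF A(1)]) auto
    have g_h: "poly (spec g w) (w v) = C w * h w" for w
      by (simp add: poly_spec h_def A sum_distrib_left mult_ac)
    have zero: "C w * (a w - e w * h w) = 0" for w
      using arg_cong[OF eq'[of w], of "\<lambda>p. poly p (w v)"] by (simp add: p q g_h algebra_simps)
    have diff: "(\<lambda>w. a w - e w * h w) \<in> poly_funs UNIV (insert v V)"
      by (intro poly_funs_diff poly_funs.mult h insert.prems is_subring_UNIV)
    have "C \<in> poly_funs UNIV (insert v V)"
      by (rule poly_funs_mono[OF C]) auto
    from poly_funs_cancel[OF diff this zero \<open>C y1 \<noteq> 0\<close>] have "a w - e w * h w = 0" for w .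
    then show ?case using h by (intro bexI[of _ h]) auto
  qed
  then show ?thesis using that by blast
qed

section \<open>Inverting injective birational maps\<close>

text \<open>Invariance of domain for the map on real coordinates: the image is open in
  \<open>E\<close>, and a basic open set of the product topology inside it yields a box around
  \<open>F z\<close>.\<close>

lemma inj_polynomial_map_open:
  fixes F :: "nat \<Rightarrow> (nat \<Rightarrow> complex) \<Rightarrow> complex"
  assumes F: "\<And>i. i < n \<Longrightarrow> F i \<in> poly_funs UNIV {..<n}"
    and inj: "coord_inj n F"
  obtains \<epsilon> where "\<epsilon> > 0" "\<And>y. (\<And>i. i < n \<Longrightarrow> cmod (y i - F i z) < \<epsilon>) \<Longrightarrow> \<exists>x. \<forall>i<n. F i x = y i"
proof -
  define E where "E = Euclidean_space (2 * n)"
  define emb where "emb z I = (if I < 2 * n then real_coord I z else 0)" for z I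
  define T where "T X = emb (\<lambda>a. F a (complex_coords X))" for X
  have emb_top: "emb z \<in> topspace E" for z
    by (simp add: E_def emb_def topspace_Euclidean_space)
  have cc_emb: "complex_coords (emb z) a = z a" if "a < n" for z a
    using that by (auto simp: complex_coords_def emb_def real_coord_def complex_eq_iff)
  have F_cong: "F a x = F a y" if "a < n" "\<And>b. b < n \<Longrightarrow> x b = y b" for a x y
    using that by (intro poly_funs_cong[OF F]) auto
  have "continuous_on UNIV (\<lambda>X. real_coord I (\<lambda>a. F a (complex_coords X)))" if I: "I < 2 * n" for I
  proof -
    have "continuous_on UNIV (\<lambda>X. F (I div 2) (complex_coords X))"
      using continuous_on_poly_funs[OF F continuous_on_complex_coords, of "I div 2"] I by simp
    then show ?thesis by (cases "even I") (auto simp: real_coord_def intro!: continuous_intros)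
  qed
  then have "continuous_map E E T"
    unfolding T_def[abs_def] emb_def E_def continuous_map_componentwise_Euclidean_space
    by (auto simp: continuous_map_Euclidean_space_iff intro: continuous_on_subset)
  moreover have "inj_on T (topspace E)"
  proof (rule inj_onI)
    fix X Y assume XY: "X \<in> topspace E" "Y \<in> topspace E" "T X = T Y"
    have "F j (complex_coords X) = F j (complex_coords Y)" if "j < n" for j
      using fun_cong[OF XY(3), of "2 * j"] fun_cong[OF XY(3), of "2 * j + 1"] that
      by (auto simp: T_def emb_def real_coord_def complex_eq_iff)
    then have *: "complex_coords X a = complex_coords Y a" if "a < n" for a
      using coord_injD[OF inj] that by blast
    show "X = Y"
    proof
      fix I :: nat
      have "I = 2 * (I div 2) \<or> I = 2 * (I div 2) + 1" by auto
      then show "X I = Y I"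
        using XY(1,2) *[of "I div 2"] by (cases "I < 2 * n") (auto simp: E_def topspace_Euclidean_space complex_coords_def)
    qed
  qed
  ultimately have "openin E (T ` topspace E)"
    using invariance_of_domain_Euclidean_space[of "2 * n" "topspace E" T] by (simp add: E_def)
  then obtain W where W: "openin (powertop_real UNIV) W" "T ` topspace E = W \<inter> {x. \<forall>i\<ge>2 * n. x i = 0}"
    by (auto simp: E_def Euclidean_space_def openin_subtopology)
  have "T (emb z) \<in> W" using W(2) emb_top by blast
  then obtain U where U: "\<And>I. openin euclideanreal (U I)" "T (emb z) \<in> Pi\<^sub>E UNIV U" "Pi\<^sub>E UNIV U \<subseteq> W"
    using W(1) unfolding openin_product_topology_alt by (metis UNIV_I)
  have "\<forall>I. \<exists>e>0. ball (T (emb z) I) e \<subseteq> U I"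
    using U(1,2) by (auto simp: open_contains_ball PiE_def Pi_def)
  then obtain e where e: "\<And>I. e I > 0" "\<And>I. ball (T (emb z) I) (e I) \<subseteq> U I" by metis
  \<comment> \<open>A minimum over the real coordinates below \<open>2 * n\<close> suffices, since
    beyond them both points are zero. The \<open>1\<close> keeps the set nonempty.\<close>
  define \<epsilon> where "\<epsilon> = Min (insert 1 (e ` {..<2 * n}))"
  have \<epsilon>: "\<epsilon> > 0" "\<And>I. I < 2 * n \<Longrightarrow> \<epsilon> \<le> e I"
    using e(1) by (auto simp: \<epsilon>_def)
  have "\<exists>x. \<forall>i<n. F i x = y i" if y: "\<And>i. i < n \<Longrightarrow> cmod (y i - F i z) < \<epsilon>" for y
  proof -
    have "emb y I \<in> U I" for I
    proof (cases "I < 2 * n")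
      case True
      then have a: "I div 2 < n" by auto
      have "\<bar>real_coord I y - real_coord I (\<lambda>a. F a z)\<bar> \<le> cmod (y (I div 2) - F (I div 2) z)"
        using abs_Re_le_cmod[of "y (I div 2) - F (I div 2) z"] abs_Im_le_cmod[of "y (I div 2) - F (I div 2) z"]
        by (auto simp: real_coord_def)
      also have "\<dots> < e I" using y[OF a] \<epsilon>(2)[OF True] by simp
      finally have "dist (T (emb z) I) (emb y I) < e I"
        using True a F_cong[OF a, of "complex_coords (emb z)" z] cc_emb
        by (cases "even I") (simp_all add: T_def emb_def real_coord_def dist_real_def abs_minus_commute)
      then show ?thesis using e(2)[of I] by auto
    next
      case False
      then have "T (emb z) I = emb y I" by (simp add: T_def emb_def)
      then show ?thesis using U(2) by (metis PiE_mem UNIV_I)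
    qed
    then have "emb y \<in> W" using U(3) by (auto simp: PiE_def)
    moreover have "emb y \<in> {x. \<forall>i\<ge>2 * n. x i = 0}" by (simp add: emb_def)
    ultimately obtain X where X: "emb y = T X" using W(2) by blast
    have "F i (complex_coords X) = y i" if "i < n" for i
      using fun_cong[OF X, of "2 * i"] fun_cong[OF X, of "2 * i + 1"] that
      by (auto simp: T_def emb_def real_coord_def complex_eq_iff)
    then show ?thesis by blast
  qed
  then show ?thesis using that \<epsilon>(1) by blast
qed

text \<open>
  The shear turns the direction of \<open>x\<^sub>v\<close> into a vector at which the leading homogeneous part of \<open>Q\<close>
  does not vanish.
\<close>

lemma exists_monic_coordinates:
  fixes Q :: "(nat \<Rightarrow> complex) \<Rightarrow> complex"
  assumes v: "v \<notin> V" and Q: "Q \<in> poly_funs UNIV (insert v V)" and Q0: "Q y0 \<noteq> 0"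
  obtains b q \<kappa> where "q \<in> coeffs_in (poly_funs UNIV V)" "lead_coeff q = 1" "\<kappa> \<noteq> 0"
    "\<And>y. Q (\<lambda>i. if i = v then y v else y i + y v * b i) = \<kappa> * poly (spec q y) (y v)"
proof -
  let ?W = "insert v V"
  obtain p where p: "p \<in> coeffs_in (poly_funs UNIV ?W)"
    "\<And>k t x. coeff p k (\<lambda>i. t * x i) = t ^ k * coeff p k x" "\<And>x. Q x = poly (spec p x) 1"
    using poly_funs_homogeneous[OF is_subring_UNIV Q] by blast
  have "p \<noteq> 0" using Q0 p(3) by auto
  define d where "d = degree p"
  have "coeff p d \<noteq> 0" using \<open>p \<noteq> 0\<close> by (simp add: d_def)
  then obtain a where a: "coeff p d a \<noteq> 0" by (auto simp: fun_eq_iff)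
  \<comment> \<open>Both the leading form and the coordinate \<open>v\<close> are nonzero at
    \<open>x\<close>, so it can be rescaled to a \<open>b\<close> with
    \<open>b v = 1\<close>.\<close>
  obtain x where x: "coeff p d x \<noteq> 0" "x v \<noteq> 0"
    by (rule poly_funs_mult_nonzero[OF coeffs_inD[OF p(1)] poly_funs.var[of v ?W UNIV] a, of "\<lambda>_. 1"])
      (auto intro: that)
  define b where "b = (\<lambda>i. 1 / x v * x i)"
  define \<kappa> where "\<kappa> = coeff p d b"
  have \<kappa>: "\<kappa> \<noteq> 0" unfolding \<kappa>_def b_def p(2) using x by simp
  have bv: "b v = 1" using x by (simp add: b_def)
  define T where "T y i = (if i = v then y v else y i + y v * b i)" for y i
  have T_scale: "T (\<lambda>i. t * y i) = (\<lambda>i. t * T y i)" for t y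
    by (auto simp: T_def fun_eq_iff algebra_simps)
  have T: "(\<lambda>y. T y i) \<in> poly_funs UNIV ?W" if "i \<in> ?W" for i
    using that by (cases "i = v") (auto simp: T_def intro!: poly_funs.intros)
  have "\<exists>q. q \<in> coeffs_in (poly_funs UNIV V) \<and> (\<forall>y. coeff p k (T y) = poly (spec q y) (y v))" for k
  proof -
    have "(\<lambda>y. coeff p k (\<lambda>i. T y i)) \<in> poly_funs UNIV ?W"
      by (rule poly_funs_subst[OF coeffs_inD[OF p(1)] T])
    then show ?thesis
      using poly_funs_expand[OF is_subring_UNIV, of "\<lambda>y. coeff p k (T y)" v V] by blast
  qed
  then have "\<forall>k. \<exists>q. q \<in> coeffs_in (poly_funs UNIV V) \<and> (\<forall>y. coeff p k (T y) = poly (spec q y) (y v))" by blast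
  from choice[OF this] obtain q where q: "\<And>k. q k \<in> coeffs_in (poly_funs UNIV V)"
    "\<And>k y. coeff p k (T y) = poly (spec (q k) y) (y v)" by blast
  have upd: "spec (q k) (y(v := s)) = spec (q k) y" for k y s
    using q(1) v by (intro spec_cong) auto
  have hom: "coeff (q k) j (\<lambda>i. t * y i) * t ^ j = t ^ k * coeff (q k) j y" for k j t y
  proof -
    have "poly (pcompose (spec (q k) (\<lambda>i. t * y i)) [:0, t:]) s = poly (smult (t ^ k) (spec (q k) y)) s" for s
    proof -
      define y' where "y' = y(v := s)"
      have "coeff p k (T (\<lambda>i. t * y' i)) = t ^ k * coeff p k (T y')"
        unfolding T_scale by (rule p(2))
      moreover have "(\<lambda>i. t * y' i) = (\<lambda>i. t * y i)(v := t * s)" by (auto simp: y'_def)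
      ultimately show ?thesis
        unfolding q(2) by (simp add: upd y'_def poly_pcompose mult.commute)
    qed
    then have "pcompose (spec (q k) (\<lambda>i. t * y i)) [:0, t:] = smult (t ^ k) (spec (q k) y)"
      using poly_eq_poly_eq_iff by blast
    from arg_cong[OF this, of "\<lambda>p. coeff p j"] show ?thesis
      by (simp add: coeff_pcompose_linear mult.commute)
  qed
  \<comment> \<open>Coefficient \<open>j\<close> of \<open>q k\<close> is homogeneous of degree
    \<open>k - j\<close>; for \<open>j \<ge> k\<close> this leaves a constant or zero.\<close>
  have high: "coeff (q k) j y = (if j = k then coeff (q k) j (\<lambda>_. 0) else 0)" if "j \<ge> k" for k j y
  proof -
    obtain r where r: "\<And>t. coeff (q k) j (\<lambda>i. 0 + t * y i) = poly r t"
      by (rule poly_funs_line[OF coeffs_inD[OF q(1)], of k j "\<lambda>_. 0" y]) (rule that)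
    have "poly (r * monom 1 (j - k)) t = coeff (q k) j y" if "t \<noteq> 0" for t
    proof -
      have "t ^ j = t ^ k * t ^ (j - k)" using \<open>j \<ge> k\<close> by (simp flip: power_add)
      then have "t ^ k * (poly r t * t ^ (j - k)) = t ^ k * coeff (q k) j y"
        using hom[of k j t y] r[of t] by (simp add: mult_ac)
      then show ?thesis using that by (simp add: poly_monom)
    qed
    then have "r * monom 1 (j - k) = [:coeff (q k) j y:]" by (intro poly_eqI_nonzero) simp
    then have "coeff (q k) j y = poly (r * monom 1 (j - k)) 0" by simp
    then show ?thesis using r[of 0] \<open>j \<ge> k\<close> by (auto simp: poly_monom)
  qed
  \<comment> \<open>The shear sends the unit vector in direction \<open>v\<close> to
    \<open>b\<close>. There the lower coefficients of \<open>q k\<close> vanish, being forms of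
    positive degree evaluated at zero.\<close>
  have diag: "coeff (q k) k y = coeff p k b" for k y
  proof -
    define o1 :: "nat \<Rightarrow> complex" where "o1 = (\<lambda>_. 0)(v := 1)"
    have "T o1 = b" using bv by (auto simp: T_def o1_def fun_eq_iff)
    then have "coeff p k b = poly (spec (q k) (\<lambda>_. 0)) 1"
      using q(2)[of k o1] by (simp add: o1_def upd)
    also have "spec (q k) (\<lambda>_. 0) = monom (coeff (q k) k (\<lambda>_. 0)) k"
    proof (rule poly_eqI)
      fix j
      show "coeff (spec (q k) (\<lambda>_. 0)) j = coeff (monom (coeff (q k) k (\<lambda>_. 0)) k) j"
      proof (cases "j < k")
        case True
        have "coeff (q k) j (\<lambda>_. 0) * 2 ^ j = 2 ^ j * 2 ^ (k - j) * coeff (q k) j (\<lambda>_. 0)"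
          using hom[of k j 2 "\<lambda>_. 0"] True by (simp flip: power_add)
        then have "coeff (q k) j (\<lambda>_. 0) * (2 ^ (k - j) - 1) = 0" by (simp add: algebra_simps)
        moreover have "(2 :: complex) ^ (k - j) \<noteq> 1"
        proof
          assume "(2 :: complex) ^ (k - j) = 1"
          then have "(2 :: nat) ^ (k - j) = 1" by (metis of_nat_1 of_nat_eq_iff of_nat_numeral of_nat_power)
          then show False using True by simp
        qed
        ultimately show ?thesis using True by simp
      next
        case False
        then show ?thesis using high[of k j "\<lambda>_. 0"] by (cases "j = k") auto
      qed
    qed
    finally show ?thesis using high[of k k y] by (simp add: poly_monom)
  qed
  define qq where "qq = (\<Sum>k\<le>d. q k)"
  note C = is_subringD[OF is_subring_coeffs_in[OF is_subring_poly_funs[OF is_subring_UNIV, of V]]]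
  have qq: "qq \<in> coeffs_in (poly_funs UNIV V)"
    unfolding qq_def by (rule is_subring_sum[OF is_subring_coeffs_in[OF is_subring_poly_funs[OF is_subring_UNIV]] q(1)])
  have coeff_qq: "coeff qq j y = (\<Sum>k\<le>d. coeff (q k) j y)" for j y
    by (simp add: qq_def coeff_sum sum_apply)
  define q' where "q' = smult (\<lambda>_. 1 / \<kappa>) qq"
  have "coeff qq d y = \<kappa>" for y
  proof -
    have "coeff qq d y = (\<Sum>k\<le>d. if k = d then \<kappa> else 0)"
      unfolding coeff_qq
    proof (intro sum.cong refl)
      fix k assume "k \<in> {..d}"
      then show "coeff (q k) d y = (if k = d then \<kappa> else 0)"
        using diag[of d y] high[of k d y] by (auto simp: \<kappa>_def)
    qed
    then show ?thesis by simp
  qed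
  then have top: "coeff q' d = 1" using \<kappa> by (auto simp: q'_def fun_eq_iff one_fun_def)
  have "coeff qq j y = 0" if "j > d" for j y
    unfolding coeff_qq
  proof (intro sum.neutral ballI)
    fix k assume "k \<in> {..d}"
    then show "coeff (q k) j y = 0" using high[of k j y] that by simp
  qed
  then have "coeff q' j = 0" if "j > d" for j
    using that by (auto simp: q'_def fun_eq_iff)
  then have "degree q' = d"
    using top by (intro antisym degree_le le_degree) auto
  show ?thesis
  proof
    show "q' \<in> coeffs_in (poly_funs UNIV V)"
      unfolding q'_def by (intro coeffs_in_smult is_subring_poly_funs is_subring_UNIV qq poly_funs.const UNIV_I)
    show "lead_coeff q' = 1" using \<open>degree q' = d\<close> top by simp
    show "\<kappa> \<noteq> 0" by (rule \<kappa>)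
    fix y
    have "spec qq y = (\<Sum>k\<le>d. spec (q k) y)"
      by (intro poly_eqI) (simp add: coeff_qq coeff_sum)
    then have "poly (spec qq y) (y v) = (\<Sum>k\<le>d. coeff p k (T y))"
      by (simp add: q(2) poly_sum)
    also have "\<dots> = Q (T y)" by (simp add: p(3) poly_spec d_def)
    finally have "Q (T y) = \<kappa> * poly (spec q' y) (y v)"
      using \<kappa> by (simp add: q'_def)
    then show "Q (\<lambda>i. if i = v then y v else y i + y v * b i) = \<kappa> * poly (spec q' y) (y v)"
      by (simp add: T_def[abs_def])
  qed
qed

text \<open>
  Among the denominators \<open>D\<close> of the inverse map choose one of least degree in \<open>x\<^sub>v\<close>. It divides a
  power of its leading coefficient times the monic denominator \<open>Q\<^sub>0\<close>, so by Gauss's lemma it may be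
  taken monic. If \<open>D\<close> vanished at a point of the open image of \<open>F\<close>, then so would the numerators on
  the nearby zeros of \<open>D\<close>, and a common factor could be cancelled. Hence \<open>D \<circ> F\<close> has no zeros and
  is constant.
\<close>

lemma inverse_of_monic_denominator:
  fixes F :: "nat \<Rightarrow> (nat \<Rightarrow> complex) \<Rightarrow> complex"
  assumes V: "finite V" "v \<notin> V" and W: "W = insert v V"
    and F: "\<And>i. i \<in> W \<Longrightarrow> F i \<in> poly_funs UNIV W"
    and op: "\<And>z. \<exists>\<epsilon>>0. \<forall>y. (\<forall>i\<in>W. cmod (y i - F i z) < \<epsilon>) \<longrightarrow> (\<exists>x. \<forall>i\<in>W. F i x = y i)"
    and Q0: "Q0 \<in> coeffs_in (poly_funs UNIV V)" "lead_coeff Q0 = 1"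
    and P0: "\<And>i. i \<in> W \<Longrightarrow> P0 i \<in> poly_funs UNIV W"
    and QP0: "\<And>z i. i \<in> W \<Longrightarrow> poly (spec Q0 (\<lambda>j. F j z)) (F v z) * z i = P0 i (\<lambda>j. F j z)"
  obtains A where "\<And>i. i \<in> W \<Longrightarrow> A i \<in> poly_funs UNIV W" "\<And>z i. i \<in> W \<Longrightarrow> z i = A i (\<lambda>j. F j z)"
proof -
  let ?R = "poly_funs UNIV V"
  let ?RW = "poly_funs UNIV W"
  have R: "is_subring ?R" and RW: "is_subring ?RW" by (simp_all add: is_subring_poly_funs)
  note C = is_subringD[OF is_subring_coeffs_in[OF R]] and R' = is_subringD[OF R]
  define ev where "ev p y = poly (spec p y) (y v)" for p and y :: "nat \<Rightarrow> complex"
  define Fv where "Fv z = (\<lambda>j. F j z)" for z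
  have finW: "finite W" using V W by simp
  have VW: "?R \<subseteq> ?RW" using poly_funs_mono[of _ UNIV V UNIV W] W by blast
  have ev_PF: "ev p \<in> ?RW" if "p \<in> coeffs_in ?R" for p
    unfolding ev_def[abs_def]
    by (rule poly_funs_poly_spec[OF is_subring_UNIV coeffs_in_mono[OF VW that] poly_funs.var]) (simp add: W)
  have upd: "spec p (y(v := s)) = spec p y" if "p \<in> coeffs_in ?R" for p y s
    using that V by (intro spec_cong) auto
  have ev_upd: "ev p (y(v := s)) = poly (spec p y) s" if "p \<in> coeffs_in ?R" for p y s
    by (simp add: ev_def upd[OF that])
  have ev_0: "p = 0" if p: "p \<in> coeffs_in ?R" and 0: "\<And>y. ev p y = 0" for p
  proof (rule poly_eqI, rule ext)
    fix i y
    have "poly (spec p y) = poly 0" using 0 ev_upd[OF p, of y] by (auto simp: fun_eq_iff)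
    then have "spec p y = 0" by (simp only: poly_eq_poly_eq_iff)
    then show "coeff p i y = coeff 0 i y" by (metis coeff_0 coeff_spec zero_fun_def)
  qed
  have ev_simps: "ev (p + q) y = ev p y + ev q y" "ev (p - q) y = ev p y - ev q y"
    "ev (p * q) y = ev p y * ev q y" "ev (smult c p) y = c y * ev p y" for p q c y
    by (simp_all add: ev_def)
  have ev_expand: "\<exists>p\<in>coeffs_in ?R. f = ev p" if "f \<in> ?RW" for f
    using poly_funs_expand[OF is_subring_UNIV, of f v V] that W unfolding ev_def[abs_def] by (metis ext)
  have comp: "(\<lambda>z. f (Fv z)) \<in> ?RW" if "f \<in> ?RW" for f
    unfolding Fv_def by (rule poly_funs_subst[OF that F])
  \<comment> \<open>The image of \<open>F\<close> contains a box, so polynomial identities on the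
    image hold everywhere.\<close>
  have image_dense: "f y = 0" if f: "f \<in> ?RW" and 0: "\<And>z. f (Fv z) = 0" for f y
  proof -
    obtain \<epsilon> where \<epsilon>: "\<epsilon> > 0" "\<forall>y. (\<forall>i\<in>W. cmod (y i - F i (\<lambda>_. 0)) < \<epsilon>) \<longrightarrow> (\<exists>x. \<forall>i\<in>W. F i x = y i)"
      using op[of "\<lambda>_. 0"] by blast
    show ?thesis
    proof (rule poly_funs_eq_0_on_box[OF finW f \<epsilon>(1), of "Fv (\<lambda>_. 0)"])
      fix y assume "\<And>i. i \<in> W \<Longrightarrow> cmod (y i - Fv (\<lambda>_. 0) i) < \<epsilon>"
      then obtain x where "\<forall>i\<in>W. F i x = y i" using \<epsilon>(2) unfolding Fv_def by blast
      then have "f y = f (Fv x)" by (intro poly_funs_cong[OF f]) (simp add: Fv_def)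
      then show "f y = 0" using 0 by simp
    qed
  qed
  have cancel: "f z = 0" if g: "g \<in> ?RW" "g y \<noteq> 0" and f: "f \<in> ?RW" "\<And>z. g (Fv z) * f z = 0" for f g y z
  proof -
    obtain z' where "g (Fv z') \<noteq> 0" using image_dense[OF g(1)] g(2) by blast
    from poly_funs_cancel[OF f(1) comp[OF g(1)] f(2) this] show ?thesis .
  qed
  \<comment> \<open>Denominators are read as polynomials in the coordinate \<open>v\<close>, so that
    a least degree and pseudo-division make sense.\<close>
  define adm where "adm D P \<longleftrightarrow> D \<in> coeffs_in ?R \<and> D \<noteq> 0 \<and>
    (\<forall>i\<in>W. P i \<in> ?RW \<and> (\<forall>z. ev D (Fv z) * z i = P i (Fv z)))" for D P
  define m where "m = (LEAST m. \<exists>D P. adm D P \<and> degree D = m)"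
  have "Q0 \<noteq> 0" using Q0(2) by auto
  then have "adm Q0 P0" using Q0 P0 QP0 by (auto simp: adm_def ev_def Fv_def)
  then have "\<exists>m D P. adm D P \<and> degree D = m" by blast
  from LeastI_ex[OF this] obtain D P where D: "adm D P" "degree D = m"
    unfolding m_def by blast
  have min: "m \<le> degree D'" if "adm D' P'" for D' P'
    unfolding m_def using that by (intro Least_le) blast
  have Din: "D \<in> coeffs_in ?R" "D \<noteq> 0" and P: "\<And>i. i \<in> W \<Longrightarrow> P i \<in> ?RW"
    "\<And>i z. i \<in> W \<Longrightarrow> ev D (Fv z) * z i = P i (Fv z)"
    using D(1) by (auto simp: adm_def)
  define e where "e = lead_coeff D"
  have e: "e \<in> ?R" using Din by (auto simp: e_def intro: coeffs_inD)
  have "e \<noteq> 0" using Din by (simp add: e_def)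
  then obtain ye where ye: "e ye \<noteq> 0" by (auto simp: fun_eq_iff)
  obtain k g where g: "g \<in> coeffs_in ?R" "smult (e ^ k) Q0 = D * g"
  proof -
    obtain k g r where *: "g \<in> coeffs_in ?R" "r \<in> coeffs_in ?R" "smult (e ^ k) Q0 = D * g + r"
      "\<And>i. i \<ge> degree D \<Longrightarrow> coeff r i = 0"
      unfolding e_def using pseudo_division[OF R Din Q0(1)] by metis
    \<comment> \<open>A nonzero remainder would again be a denominator, with numerators
      \<open>P'\<close> and of smaller degree.\<close>
    have "r = 0"
    proof (rule ccontr)
      assume "r \<noteq> 0"
      define P' where "P' i y = (e ^ k) y * P0 i y - ev g y * P i y" for i y
      have "adm r P'"
        unfolding adm_def
      proof (intro conjI ballI allI)
        fix i assume i: "i \<in> W"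
        show "P' i \<in> ?RW"
          unfolding P'_def[abs_def] using VW R'(7)[OF e] i
          by (intro poly_funs_diff is_subring_UNIV poly_funs.mult P P0 ev_PF *) auto
        fix z
        have r: "r = smult (e ^ k) Q0 - D * g" using *(3) by simp
        have evr: "ev r (Fv z) = (e ^ k) (Fv z) * ev Q0 (Fv z) - ev D (Fv z) * ev g (Fv z)"
          unfolding r by (simp only: ev_simps)
        have "ev r (Fv z) * z i = (e ^ k) (Fv z) * (ev Q0 (Fv z) * z i) - ev g (Fv z) * (ev D (Fv z) * z i)"
          unfolding evr by (simp add: algebra_simps)
        also have "ev Q0 (Fv z) * z i = P0 i (Fv z)" using QP0[OF i] by (simp add: ev_def Fv_def)
        finally show "ev r (Fv z) * z i = P' i (Fv z)" by (simp add: P'_def P(2)[OF i])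
      qed (use * \<open>r \<noteq> 0\<close> in auto)
      then have "degree D \<le> degree r" using min D(2) by simp
      then show False using *(4)[of "degree r"] \<open>r \<noteq> 0\<close> by simp
    qed
    then show ?thesis using that * by simp
  qed
  have "\<exists>a \<in> ?R. \<forall>w. coeff D j w = e w * a w" for j
  proof -
    have "\<exists>a. a \<in> ?R \<and> (\<forall>w. coeff D j w = e w * a w)"
    proof (rule poly_funs_dvd_of_lines[OF V(1) coeffs_inD[OF Din(1)] e ye])
      fix w b p q
      assume p: "\<And>t. coeff D j (\<lambda>i. w i + t * b i) = poly p t"
        and q: "\<And>t. e (\<lambda>i. w i + t * b i) = poly q t" and "q \<noteq> 0"
      \<comment> \<open>Restriction to the line, as a polynomial in its parameter. It is a ring
        homomorphism on polynomial functions because a polynomial over \<complex> is determined by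
        its values. Applied to coefficients it turns the relation between \<open>Q0\<close>,
        \<open>D\<close> and \<open>g\<close> into one over \<open>complex poly\<close>, where
        Gauss's lemma applies.\<close>
      define \<rho> where "\<rho> f = (SOME p. \<forall>t. f (\<lambda>i. w i + t * b i) = poly p t)" for f :: "(nat \<Rightarrow> complex) \<Rightarrow> complex"
      have \<rho>: "f (\<lambda>i. w i + t * b i) = poly (\<rho> f) t" if "f \<in> ?R" for f t
      proof -
        have "\<exists>p. \<forall>t. f (\<lambda>i. w i + t * b i) = poly p t"
          by (rule poly_funs_line[OF that, of w b]) blast
        from someI_ex[OF this] show ?thesis unfolding \<rho>_def by blast
      qed
      have \<rho>_eq: "\<rho> f = p'" if "f \<in> ?R" "\<And>t. f (\<lambda>i. w i + t * b i) = poly p' t" for f p'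
      proof -
        have "poly (\<rho> f) = poly p'" using \<rho>[OF that(1)] that(2) by (auto simp: fun_eq_iff)
        then show ?thesis by (simp only: poly_eq_poly_eq_iff)
      qed
      have \<rho>0: "\<rho> 0 = 0" using R'(2) by (intro \<rho>_eq) auto
      have \<rho>1: "\<rho> 1 = 1" using R'(1) by (intro \<rho>_eq) auto
      have \<rho>_mult: "\<rho> (f * f') = \<rho> f * \<rho> f'" if "f \<in> ?R" "f' \<in> ?R" for f f'
        using that \<rho> by (intro \<rho>_eq R'(4)) auto
      have \<rho>_sum: "\<rho> (\<Sum>i\<in>I. f i) = (\<Sum>i\<in>I. \<rho> (f i))" if "\<And>i. i \<in> I \<Longrightarrow> f i \<in> ?R" for f and I :: "nat set"
        using that \<rho> by (intro \<rho>_eq is_subring_sum[OF R]) (auto simp: sum_apply poly_sum)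
      define \<Phi> where "\<Phi> = map_poly \<rho>"
      have \<Phi>: "coeff (\<Phi> p) i = \<rho> (coeff p i)" for p i
        by (simp add: \<Phi>_def coeff_map_poly \<rho>0)
      have ein: "e ^ k \<in> ?R" by (rule R'(7)[OF e])
      have "\<Phi> (smult (e ^ k) Q0) = smult (\<rho> (e ^ k)) (\<Phi> Q0)"
        using Q0 ein by (intro poly_eqI) (simp add: \<Phi> \<rho>_mult coeffs_inD)
      moreover have "\<Phi> (D * g) = \<Phi> D * \<Phi> g"
        using Din g by (intro poly_eqI) (simp add: \<Phi> coeff_mult \<rho>_sum \<rho>_mult coeffs_inD R')
      ultimately have eq: "smult (\<rho> (e ^ k)) (\<Phi> Q0) = \<Phi> D * \<Phi> g" using g(2) by simp
      have \<rho>e: "\<rho> e = q" using q by (intro \<rho>_eq e) auto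
      have "\<rho> (e ^ k) = q ^ k"
        by (induction k) (simp_all only: power_0 power_Suc \<rho>1 \<rho>_mult[OF e R'(7)[OF e]] \<rho>e)
      then have nz: "\<rho> (e ^ k) \<noteq> 0" using \<open>q \<noteq> 0\<close> by simp
      have "degree (\<Phi> Q0) = degree Q0"
        using Q0(2) by (intro antisym degree_le le_degree) (auto simp: \<Phi> \<rho>0 \<rho>1 coeff_eq_0)
      then have lcQ: "lead_coeff (\<Phi> Q0) = 1" using Q0(2) by (simp add: \<Phi> \<rho>1)
      have "degree (\<Phi> D) = degree D"
        using \<open>q \<noteq> 0\<close> by (intro antisym degree_le le_degree) (auto simp: \<Phi> \<rho>0 \<rho>e coeff_eq_0 simp flip: e_def)
      then have lcD: "lead_coeff (\<Phi> D) = q" by (simp add: \<Phi> \<rho>e flip: e_def)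
      have "\<rho> (e ^ k) = lead_coeff (\<Phi> D) * lead_coeff (\<Phi> g)"
        using arg_cong[OF eq, of lead_coeff] lcQ nz by (simp add: lead_coeff_mult)
      from lead_coeff_dvd_coeff_of_monic_multiple[OF eq nz lcQ this, of j]
      have "q dvd coeff (\<Phi> D) j" by (simp only: lcD)
      then have "q dvd \<rho> (coeff D j)" by (simp only: \<Phi>)
      moreover have "\<rho> (coeff D j) = p" using p Din by (intro \<rho>_eq coeffs_inD) auto
      ultimately show "q dvd p" by simp
    qed blast
    then show ?thesis by blast
  qed
  then have "\<forall>j. \<exists>a. a \<in> ?R \<and> (\<forall>w. coeff D j w = e w * a w)" by blast
  from choice[OF this] obtain a where a: "\<And>j. a j \<in> ?R" "\<And>j w. coeff D j w = e w * a j w" by blast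
  define D' where "D' = monom 1 m + (\<Sum>j<m. monom (a j) j)"
  have coeff_D': "coeff D' j = (if j = m then 1 else if j < m then a j else 0)" for j
    by (simp add: D'_def coeff_sum)
  have D'in: "D' \<in> coeffs_in ?R"
    using a(1) R' by (auto simp: coeffs_in_def coeff_D')
  have "degree D' = m"
    by (intro antisym degree_le le_degree) (auto simp: coeff_D')
  then have lcD': "lead_coeff D' = 1" by (simp add: coeff_D')
  have D_D': "D = smult e D'"
  proof (rule poly_eqI, rule ext)
    fix j w
    show "coeff D j w = coeff (smult e D') j w"
      using a(2)[of j w] D(2) by (auto simp: coeff_D' e_def coeff_eq_0)
  qed
  \<comment> \<open>From \<open>D = e D'\<close> one gets only that \<open>e D'\<close> is a
    denominator. To remove \<open>e\<close>, divide \<open>D' p0\<close> by the monic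
    \<open>Q0\<close>: the remainder satisfies \<open>e B = Q0 (P i - e A)\<close>, so
    \<open>Q0\<close> divides \<open>B\<close> wherever \<open>e\<close> is nonzero, and the degree
    of \<open>B\<close> is too small for that.\<close>
  have "\<exists>A \<in> ?RW. \<forall>z. ev D' (Fv z) * z i = A (Fv z)" if i: "i \<in> W" for i
  proof -
    obtain p0 where p0: "p0 \<in> coeffs_in ?R" "P0 i = ev p0" using ev_expand[OF P0[OF i]] by blast
    obtain k' A B where AB: "A \<in> coeffs_in ?R" "B \<in> coeffs_in ?R" "smult (lead_coeff Q0 ^ k') (D' * p0) = Q0 * A + B"
      "\<And>j. j \<ge> degree Q0 \<Longrightarrow> coeff B j = 0"
      using pseudo_division[OF R Q0(1) \<open>Q0 \<noteq> 0\<close> C(4)[OF D'in p0(1)]] by metis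
    have AB': "D' * p0 = Q0 * A + B" using AB(3) Q0(2) by simp
    have evB: "ev B (Fv z) = ev Q0 (Fv z) * (ev D' (Fv z) * z i - ev A (Fv z))" for z
    proof -
      have "ev D' (Fv z) * (ev Q0 (Fv z) * z i) = ev Q0 (Fv z) * ev A (Fv z) + ev B (Fv z)"
        using arg_cong[OF AB', of "\<lambda>p. ev p (Fv z)"] QP0[OF i, of z] p0(2)
        by (simp add: ev_simps) (simp add: ev_def Fv_def)
      then show ?thesis by (simp add: algebra_simps)
    qed
    have eB: "e y * ev B y - ev Q0 y * (P i y - e y * ev A y) = 0" for y
    proof (rule image_dense[of "\<lambda>y. e y * ev B y - ev Q0 y * (P i y - e y * ev A y)"])
      show "(\<lambda>y. e y * ev B y - ev Q0 y * (P i y - e y * ev A y)) \<in> ?RW"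
        using e VW AB Q0 i by (intro poly_funs_diff is_subring_UNIV poly_funs.mult P ev_PF) auto
      fix z
      show "e (Fv z) * ev B (Fv z) - ev Q0 (Fv z) * (P i (Fv z) - e (Fv z) * ev A (Fv z)) = 0"
        unfolding P(2)[OF i, symmetric] evB D_D' ev_simps by (simp add: algebra_simps)
    qed
    obtain Pi where Pi: "Pi \<in> coeffs_in ?R" "P i = ev Pi" using ev_expand[OF P(1)[OF i]] by blast
    have "e w * coeff B j w = 0" for j w
    proof (cases "e w = 0")
      case False
      have "poly (smult (e w) (spec B w)) s = poly (spec Q0 w * (spec Pi w - smult (e w) (spec A w))) s" for s
      proof -
        have "e (w(v := s)) = e w" using V(2) by (intro poly_funs_cong[OF e]) auto
        then show ?thesis
          using eB[of "w(v := s)"] Pi(2) ev_upd[OF AB(1)] ev_upd[OF AB(2)] ev_upd[OF Q0(1)] ev_upd[OF Pi(1)] by simp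
      qed
      then have "smult (e w) (spec B w) = spec Q0 w * (spec Pi w - smult (e w) (spec A w))"
        using poly_eq_poly_eq_iff by blast
      then have "spec Q0 w dvd smult (e w) (spec B w)" by simp
      then have dvd: "spec Q0 w dvd spec B w" using False by (simp add: dvd_smult_iff)
      have "degree (spec Q0 w) = degree Q0"
        using Q0(2) by (intro degree_spec) simp
      then have "spec B w = 0"
        using dvd_imp_degree_le[OF dvd] AB(4)[of "degree (spec B w)"]
        by (metis coeff_spec leading_coeff_0_iff zero_fun_def)
      then show ?thesis by (metis coeff_0 coeff_spec mult_zero_right)
    qed simp
    from poly_funs_cancel[OF coeffs_inD[OF AB(2)] e this ye] have "coeff B j w = 0" for j w .
    then have "B = 0" by (intro poly_eqI) (auto simp: fun_eq_iff)
    have "(\<lambda>z. ev D' (Fv z) * z i - ev A (Fv z)) \<in> ?RW"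
      using i by (intro poly_funs_diff is_subring_UNIV poly_funs.mult comp[OF ev_PF[OF D'in]] comp[OF ev_PF[OF AB(1)]]
          poly_funs.var)
    moreover obtain y0 where "ev Q0 y0 \<noteq> 0" using ev_0[OF Q0(1)] \<open>Q0 \<noteq> 0\<close> by blast
    moreover have "ev Q0 (Fv z) * (ev D' (Fv z) * z i - ev A (Fv z)) = 0" for z
      using evB[of z] \<open>B = 0\<close> by (simp add: ev_def)
    ultimately have "ev D' (Fv z) * z i - ev A (Fv z) = 0" for z
      by (intro cancel[OF ev_PF[OF Q0(1)], of y0 "\<lambda>z. ev D' (Fv z) * z i - ev A (Fv z)"])
    then show ?thesis by (intro bexI[OF _ ev_PF[OF AB(1)]]) auto
  qed
  then have "\<forall>i. \<exists>A. i \<in> W \<longrightarrow> A \<in> ?RW \<and> (\<forall>z. ev D' (Fv z) * z i = A (Fv z))" by blast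
  from choice[OF this] obtain A where A: "\<And>i. i \<in> W \<Longrightarrow> A i \<in> ?RW"
    "\<And>i z. i \<in> W \<Longrightarrow> ev D' (Fv z) * z i = A i (Fv z)" by blast
  have "m = 0"
  proof (rule ccontr)
    assume "m \<noteq> 0"
    have no_zero: "ev D' (Fv z0) \<noteq> 0" for z0
    proof
      assume z0: "ev D' (Fv z0) = 0"
      define y0 where "y0 = Fv z0"
      obtain \<epsilon> where \<epsilon>: "\<epsilon> > 0" "\<forall>y. (\<forall>i\<in>W. cmod (y i - F i z0) < \<epsilon>) \<longrightarrow> (\<exists>x. \<forall>i\<in>W. F i x = y i)"
        using op by blast
      define near where "near y \<longleftrightarrow> (\<forall>i\<in>W. cmod (y i - y0 i) < \<epsilon>)" for y :: "nat \<Rightarrow> complex"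
      \<comment> \<open>The polynomials that vanish on the zeros of \<open>D'\<close> near
        \<open>y0\<close>. \<open>D'\<close> and the numerators belong to \<open>Z\<close>, and a
        nonzero element of least degree divides all of them up to powers of its leading
        coefficient.\<close>
      define Z where "Z = {f \<in> coeffs_in ?R. \<forall>y. near y \<longrightarrow> ev D' y = 0 \<longrightarrow> ev f y = 0}"
      define m' where "m' = (LEAST m. \<exists>d\<in>Z. d \<noteq> 0 \<and> degree d = m)"
      have "D' \<in> Z" using D'in by (simp add: Z_def)
      moreover have "D' \<noteq> 0" using lcD' by auto
      ultimately have "\<exists>m. \<exists>d\<in>Z. d \<noteq> 0 \<and> degree d = m" by blast
      from LeastI_ex[OF this] obtain d where d: "d \<in> Z" "d \<noteq> 0" "degree d = m'"
        unfolding m'_def by blast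
      have m'_le: "m' \<le> degree f" if "f \<in> Z" "f \<noteq> 0" for f
        unfolding m'_def using that by (intro Least_le) blast
      have din: "d \<in> coeffs_in ?R" using d(1) by (simp add: Z_def)
      define l where "l = lead_coeff d"
      have l: "l \<in> ?R" using din by (auto simp: l_def intro: coeffs_inD)
      have "l \<noteq> 0" using d(2) by (simp add: l_def)
      then obtain yl where yl: "l yl \<noteq> 0" by (auto simp: fun_eq_iff)
      \<comment> \<open>If \<open>d\<close> did not involve the coordinate \<open>v\<close>, it
        would vanish on the projection of the nearby zeros of \<open>D'\<close>. That projection
        contains a box: for \<open>w\<close> close to \<open>y0\<close> the monic \<open>D'\<close>
        is small at \<open>y0 v\<close>, hence has a root within \<open>\<epsilon>\<close> of it.
        The threshold \<open>\<epsilon> ^ m\<close> comes from the power in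
        \<open>monic_poly_root_near\<close>.\<close>
      have "m' \<noteq> 0"
      proof
        assume "m' = 0"
        then obtain c where c: "d = [:c:]" using d(3) degree_eq_zeroE by auto
        have cl: "c = l" using c by (simp add: l_def)
        have "\<epsilon> ^ m > 0" using \<epsilon>(1) by simp
        have fin: "finite W" by (rule finW)
        have "(\<lambda>y. poly (spec D' y) (y0 v)) \<in> ?RW"
          by (rule poly_funs_poly_spec[OF is_subring_UNIV coeffs_in_mono[OF VW D'in] poly_funs.const]) simp
        from poly_funs_eventually_near[OF fin this \<open>\<epsilon> ^ m > 0\<close>, of y0]
        obtain \<delta> where \<delta>: "\<delta> > 0"
          "\<And>y. (\<And>i. i \<in> W \<Longrightarrow> cmod (y i - y0 i) < \<delta>) \<Longrightarrow>
            cmod (poly (spec D' y) (y0 v) - poly (spec D' y0) (y0 v)) < \<epsilon> ^ m"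
          by blast
        have "l w = 0" if w: "\<And>i. i \<in> V \<Longrightarrow> cmod (w i - y0 i) < min \<delta> \<epsilon>" for w
        proof -
          define w' where "w' = w(v := y0 v)"
          have "cmod (poly (spec D' w') (y0 v) - poly (spec D' y0) (y0 v)) < \<epsilon> ^ m"
            using w \<delta>(1) by (intro \<delta>(2)) (auto simp: w'_def W)
          moreover have "poly (spec D' y0) (y0 v) = 0" using z0 by (simp add: ev_def y0_def)
          ultimately have small: "cmod (poly (spec D' w) (y0 v)) < \<epsilon> ^ m"
            by (simp add: w'_def upd[OF D'in])
          have deg: "degree (spec D' w) = m"
            by (intro antisym degree_le le_degree) (auto simp: coeff_D')
          then have "lead_coeff (spec D' w) = 1" by (simp add: coeff_D')
          then obtain s where s: "poly (spec D' w) s = 0" "cmod (s - y0 v) ^ m \<le> cmod (poly (spec D' w) (y0 v))"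
            using monic_poly_root_near[of "spec D' w" "y0 v"] deg \<open>m \<noteq> 0\<close> by auto
          then have "cmod (s - y0 v) ^ m < \<epsilon> ^ m" using small by simp
          then have "cmod (s - y0 v) < \<epsilon>"
            using \<epsilon>(1) by (metis less_imp_le power_less_imp_less_base)
          then have "near (w(v := s))" using w by (auto simp: near_def W)
          moreover have "ev D' (w(v := s)) = 0" using s by (simp add: ev_upd[OF D'in])
          ultimately have "ev d (w(v := s)) = 0" using d(1) by (simp add: Z_def)
          then have "poly (spec d w) s = 0" by (simp add: ev_upd[OF din])
          then show "l w = 0" by (simp add: c cl)
        qed
        then have "l yl = 0"
          using \<delta>(1) \<epsilon>(1) by (intro poly_funs_eq_0_on_box[OF V(1) l, of "min \<delta> \<epsilon>" y0 yl]) auto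
        then show False using yl by simp
      qed
      have div: "\<exists>k. \<exists>q\<in>coeffs_in ?R. smult (l ^ k) f = d * q" if f: "f \<in> Z" for f
      proof -
        have fin: "f \<in> coeffs_in ?R" using f by (simp add: Z_def)
        obtain k q r where *: "q \<in> coeffs_in ?R" "r \<in> coeffs_in ?R" "smult (l ^ k) f = d * q + r"
          "\<And>i. i \<ge> degree d \<Longrightarrow> coeff r i = 0"
          unfolding l_def using pseudo_division[OF R din d(2) fin] by metis
        have r: "r = smult (l ^ k) f - d * q" using *(3) by simp
        have "ev r y = (l ^ k) y * ev f y - ev d y * ev q y" for y
          unfolding r by (simp only: ev_simps)
        then have "r \<in> Z" using *(2) f d(1) by (simp add: Z_def)
        then have "r = 0" using m'_le[of r] *(4)[of "degree r"] d(3) by (cases "r = 0") auto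
        then show ?thesis using * by auto
      qed
      have near_image: "\<exists>x. \<forall>i\<in>W. F i x = y i" if "near y" for y
        using that \<epsilon>(2) by (simp add: near_def y0_def Fv_def)
      \<comment> \<open>Near \<open>y0\<close> every point is an image, and there \<open>A i\<close>
        is \<open>D'\<close> times a coordinate of the preimage. So \<open>A i\<close> belongs to
        \<open>Z\<close>.\<close>
      have "\<exists>k. \<exists>q\<in>coeffs_in ?R. \<forall>y. l y ^ k * A i y = ev d y * ev q y" if i: "i \<in> W" for i
      proof -
        obtain ai where ai: "ai \<in> coeffs_in ?R" "A i = ev ai" using ev_expand[OF A(1)[OF i]] by blast
        have "ev ai y = 0" if y: "near y" "ev D' y = 0" for y
        proof -
          obtain x where x: "\<forall>i\<in>W. F i x = y i" using near_image[OF y(1)] by blast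
          have "ev D' (Fv x) = ev D' y" by (rule poly_funs_cong[OF ev_PF[OF D'in]]) (use x in \<open>simp add: Fv_def\<close>)
          moreover have "A i (Fv x) = A i y" by (rule poly_funs_cong[OF A(1)[OF i]]) (use x in \<open>simp add: Fv_def\<close>)
          ultimately show ?thesis using A(2)[OF i, of x] y(2) ai(2) by simp
        qed
        then have "ai \<in> Z" using ai by (simp add: Z_def)
        from div[OF this] obtain k q where kq: "q \<in> coeffs_in ?R" "smult (l ^ k) ai = d * q" by blast
        have "(l ^ k) y = l y ^ k" for y by (induction k) auto
        then have "l y ^ k * A i y = ev d y * ev q y" for y
          using arg_cong[OF kq(2), of "\<lambda>p. ev p y"] ai(2) by (simp add: ev_simps)
        then show ?thesis using kq(1) by blast
      qed
      then have "\<forall>i. \<exists>k q. i \<in> W \<longrightarrow> q \<in> coeffs_in ?R \<and> (\<forall>y. l y ^ k * A i y = ev d y * ev q y)" by blast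
      from choice[OF this] obtain ki where
        "\<forall>i. \<exists>q. i \<in> W \<longrightarrow> q \<in> coeffs_in ?R \<and> (\<forall>y. l y ^ ki i * A i y = ev d y * ev q y)" by blast
      from choice[OF this] obtain qi where qi: "\<And>i. i \<in> W \<Longrightarrow> qi i \<in> coeffs_in ?R"
        "\<And>i y. i \<in> W \<Longrightarrow> l y ^ ki i * A i y = ev d y * ev (qi i) y" by blast
      obtain k0 q0 where q0: "q0 \<in> coeffs_in ?R" "smult (l ^ k0) D' = d * q0"
        using div[OF \<open>D' \<in> Z\<close>] by blast
      have lpow: "(l ^ k) y = l y ^ k" for y k by (induction k) auto
      \<comment> \<open>With one power of \<open>l\<close> for all of them, \<open>d\<close> can be
        cancelled from \<open>D'(F z) * z i = A i (F z)\<close>, which leaves the denominator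
        \<open>G\<close> with numerators \<open>H\<close>.\<close>
      define K where "K = (\<Sum>i\<in>W. ki i)"
      have K: "ki i \<le> K" if "i \<in> W" for i
        unfolding K_def using finW that by (intro member_le_sum) auto
      define G where "G = smult (l ^ K) q0"
      have G: "smult (l ^ (K + k0)) D' = d * G"
        by (simp add: G_def power_add q0(2)[symmetric])
      have Gin: "G \<in> coeffs_in ?R"
        unfolding G_def by (intro coeffs_in_smult R R' l q0)
      define H where "H i y = l y ^ (k0 + (K - ki i)) * ev (qi i) y" for i y
      have H: "H i \<in> ?RW" if "i \<in> W" for i
        unfolding H_def[abs_def] using l VW
        by (intro poly_funs.mult poly_funs_power is_subring_UNIV ev_PF qi that) auto
      have lH: "l y ^ (K + k0) * A i y = ev d y * H i y" if "i \<in> W" for i y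
      proof -
        have "K + k0 = (k0 + (K - ki i)) + ki i" using K[OF that] by simp
        then have "l y ^ (K + k0) * A i y = l y ^ (k0 + (K - ki i)) * (l y ^ ki i * A i y)"
          by (metis mult.assoc power_add)
        then show ?thesis using qi(2)[OF that] by (simp add: H_def)
      qed
      have GH: "ev G (Fv z) * z i - H i (Fv z) = 0" if i: "i \<in> W" for i z
      proof -
        have "ev d (Fv z) * (ev G (Fv z) * z i - H i (Fv z)) = 0" for z
        proof -
          have "ev d (Fv z) * ev G (Fv z) = l (Fv z) ^ (K + k0) * ev D' (Fv z)"
            using arg_cong[OF G, of "\<lambda>p. ev p (Fv z)"] by (simp add: ev_simps lpow)
          then have "ev d (Fv z) * (ev G (Fv z) * z i) = l (Fv z) ^ (K + k0) * (ev D' (Fv z) * z i)"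
            by (metis mult.assoc)
          then show ?thesis using lH[OF i, of "Fv z"] A(2)[OF i, of z] by (simp add: right_diff_distrib)
        qed
        moreover have "(\<lambda>z. ev G (Fv z) * z i - H i (Fv z)) \<in> ?RW"
          using i by (intro poly_funs_diff is_subring_UNIV poly_funs.mult comp[OF ev_PF[OF Gin]] comp[OF H]
              poly_funs.var)
        moreover obtain y1 where "ev d y1 \<noteq> 0" using ev_0[OF din] d(2) by blast
        ultimately show ?thesis
          by (intro cancel[OF ev_PF[OF din], of y1 "\<lambda>z. ev G (Fv z) * z i - H i (Fv z)"])
      qed
      have "G \<noteq> 0"
      proof
        assume "G = 0"
        then have "smult (l ^ (K + k0)) D' = 0" using G by simp
        from arg_cong[OF this, of "\<lambda>p. coeff p m yl"] show False
          using yl by (simp add: coeff_D' lpow)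
      qed
      then have "adm G H" using Gin H GH by (auto simp: adm_def)
      then have "m \<le> degree G" by (rule min)
      have Glc: "lead_coeff G \<in> ?R" using Gin by (rule coeffs_inD)
      obtain yG where yG: "lead_coeff G yG \<noteq> 0" using \<open>G \<noteq> 0\<close> by (metis leading_coeff_0_iff ext zero_fun_def)
      \<comment> \<open>Degrees add over a domain but not over the ring of functions, so they are
        compared at a point where both leading coefficients survive.\<close>
      obtain w where w: "lead_coeff G w \<noteq> 0" "l w \<noteq> 0"
        by (rule poly_funs_mult_nonzero[OF Glc l yG yl]) (rule that)
      have degG: "degree (spec G w) = degree G"
        using w(1) by (rule degree_spec)
      have degd: "degree (spec d w) = m'"
        using w(2) d(3) degree_spec[of d w] by (simp add: l_def)
      have degD': "degree (spec D' w) = m"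
        by (intro antisym degree_le le_degree) (auto simp: coeff_D')
      have "smult (l w ^ (K + k0)) (spec D' w) = spec d w * spec G w"
        using arg_cong[OF G, of "\<lambda>p. spec p w"] by (simp add: lpow)
      from arg_cong[OF this, of degree] have "m = degree (spec d w * spec G w)"
        using w(2) degD' by simp
      also have "\<dots> = m' + degree G"
      proof -
        have "spec d w \<noteq> 0" "spec G w \<noteq> 0"
          using w by (metis coeff_0 coeff_spec l_def, metis coeff_0 coeff_spec)
        then show ?thesis using degG degd by (simp add: degree_mult_eq)
      qed
      finally have "m = m' + degree G" .
      then show False using \<open>m' \<noteq> 0\<close> \<open>m \<le> degree G\<close> by simp
    qed
    \<comment> \<open>By the fundamental theorem of algebra \<open>D'\<close> composed with
      \<open>F\<close> is constant on each line through the origin. Since identities on the image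
      hold everywhere, \<open>D'\<close> itself is then constant, against its positive degree in the
      coordinate \<open>v\<close>.\<close>
    define \<kappa> where "\<kappa> = ev D' (Fv (\<lambda>_. 0))"
    have const: "ev D' (Fv z) = \<kappa>" for z
    proof -
      obtain p where p: "\<And>t. ev D' (Fv (\<lambda>i. 0 + t * z i)) = poly p t"
        by (rule poly_funs_line[OF comp[OF ev_PF[OF D'in]], of "\<lambda>_. 0" z]) (rule that)
      have "constant (poly p)"
        using fundamental_theorem_of_algebra[of p] no_zero p by metis
      then show ?thesis using p[of 0] p[of 1] by (simp add: \<kappa>_def constant_def)
    qed
    have "(\<lambda>y. ev D' y - \<kappa>) \<in> ?RW"
      by (intro poly_funs_diff is_subring_UNIV ev_PF D'in poly_funs.const UNIV_I)
    from image_dense[OF this] have "ev D' y - \<kappa> = 0" for y by (simp add: const)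
    then have "poly (spec D' y) s = poly [:\<kappa>:] s" for y s
      using ev_upd[OF D'in, of y s] by simp
    then have "spec D' (\<lambda>_. 0) = [:\<kappa>:]" using poly_eq_poly_eq_iff by blast
    from arg_cong[OF this, of "\<lambda>p. coeff p m"] show False
      using \<open>m \<noteq> 0\<close> by (simp add: coeff_D' coeff_pCons split: nat.splits)
  qed
  then have "D' = 1" by (intro poly_eqI) (simp add: coeff_D' coeff_1)
  then have "z i = A i (\<lambda>j. F j z)" if "i \<in> W" for z i
    using A(2)[OF that, of z] by (simp add: ev_def Fv_def)
  with A(1) show ?thesis by (rule that)
qed

text \<open>The product of the denominators of all coordinates is a common denominator, and a shear
  \<open>T\<close> of the target makes it monic in the last coordinate. The inverse shear
  \<open>T'\<close> is applied after \<open>F\<close>, and again before the inverse found for the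
  sheared map.\<close>

lemma inj_polynomial_map_left_inverse:
  fixes F :: "nat \<Rightarrow> (nat \<Rightarrow> complex) \<Rightarrow> complex"
  assumes S: "is_subring S" "countable S" and n: "n \<ge> 1"
    and FS: "\<And>i. i < n \<Longrightarrow> F i \<in> poly_funs S {..<n}"
    and inj: "coord_inj n F"
  obtains A where "\<And>i. i < n \<Longrightarrow> A i \<in> poly_funs UNIV {..<n}" "\<And>z i. i < n \<Longrightarrow> z i = A i (\<lambda>j. F j z)"
proof -
  let ?R = "poly_funs UNIV {..<n} :: ((nat \<Rightarrow> complex) \<Rightarrow> complex) set"
  have F: "F i \<in> ?R" if "i < n" for i
    using poly_funs_mono[OF FS[OF that]] by simp
  have "\<forall>i. \<exists>Q P y. i < n \<longrightarrow> Q \<in> ?R \<and> P \<in> ?R \<and> Q y \<noteq> 0 \<and> (\<forall>z. Q (\<lambda>j. F j z) * z i = P (\<lambda>j. F j z))"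
    using inj_polynomial_map_birational[OF S FS inj] by metis
  from choice[OF this] obtain Q where
    "\<forall>i. \<exists>P y. i < n \<longrightarrow> Q i \<in> ?R \<and> P \<in> ?R \<and> Q i y \<noteq> 0 \<and> (\<forall>z. Q i (\<lambda>j. F j z) * z i = P (\<lambda>j. F j z))" by blast
  from choice[OF this] obtain P where
    P: "\<forall>i. \<exists>y. i < n \<longrightarrow> Q i \<in> ?R \<and> P i \<in> ?R \<and> Q i y \<noteq> 0 \<and> (\<forall>z. Q i (\<lambda>j. F j z) * z i = P i (\<lambda>j. F j z))" by blast
  have Q: "Q i \<in> ?R" and Pi: "P i \<in> ?R" and Qnz: "\<exists>y. Q i y \<noteq> 0"
    and QP: "Q i (\<lambda>j. F j z) * z i = P i (\<lambda>j. F j z)" if "i < n" for i z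
    using P that by blast+
  have "\<exists>y. (\<Prod>i<k. Q i y) \<noteq> 0" if "k \<le> n" for k
    using that
  proof (induction k)
    case (Suc k)
    then obtain y where y: "(\<Prod>i<k. Q i y) \<noteq> 0" by auto
    obtain y' where y': "Q k y' \<noteq> 0" using Qnz Suc.prems by (metis Suc_le_eq)
    have k: "(\<lambda>y. \<Prod>i<k. Q i y) \<in> ?R" "Q k \<in> ?R"
      using Suc.prems by (intro poly_funs_prod is_subring_UNIV Q; auto)+
    obtain x where "(\<Prod>i<k. Q i x) \<noteq> 0" "Q k x \<noteq> 0"
      by (rule poly_funs_mult_nonzero[OF k y y']) (rule that)
    then show ?case by (intro exI[of _ x]) simp
  qed simp
  then obtain y0 where y0: "(\<Prod>i<n. Q i y0) \<noteq> 0" by blast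
  define v V where "v = n - 1" and "V = {..<n - 1}"
  have V: "finite V" "v \<notin> V" and W: "{..<n} = insert v V" and vn: "v < n"
    using n by (auto simp: v_def V_def)
  define Qa where "Qa x = (\<Prod>i<n. Q i x)" for x
  define Pa where "Pa i x = (\<Prod>j\<in>{..<n} - {i}. Q j x) * P i x" for i x
  have Qa: "Qa \<in> poly_funs UNIV (insert v V)"
    unfolding Qa_def[abs_def] W[symmetric] by (intro poly_funs_prod is_subring_UNIV Q) auto
  have Pa: "Pa i \<in> ?R" if "i < n" for i
    unfolding Pa_def[abs_def] by (intro poly_funs.mult poly_funs_prod is_subring_UNIV Q Pi that) auto
  have QPa: "Qa (\<lambda>j. F j z) * z i = Pa i (\<lambda>j. F j z)" if "i < n" for i z
  proof -
    have "Qa (\<lambda>j. F j z) = Q i (\<lambda>j. F j z) * (\<Prod>l\<in>{..<n} - {i}. Q l (\<lambda>j. F j z))"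
      unfolding Qa_def using that by (intro prod.remove) auto
    then show ?thesis using QP[OF that, of z] by (simp add: Pa_def mult_ac)
  qed
  obtain b q \<kappa> where q: "q \<in> coeffs_in (poly_funs UNIV V)" "lead_coeff q = 1" "\<kappa> \<noteq> 0"
    "\<And>y. Qa (\<lambda>i. if i = v then y v else y i + y v * b i) = \<kappa> * poly (spec q y) (y v)"
    by (rule exists_monic_coordinates[OF V(2) Qa y0[folded Qa_def]]) (rule that)
  define T where "T y i = (if i = v then y v else y i + y v * b i)" for y :: "nat \<Rightarrow> complex" and i
  define T' where "T' y i = (if i = v then y v else y i - y v * b i)" for y :: "nat \<Rightarrow> complex" and i
  have T: "(\<lambda>y. T y i) \<in> ?R" "(\<lambda>y. T' y i) \<in> ?R" if "i < n" for i
  proof -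
    have "(\<lambda>y. y i + y v * b i) \<in> ?R" "(\<lambda>y. y i - y v * b i) \<in> ?R" "(\<lambda>y. y v) \<in> ?R"
      using that vn by (intro poly_funs_diff is_subring_UNIV poly_funs.intros; simp)+
    then show "(\<lambda>y. T y i) \<in> ?R" "(\<lambda>y. T' y i) \<in> ?R"
      unfolding T_def T'_def by (cases "i = v"; simp)+
  qed
  have TT': "T (T' y) = y" for y by (auto simp: T_def T'_def fun_eq_iff)
  define F' where "F' i z = T' (\<lambda>j. F j z) i" for i z
  have F': "F' i \<in> poly_funs UNIV {..<n}" if "i < n" for i
    unfolding F'_def[abs_def] using poly_funs_subst[OF T(2)[OF that] F] by simp
  have F'v: "T (\<lambda>j. F' j z) = (\<lambda>j. F j z)" for z
    unfolding F'_def by (rule TT')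
  have inj': "coord_inj n F'"
    unfolding coord_inj_def
  proof (intro allI impI)
    fix x y i assume eq: "\<forall>j<n. F' j x = F' j y" and "i < n"
    show "x i = y i"
    proof (rule coord_injD[OF inj _ \<open>i < n\<close>])
      fix j assume j: "j < n"
      have "F v x = F v y" using eq vn by (auto simp: F'_def T'_def)
      then show "F j x = F j y" using eq j by (cases "j = v") (auto simp: F'_def T'_def)
    qed
  qed
  have op: "\<exists>\<epsilon>>0. \<forall>y. (\<forall>i\<in>{..<n}. cmod (y i - F' i z) < \<epsilon>) \<longrightarrow> (\<exists>x. \<forall>i\<in>{..<n}. F' i x = y i)" for z
  proof -
    obtain \<epsilon> where "\<epsilon> > 0" "\<And>y. (\<And>i. i < n \<Longrightarrow> cmod (y i - F' i z) < \<epsilon>) \<Longrightarrow> \<exists>x. \<forall>i<n. F' i x = y i"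
      using inj_polynomial_map_open[OF F' inj'] by metis
    then have "\<exists>x. \<forall>i\<in>{..<n}. F' i x = y i" if "\<forall>i\<in>{..<n}. cmod (y i - F' i z) < \<epsilon>" for y
      using that by (metis lessThan_iff)
    with \<open>\<epsilon> > 0\<close> show ?thesis by blast
  qed
  define P0 where "P0 i y = 1 / \<kappa> * Pa i (T y)" for i y
  have P0: "P0 i \<in> ?R" if "i < n" for i
  proof -
    have "(\<lambda>y. Pa i (\<lambda>j. T y j)) \<in> ?R" by (rule poly_funs_subst[OF Pa[OF that] T(1)]) simp
    then show ?thesis unfolding P0_def[abs_def] by (intro poly_funs.mult poly_funs.const) auto
  qed
  have QP0: "poly (spec q (\<lambda>j. F' j z)) (F' v z) * z i = P0 i (\<lambda>j. F' j z)" if "i < n" for i z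
  proof -
    have "Qa (T (\<lambda>j. F' j z)) = \<kappa> * poly (spec q (\<lambda>j. F' j z)) (F' v z)"
      using q(4)[of "\<lambda>j. F' j z"] by (simp add: T_def[abs_def])
    then have "\<kappa> * (poly (spec q (\<lambda>j. F' j z)) (F' v z) * z i) = Pa i (\<lambda>j. F j z)"
      using QPa[OF that, of z] by (simp add: F'v flip: mult.assoc)
    then show ?thesis using q(3) by (simp add: P0_def F'v field_simps)
  qed
  obtain A' where A': "\<And>i. i \<in> {..<n} \<Longrightarrow> A' i \<in> ?R" "\<And>z i. i \<in> {..<n} \<Longrightarrow> z i = A' i (\<lambda>j. F' j z)"
    by (rule inverse_of_monic_denominator[OF V W, of F' q P0]) (use F' op q(1,2) P0 QP0 in auto)
  define A where "A i y = A' i (T' y)" for i y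
  have "A i \<in> ?R" if "i < n" for i
    unfolding A_def[abs_def] using poly_funs_subst[OF A'(1) T(2), of i] that by simp
  moreover have "z i = A i (\<lambda>j. F j z)" if "i < n" for z i
    using A'(2)[of i z] that unfolding A_def F'_def by simp
  ultimately show ?thesis by (rule that)
qed

text \<open>A left inverse is a right inverse on the image; the image contains a box, and polynomial
  functions that agree on a box are equal.\<close>

theorem inj_polynomial_map_inverse:
  fixes F :: "nat \<Rightarrow> (nat \<Rightarrow> complex) \<Rightarrow> complex"
  assumes S: "is_subring S" "countable S" and n: "n \<ge> 1"
    and FS: "\<And>i. i < n \<Longrightarrow> F i \<in> poly_funs S {..<n}"
    and inj: "coord_inj n F"
  obtains A where "\<And>i. i < n \<Longrightarrow> A i \<in> poly_funs UNIV {..<n}" "\<And>z i. i < n \<Longrightarrow> z i = A i (\<lambda>j. F j z)"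
    "\<And>y i. i < n \<Longrightarrow> F i (\<lambda>j. A j y) = y i"
proof -
  obtain A where A: "\<And>i. i < n \<Longrightarrow> A i \<in> poly_funs UNIV {..<n}" "\<And>z i. i < n \<Longrightarrow> z i = A i (\<lambda>j. F j z)"
    using inj_polynomial_map_left_inverse[OF S n FS inj] by metis
  have F: "F i \<in> poly_funs UNIV {..<n}" if "i < n" for i
    using poly_funs_mono[OF FS[OF that]] by simp
  obtain \<epsilon> where \<epsilon>: "\<epsilon> > 0" "\<And>y. (\<And>i. i < n \<Longrightarrow> cmod (y i - F i (\<lambda>_. 0)) < \<epsilon>) \<Longrightarrow> \<exists>x. \<forall>i<n. F i x = y i"
    using inj_polynomial_map_open[OF F inj] by metis
  have "F i (\<lambda>j. A j y) - y i = 0" if i: "i < n" for i y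
  proof (rule poly_funs_eq_0_on_box[where V = "{..<n}" and f = "\<lambda>y. F i (\<lambda>j. A j y) - y i"
        and y = "\<lambda>i. F i (\<lambda>_. 0)" and \<epsilon> = \<epsilon>])
    show "(\<lambda>y. F i (\<lambda>j. A j y) - y i) \<in> poly_funs UNIV {..<n}"
      using i by (intro poly_funs_diff is_subring_UNIV poly_funs_subst[OF F[OF i]] A poly_funs.var) auto
    fix y assume "\<And>i. i \<in> {..<n} \<Longrightarrow> cmod (y i - F i (\<lambda>_. 0)) < \<epsilon>"
    then obtain x where x: "\<forall>i<n. F i x = y i" using \<epsilon>(2) by blast
    have "A j y = x j" if "j < n" for j
    proof -
      have "A j y = A j (\<lambda>j. F j x)"
        by (rule poly_funs_cong[OF A(1)[OF that]]) (use x in simp)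
      then show ?thesis using A(2)[OF that, of x] by simp
    qed
    then have "F i (\<lambda>j. A j y) = F i x" by (intro poly_funs_cong[OF F[OF i]]) simp
    then show "F i (\<lambda>j. A j y) - y i = 0" using x i by simp
  qed (use \<epsilon>(1) in auto)
  then have "F i (\<lambda>j. A j y) = y i" if "i < n" for y i using that by simp
  with A show ?thesis by (rule that)
qed

section \<open>Polynomials over an arbitrary field of characteristic zero\<close>

definition monom_eval :: "(nat \<Rightarrow>\<^sub>0 nat) \<Rightarrow> (nat \<Rightarrow> 'a::comm_semiring_1) \<Rightarrow> 'a"
  where "monom_eval m z = (\<Prod>i\<in>Poly_Mapping.keys m. z i ^ Poly_Mapping.lookup m i)"

text \<open>\<open>\<sigma>\<close> acts on the coefficients only, so a polynomial over one field is
  evaluated at points of another without forming its image as a formal polynomial.\<close>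

definition mpoly_fun :: "('a::zero \<Rightarrow> 'b::comm_semiring_1) \<Rightarrow> 'a mpoly \<Rightarrow> (nat \<Rightarrow> 'b) \<Rightarrow> 'b"
  where "mpoly_fun \<sigma> p z = (\<Sum>m\<in>Poly_Mapping.keys p. \<sigma> (Poly_Mapping.lookup p m) * monom_eval m z)"

definition mpoly_deriv_fun :: "('a::zero \<Rightarrow> 'b::comm_semiring_1) \<Rightarrow> nat \<Rightarrow> 'a mpoly \<Rightarrow> (nat \<Rightarrow> 'b) \<Rightarrow> 'b"
  where "mpoly_deriv_fun \<sigma> j p z = (\<Sum>m\<in>Poly_Mapping.keys p.
    \<sigma> (Poly_Mapping.lookup p m) * (of_nat (Poly_Mapping.lookup m j) * monom_eval (m - Poly_Mapping.single j 1) z))"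

abbreviation "mpoly_val \<equiv> mpoly_fun (\<lambda>a. a)"

abbreviation "mpoly_deriv_val \<equiv> mpoly_deriv_fun (\<lambda>a. a)"

lemma monom_eval_superset:
  assumes "finite B" "Poly_Mapping.keys m \<subseteq> B"
  shows "monom_eval m z = (\<Prod>i\<in>B. z i ^ Poly_Mapping.lookup m i)"
  unfolding monom_eval_def using assms by (intro prod.mono_neutral_left) (auto simp: in_keys_iff)

lemma monom_eval_add: "monom_eval (m + m') z = monom_eval m z * monom_eval m' z"
proof -
  let ?B = "Poly_Mapping.keys m \<union> Poly_Mapping.keys m'"
  have "finite ?B" by simp
  moreover have "Poly_Mapping.keys (m + m') \<subseteq> ?B" by (rule Poly_Mapping.keys_add)
  ultimately show ?thesis
    by (simp add: monom_eval_superset[of ?B] lookup_add power_add prod.distrib)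
qed

lemma monom_eval_single: "monom_eval (Poly_Mapping.single i 1) z = z i"
  by (simp add: monom_eval_def)

lemma monom_eval_zero: "monom_eval 0 z = 1"
  by (simp add: monom_eval_def)

lemma monom_eval_poly_funs:
  "is_subring S \<Longrightarrow> Poly_Mapping.keys m \<subseteq> V \<Longrightarrow> monom_eval m \<in> poly_funs S V"
  unfolding monom_eval_def[abs_def] by (intro poly_funs_prod poly_funs_power poly_funs.var) auto

lemma keys_minus_subset: "Poly_Mapping.keys (m - m') \<subseteq> Poly_Mapping.keys m" for m m' :: "nat \<Rightarrow>\<^sub>0 nat"
  by (auto simp: in_keys_iff lookup_minus)

lemma monom_eval_deriv:
  fixes z :: "nat \<Rightarrow> 'a::real_normed_field"
  shows "((\<lambda>t. monom_eval m (z(j := t))) has_field_derivative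
    of_nat (Poly_Mapping.lookup m j) * monom_eval (m - Poly_Mapping.single j 1) z) (at (z j))"
proof (cases "j \<in> Poly_Mapping.keys m")
  case False
  then have "monom_eval m (z(j := t)) = monom_eval m z" for t
    unfolding monom_eval_def by (intro prod.cong) auto
  then show ?thesis using False by (simp add: in_keys_iff)
next
  case True
  let ?l = "Poly_Mapping.lookup m"
  define c where "c = (\<Prod>i\<in>Poly_Mapping.keys m - {j}. z i ^ ?l i)"
  have "monom_eval m (z(j := t)) = t ^ ?l j * c" for t
    unfolding monom_eval_def c_def prod.remove[OF finite_keys True] by (auto intro!: prod.cong)
  moreover have "monom_eval (m - Poly_Mapping.single j 1) z = z j ^ (?l j - 1) * c"
    unfolding monom_eval_superset[OF finite_keys keys_minus_subset] c_def prod.remove[OF finite_keys True]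
    by (auto intro!: prod.cong simp: lookup_minus lookup_single)
  ultimately show ?thesis
    by (auto intro!: derivative_eq_intros)
qed

lemma mpoly_fun_deriv:
  fixes \<sigma> :: "'a::zero \<Rightarrow> 'b::real_normed_field"
  shows "((\<lambda>t. mpoly_fun \<sigma> p (z(j := t))) has_field_derivative mpoly_deriv_fun \<sigma> j p z) (at (z j))"
  unfolding mpoly_fun_def mpoly_deriv_fun_def by (intro DERIV_sum DERIV_cmult monom_eval_deriv)

lemma mpoly_fun_poly_funs:
  assumes "is_subring S" "p \<in> mpolys n" "\<And>m. \<sigma> (Poly_Mapping.lookup p m) \<in> S"
  shows "mpoly_fun \<sigma> p \<in> poly_funs S {..<n}" "mpoly_deriv_fun \<sigma> j p \<in> poly_funs S {..<n}"
proof -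
  have keys: "Poly_Mapping.keys m \<subseteq> {..<n}" "Poly_Mapping.keys (m - Poly_Mapping.single j 1) \<subseteq> {..<n}"
    if "m \<in> Poly_Mapping.keys p" for m
    using assms(2) that keys_minus_subset[of m "Poly_Mapping.single j 1"] by (auto simp: mpolys_def)
  show "mpoly_fun \<sigma> p \<in> poly_funs S {..<n}"
    unfolding mpoly_fun_def[abs_def] using assms
    by (intro poly_funs_sum poly_funs.mult poly_funs.const monom_eval_poly_funs keys)
  show "mpoly_deriv_fun \<sigma> j p \<in> poly_funs S {..<n}"
    unfolding mpoly_deriv_fun_def[abs_def] using assms is_subringD(8)[OF assms(1)]
    by (intro poly_funs_sum poly_funs.mult poly_funs.const monom_eval_poly_funs keys)
qed

lemma ring_emb_monom_eval:
  assumes \<sigma>: "ring_emb S \<sigma>" and "\<And>i. i \<in> Poly_Mapping.keys m \<Longrightarrow> z i \<in> S"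
  shows "\<sigma> (monom_eval m z) = monom_eval m (\<lambda>i. \<sigma> (z i))" "monom_eval m z \<in> S"
proof -
  note S = is_subringD[OF ring_embD(1)[OF \<sigma>]]
  show "\<sigma> (monom_eval m z) = monom_eval m (\<lambda>i. \<sigma> (z i))"
    unfolding monom_eval_def using assms
    by (subst ring_emb_prod[OF \<sigma>]) (auto intro!: S prod.cong ring_embD(9)[OF \<sigma>])
  show "monom_eval m z \<in> S"
    unfolding monom_eval_def using assms by (intro is_subring_prod ring_embD(1)[OF \<sigma>] S)
qed

lemma ring_emb_mpoly_fun:
  assumes \<sigma>: "ring_emb S \<sigma>" and p: "p \<in> mpolys n" and c: "\<And>m. Poly_Mapping.lookup p m \<in> S"
    and z: "\<And>i. i < n \<Longrightarrow> z i \<in> S"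
  shows "\<sigma> (mpoly_val p z) = mpoly_fun \<sigma> p (\<lambda>i. \<sigma> (z i))" "mpoly_val p z \<in> S"
    "\<sigma> (mpoly_deriv_val j p z) = mpoly_deriv_fun \<sigma> j p (\<lambda>i. \<sigma> (z i))"
    "mpoly_deriv_val j p z \<in> S"
proof -
  note S = is_subringD[OF ring_embD(1)[OF \<sigma>]]
  have keys: "i \<in> Poly_Mapping.keys m \<Longrightarrow> z i \<in> S" "i \<in> Poly_Mapping.keys (m - Poly_Mapping.single j 1) \<Longrightarrow> z i \<in> S"
    if "m \<in> Poly_Mapping.keys p" for m i
    using p that z keys_minus_subset[of m "Poly_Mapping.single j 1"] by (auto simp: mpolys_def)
  note M = ring_emb_monom_eval[OF \<sigma>]
  show "mpoly_val p z \<in> S" "mpoly_deriv_val j p z \<in> S"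
    unfolding mpoly_fun_def mpoly_deriv_fun_def
    by (intro is_subring_sum ring_embD(1)[OF \<sigma>] S c M(2) keys; assumption)+
  note D = ring_embD[OF \<sigma>]
  let ?t = "\<lambda>m. Poly_Mapping.lookup p m * monom_eval m z"
  let ?d = "\<lambda>m. Poly_Mapping.lookup p m *
    (of_nat (Poly_Mapping.lookup m j) * monom_eval (m - Poly_Mapping.single j 1) z)"
  have t: "\<sigma> (?t m) = \<sigma> (Poly_Mapping.lookup p m) * monom_eval m (\<lambda>i. \<sigma> (z i))" "?t m \<in> S"
    and d: "\<sigma> (?d m) = \<sigma> (Poly_Mapping.lookup p m) *
      (of_nat (Poly_Mapping.lookup m j) * monom_eval (m - Poly_Mapping.single j 1) (\<lambda>i. \<sigma> (z i)))" "?d m \<in> S"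
    if m: "m \<in> Poly_Mapping.keys p" for m
  proof -
    note M1 = M[OF keys(1)[OF m], simplified] and M2 = M[OF keys(2)[OF m], simplified]
    show "\<sigma> (?t m) = \<sigma> (Poly_Mapping.lookup p m) * monom_eval m (\<lambda>i. \<sigma> (z i))"
      using D(6)[OF c M1(2)] M1(1) by simp
    show "\<sigma> (?d m) = \<sigma> (Poly_Mapping.lookup p m) *
        (of_nat (Poly_Mapping.lookup m j) * monom_eval (m - Poly_Mapping.single j 1) (\<lambda>i. \<sigma> (z i)))"
      using D(6)[OF c S(4)[OF S(8) M2(2)]] D(6)[OF S(8) M2(2)] M2(1) D(11) by simp
    show "?t m \<in> S" "?d m \<in> S" using M1(2) M2(2) by (auto intro!: S(4,8) c)
  qed
  show "\<sigma> (mpoly_val p z) = mpoly_fun \<sigma> p (\<lambda>i. \<sigma> (z i))"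
    unfolding mpoly_fun_def by (rule trans[OF ring_emb_sum[OF \<sigma> t(2)] sum.cong[OF refl t(1)]])
  show "\<sigma> (mpoly_deriv_val j p z) = mpoly_deriv_fun \<sigma> j p (\<lambda>i. \<sigma> (z i))"
    unfolding mpoly_deriv_fun_def by (rule trans[OF ring_emb_sum[OF \<sigma> d(2)] sum.cong[OF refl d(1)]])
qed

lemma mpoly_eval_eq: "mpoly_eval p x = mpoly_val p (Matrix.vec_index x)"
  by (simp add: mpoly_eval_def mpoly_fun_def monom_eval_def)

lemma mpoly_fun_superset:
  assumes "finite A" "Poly_Mapping.keys p \<subseteq> A"
  shows "mpoly_val p z = (\<Sum>m\<in>A. Poly_Mapping.lookup p m * monom_eval m z)"
  unfolding mpoly_fun_def using assms by (intro sum.mono_neutral_left) (auto simp: in_keys_iff)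

lemma mpoly_fun_add: "mpoly_val (p + q) z = mpoly_val p z + mpoly_val q z"
proof -
  let ?B = "Poly_Mapping.keys p \<union> Poly_Mapping.keys q"
  have "finite ?B" by simp
  moreover have "Poly_Mapping.keys (p + q) \<subseteq> ?B" by (rule Poly_Mapping.keys_add)
  ultimately show ?thesis
    by (simp add: mpoly_fun_superset[of ?B] lookup_add distrib_right sum.distrib)
qed

lemma mpoly_fun_single: "mpoly_val (Poly_Mapping.single m c) z = c * monom_eval m z"
  by (subst mpoly_fun_superset[of "{m}"]) auto

lemma mpoly_fun_sum: "mpoly_val (\<Sum>i\<in>A. p i) z = (\<Sum>i\<in>A. mpoly_val (p i) z)"
  by (induction A rule: infinite_finite_induct) (simp_all add: mpoly_fun_add, simp_all add: mpoly_fun_def)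

lemma mpoly_fun_pderiv: "mpoly_val (mpoly_pderiv j p) z = mpoly_deriv_val j p z"
  by (simp add: mpoly_pderiv_def mpoly_deriv_fun_def mpoly_fun_sum mpoly_fun_single mult_ac)

text \<open>The descent keeps the monomials and turns the coefficients \<open>c\<close> into
  unknowns of a linear system. Monomials may be repeated.\<close>

lemma poly_funs_monomials:
  assumes "f \<in> poly_funs UNIV V"
  obtains T c m where "\<And>t. t < T \<Longrightarrow> Poly_Mapping.keys (m t) \<subseteq> V" "\<And>z. f z = (\<Sum>t<(T::nat). c t * monom_eval (m t) z)"
proof -
  have "\<exists>L. (\<forall>a\<in>set L. Poly_Mapping.keys (snd a) \<subseteq> V) \<and> (\<forall>z. f z = (\<Sum>a\<leftarrow>L. fst a * monom_eval (snd a) z))"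
    using assms
  proof (induction rule: poly_funs.induct)
    case (const c)
    show ?case by (intro exI[of _ "[(c, 0)]"]) (simp add: monom_eval_zero)
  next
    case (var i)
    then show ?case by (intro exI[of _ "[(1, Poly_Mapping.single i 1)]"]) (simp add: monom_eval_single del: One_nat_def)
  next
    case (add f g)
    then obtain L L' where
      "\<forall>a\<in>set L. Poly_Mapping.keys (snd a) \<subseteq> V" "\<forall>z. f z = (\<Sum>a\<leftarrow>L. fst a * monom_eval (snd a) z)"
      "\<forall>a\<in>set L'. Poly_Mapping.keys (snd a) \<subseteq> V" "\<forall>z. g z = (\<Sum>a\<leftarrow>L'. fst a * monom_eval (snd a) z)"
      by blast
    then show ?case by (intro exI[of _ "L @ L'"]) auto
  next
    case (mult f g)
    then obtain L L' where L:
      "\<forall>a\<in>set L. Poly_Mapping.keys (snd a) \<subseteq> V" "\<forall>z. f z = (\<Sum>a\<leftarrow>L. fst a * monom_eval (snd a) z)"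
      "\<forall>a\<in>set L'. Poly_Mapping.keys (snd a) \<subseteq> V" "\<forall>z. g z = (\<Sum>a\<leftarrow>L'. fst a * monom_eval (snd a) z)"
      by blast
    define LL where "LL = concat (map (\<lambda>a. map (\<lambda>b. (fst a * fst b, snd a + snd b)) L') L)"
    have inner: "(\<Sum>b\<leftarrow>L'. fst a * fst b * monom_eval (snd a + snd b) z) =
        fst a * monom_eval (snd a) z * (\<Sum>b\<leftarrow>L'. fst b * monom_eval (snd b) z)" for a z
      by (induction L') (simp_all add: monom_eval_add algebra_simps)
    have "(\<Sum>a\<leftarrow>concat (map (\<lambda>a. map (\<lambda>b. (fst a * fst b, snd a + snd b)) L') L). fst a * monom_eval (snd a) z) =
        (\<Sum>a\<leftarrow>L. fst a * monom_eval (snd a) z) * (\<Sum>a\<leftarrow>L'. fst a * monom_eval (snd a) z)" for L z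
      by (induction L) (simp_all add: o_def inner distrib_right)
    moreover have "\<forall>a\<in>set LL. Poly_Mapping.keys (snd a) \<subseteq> V"
      using L(1,3) Poly_Mapping.keys_add by (fastforce simp: LL_def)
    ultimately show ?case using L(2,4) by (intro exI[of _ LL]) (auto simp: LL_def)
  qed
  then obtain L where L: "\<forall>a\<in>set L. Poly_Mapping.keys (snd a) \<subseteq> V"
    "\<forall>z. f z = (\<Sum>a\<leftarrow>L. fst a * monom_eval (snd a) z)" by blast
  show ?thesis
  proof
    show "Poly_Mapping.keys (snd (L ! t)) \<subseteq> V" if "t < length L" for t using L that by auto
    show "f z = (\<Sum>t<length L. fst (L ! t) * monom_eval (snd (L ! t)) z)" for z
      using L(2) by (simp add: sum_list_sum_nth atLeast0LessThan)
  qed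
qed

section \<open>Descent from the complex numbers\<close>

text \<open>Gaussian elimination: the pivots lie in \<open>S\<close>, so the embedding keeps them nonzero.\<close>

lemma linear_system_descent:
  fixes \<sigma> :: "'a::field \<Rightarrow> 'b::field"
  assumes \<sigma>: "ring_emb S \<sigma>"
    and "\<And>z t. z \<in> Z \<Longrightarrow> M z t \<in> S" "\<And>z. z \<in> Z \<Longrightarrow> e z \<in> S"
    and "\<And>z. z \<in> Z \<Longrightarrow> (\<Sum>t<T. g t * \<sigma> (M z t)) = \<sigma> (e z)"
  obtains g' where "\<And>z. z \<in> Z \<Longrightarrow> (\<Sum>t<(T::nat). g' t * M z t) = e z"
proof -
  note D = ring_embD[OF \<sigma>] and S = is_subringD[OF ring_embD(1)[OF \<sigma>]]
  \<comment> \<open>The induction is on the number of unknowns, since the set \<open>Z\<close> of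
    equations may be infinite.\<close>
  have "\<exists>g'. \<forall>z\<in>Z. (\<Sum>t<T. g' t * M z t) = e z"
    using assms(2-4)
  proof (induction T arbitrary: M e)
    case 0
    then show ?case by (simp add: D(10))
  next
    case (Suc T)
    show ?case
    proof (cases "\<forall>z\<in>Z. M z T = 0")
      case True
      have "\<exists>g'. \<forall>z\<in>Z. (\<Sum>t<T. g' t * M z t) = e z"
        using Suc.prems True D(4) by (intro Suc.IH) auto
      then show ?thesis using True by auto
    next
      case False
      then obtain z0 where z0: "z0 \<in> Z" "M z0 T \<noteq> 0" by blast
      \<comment> \<open>Row \<open>z0\<close> eliminates the last unknown by cross-multiplication,
        so the new system still has its entries in \<open>S\<close>.\<close>
      define M' where "M' z t = M z0 T * M z t - M z T * M z0 t" for z t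
      define e' where "e' z = M z0 T * e z - M z T * e z0" for z
      have "\<exists>g'. \<forall>z\<in>Z. (\<Sum>t<T. g' t * M' z t) = e' z"
      proof (rule Suc.IH)
        fix z assume z: "z \<in> Z"
        show "M' z t \<in> S" for t unfolding M'_def by (intro S Suc.prems z z0)
        show "e' z \<in> S" unfolding e'_def by (intro S Suc.prems z z0)
        have row: "(\<Sum>t<T. g t * \<sigma> (M z t)) = \<sigma> (e z) - g T * \<sigma> (M z T)" if "z \<in> Z" for z
          using Suc.prems(3)[OF that] by (simp add: eq_diff_eq)
        have "(\<Sum>t<T. g t * \<sigma> (M' z t)) =
            \<sigma> (M z0 T) * (\<Sum>t<T. g t * \<sigma> (M z t)) - \<sigma> (M z T) * (\<Sum>t<T. g t * \<sigma> (M z0 t))"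
          unfolding sum_distrib_left sum_subtractf[symmetric] M'_def
          by (intro sum.cong refl) (simp add: D S Suc.prems z z0 algebra_simps)
        also have "\<dots> = \<sigma> (e' z)"
          unfolding row[OF z] row[OF z0(1)] e'_def by (simp add: D S Suc.prems z z0 algebra_simps)
        finally show "(\<Sum>t<T. g t * \<sigma> (M' z t)) = \<sigma> (e' z)" .
      qed
      then obtain g' where g': "\<And>z. z \<in> Z \<Longrightarrow> (\<Sum>t<T. g' t * M' z t) = e' z" by blast
      define h where "h = (e z0 - (\<Sum>t<T. g' t * M z0 t)) / M z0 T"
      have h: "M z0 T * h = e z0 - (\<Sum>t<T. g' t * M z0 t)" using z0 by (simp add: h_def)
      have "(\<Sum>t<T. g' t * M z t) + h * M z T = e z" if z: "z \<in> Z" for z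
      proof -
        have "e' z = M z0 T * (\<Sum>t<T. g' t * M z t) - M z T * (\<Sum>t<T. g' t * M z0 t)"
          unfolding g'[OF z, symmetric] sum_distrib_left sum_subtractf[symmetric] M'_def
          by (intro sum.cong refl) (simp add: algebra_simps)
        also have "(\<Sum>t<T. g' t * M z0 t) = e z0 - M z0 T * h" using h by simp
        finally have "M z0 T * ((\<Sum>t<T. g' t * M z t) + h * M z T) = M z0 T * e z"
          by (simp add: e'_def algebra_simps)
        then show ?thesis using z0 by simp
      qed
      moreover have "(\<Sum>t<T. (g'(T := h)) t * M z t) = (\<Sum>t<T. g' t * M z t)" for z
        by (intro sum.cong) auto
      ultimately show ?thesis by (intro exI[of _ "g'(T := h)"]) simp
    qed
  qed
  then show ?thesis using that by blast
qed

text \<open>The Leibniz sum exhibits the determinant as a polynomial in the entries, the form that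
  embeddings and \<open>poly_funs\<close> respect.\<close>

lemma det_mat_eq:
  "Determinant.det (Matrix.mat n n (\<lambda>(i, j). d i j)) =
    (\<Sum>p\<in>{p. p permutes {0..<n}}. of_int (sign p) * (\<Prod>i = 0..<n. d i (p i)))"
proof -
  have "(\<Prod>i = 0..<n. Matrix.mat n n (\<lambda>(i, j). d i j) $$ (i, p i)) = (\<Prod>i = 0..<n. d i (p i))"
    if "p permutes {0..<n}" for p
    using permutes_in_image[OF that] by (intro prod.cong) auto
  then show ?thesis by (subst det_def'[of _ n]) auto
qed

lemma is_subring_Nats: "is_subring S \<Longrightarrow> a \<in> \<nat> \<Longrightarrow> a \<in> S"
  by (auto simp: Nats_def is_subringD)

lemma is_subring_of_int: "is_subring S \<Longrightarrow> of_int k \<in> S"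
  by (cases k) (simp_all add: is_subringD del: of_nat_Suc)

lemma ring_emb_of_int: "ring_emb S \<sigma> \<Longrightarrow> \<sigma> (of_int k) = of_int k"
  by (cases k) (simp_all add: ring_embD is_subringD[OF ring_embD(1)] del: of_nat_Suc)

lemma ring_emb_det:
  assumes \<sigma>: "ring_emb S \<sigma>" and d: "\<And>i j. i < n \<Longrightarrow> j < n \<Longrightarrow> d i j \<in> S"
  shows "\<sigma> (Determinant.det (Matrix.mat n n (\<lambda>(i, j). d i j))) =
      Determinant.det (Matrix.mat n n (\<lambda>(i, j). \<sigma> (d i j)))"
    "Determinant.det (Matrix.mat n n (\<lambda>(i, j). d i j)) \<in> S"
proof -
  note D = ring_embD[OF \<sigma>] and S = is_subringD[OF ring_embD(1)[OF \<sigma>]]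
  have dp: "d i (p i) \<in> S" if "p \<in> {p. p permutes {0..<n}}" "i \<in> {0..<n}" for p i
    using that permutes_in_image[of p "{0..<n}" i] by (intro d) auto
  have prod: "of_int (sign p) * (\<Prod>i = 0..<n. d i (p i)) \<in> S" if "p \<in> {p. p permutes {0..<n}}" for p
    using dp[OF that] by (intro S(4) is_subring_of_int is_subring_prod D(1))
  show "Determinant.det (Matrix.mat n n (\<lambda>(i, j). d i j)) \<in> S"
    unfolding det_mat_eq using prod by (rule is_subring_sum[OF D(1)])
  have summand: "\<sigma> (of_int (sign p) * (\<Prod>i = 0..<n. d i (p i))) = of_int (sign p) * (\<Prod>i = 0..<n. \<sigma> (d i (p i)))"
    if "p \<in> {p. p permutes {0..<n}}" for p
  proof -
    have 1: "(\<Prod>i = 0..<n. d i (p i)) \<in> S" by (rule is_subring_prod[OF D(1) dp[OF that]])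
    have 2: "\<sigma> (\<Prod>i = 0..<n. d i (p i)) = (\<Prod>i = 0..<n. \<sigma> (d i (p i)))" by (rule ring_emb_prod[OF \<sigma> dp[OF that]])
    show ?thesis by (simp add: D(6)[OF is_subring_of_int[OF D(1)] 1] 2 ring_emb_of_int[OF \<sigma>])
  qed
  show "\<sigma> (Determinant.det (Matrix.mat n n (\<lambda>(i, j). d i j))) =
      Determinant.det (Matrix.mat n n (\<lambda>(i, j). \<sigma> (d i j)))"
    unfolding det_mat_eq by (rule trans[OF ring_emb_sum[OF \<sigma> prod] sum.cong[OF refl summand]])
qed

lemma is_subring_image:
  assumes \<sigma>: "ring_emb S \<sigma>"
  shows "is_subring (\<sigma> ` S)" "countable (\<sigma> ` S)"
proof -
  note D = ring_embD[OF \<sigma>] and S = is_subringD[OF ring_embD(1)[OF \<sigma>]]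
  show "countable (\<sigma> ` S)" using D(2) by simp
  show "is_subring (\<sigma> ` S)"
    unfolding is_subring_def
  proof (intro conjI ballI)
    show "1 \<in> \<sigma> ` S" using D(3) S(1) by (metis imageI)
    fix a b assume "a \<in> \<sigma> ` S" "b \<in> \<sigma> ` S"
    then obtain a' b' where ab: "a' \<in> S" "b' \<in> S" "a = \<sigma> a'" "b = \<sigma> b'" by blast
    then have "a - b = \<sigma> (a' - b')" "a * b = \<sigma> (a' * b')" by (simp_all add: D)
    then show "a - b \<in> \<sigma> ` S" "a * b \<in> \<sigma> ` S"
      using S(3,4)[OF ab(1,2)] by blast+
  qed
qed

lemma ring_emb_Nats_point:
  assumes \<sigma>: "ring_emb S \<sigma>" and w: "\<And>i. w i \<in> \<nat>"
  obtains z where "\<And>i. z i \<in> \<nat>" "\<And>i. z i \<in> S" "w = (\<lambda>i. \<sigma> (z i))"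
proof -
  have "\<forall>i. \<exists>a. w i = of_nat a" using w by (auto elim: Nats_cases)
  from choice[OF this] obtain a where a: "\<And>i. w i = of_nat (a i)" by blast
  show ?thesis
    by (rule that[of "\<lambda>i. of_nat (a i)"])
      (auto simp: a ring_embD[OF \<sigma>] is_subringD[OF ring_embD(1)[OF \<sigma>]])
qed

text \<open>The determinant is known only at points over the original field. At natural points the
  embedding carries it to \<open>\<sigma> C\<close>, and a polynomial function constant there is
  constant on \<complex>; so \<open>keller_map_inj\<close> applies to the complex map.\<close>

lemma keller_map_complex_inverse:
  fixes \<sigma> :: "'k::field_char_0 \<Rightarrow> complex"
  assumes A: spectral_injectivity and n: "n \<ge> 1" and \<sigma>: "ring_emb S \<sigma>"
    and P: "\<And>i. i < n \<Longrightarrow> P i \<in> mpolys n" "\<And>i m. i < n \<Longrightarrow> Poly_Mapping.lookup (P i) m \<in> S"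
    and det: "\<And>z. Determinant.det (Matrix.mat n n (\<lambda>(i, j). mpoly_deriv_val j (P i) z)) = C" "C \<noteq> 0"
  obtains G where "\<And>i. i < n \<Longrightarrow> G i \<in> poly_funs UNIV {..<n}"
    "\<And>z i. i < n \<Longrightarrow> z i = G i (\<lambda>j. mpoly_fun \<sigma> (P j) z)"
    "\<And>y i. i < n \<Longrightarrow> mpoly_fun \<sigma> (P i) (\<lambda>j. G j y) = y i"
proof -
  define F where "F i = mpoly_fun \<sigma> (P i)" for i
  define dF where "dF i j = mpoly_deriv_fun \<sigma> j (P i)" for i j
  have F: "F i \<in> poly_funs (\<sigma> ` S) {..<n}" if "i < n" for i
    unfolding F_def using that P by (intro mpoly_fun_poly_funs is_subring_image[OF \<sigma>]) auto
  have dF: "dF i j \<in> poly_funs UNIV {..<n}" if "i < n" for i j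
    unfolding dF_def using that P by (intro mpoly_fun_poly_funs) auto
  define \<delta> where "\<delta> w = Determinant.det (Matrix.mat n n (\<lambda>(i, j). dF i j w))" for w
  have \<sigma>_det: "\<delta> (\<lambda>i. \<sigma> (z i)) = \<sigma> C \<and> C \<in> S" if z: "\<And>i. z i \<in> S" for z
  proof -
    have "mpoly_deriv_val j (P i) z \<in> S" "\<sigma> (mpoly_deriv_val j (P i) z) = dF i j (\<lambda>i. \<sigma> (z i))"
      if "i < n" for i j
      using ring_emb_mpoly_fun(3,4)[OF \<sigma> P(1)[OF that] P(2)[OF that] z] by (auto simp: dF_def)
    note J = this
    have "Matrix.mat n n (\<lambda>(i, j). \<sigma> (mpoly_deriv_val j (P i) z)) =
        Matrix.mat n n (\<lambda>(i, j). dF i j (\<lambda>i. \<sigma> (z i)))"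
      by (intro eq_matI) (auto simp: J(2))
    then show ?thesis
      using ring_emb_det[OF \<sigma>, of n "\<lambda>i j. mpoly_deriv_val j (P i) z"] J(1) det(1)[of z]
      by (simp add: \<delta>_def)
  qed
  have "\<delta> w - \<sigma> C = 0" for w
  proof (rule poly_funs_eq_0_on_Nats[of "{..<n}" "\<lambda>w. \<delta> w - \<sigma> C"])
    have "\<delta> \<in> poly_funs UNIV {..<n}"
      unfolding \<delta>_def[abs_def] det_mat_eq
      by (intro poly_funs_sum poly_funs_prod poly_funs.mult poly_funs.const is_subring_UNIV dF) auto
    then show "(\<lambda>w. \<delta> w - \<sigma> C) \<in> poly_funs UNIV {..<n}"
      by (intro poly_funs_diff poly_funs.const) auto
    fix w :: "nat \<Rightarrow> complex" assume "\<And>i. w i \<in> \<nat>"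
    then obtain z where "\<And>i. z i \<in> S" "w = (\<lambda>i. \<sigma> (z i))" using ring_emb_Nats_point[OF \<sigma>] by metis
    then show "\<delta> w - \<sigma> C = 0" using \<sigma>_det by simp
  qed simp
  \<comment> \<open>As the value of the determinant at a point of \<open>S\<close>, the constant
    \<open>C\<close> lies in \<open>S\<close>, where the embedding has trivial kernel.\<close>
  moreover have "\<sigma> C \<noteq> 0"
    using \<sigma>_det[of "\<lambda>_. 0"] det(2) ring_embD(10)[OF \<sigma>] is_subringD(2)[OF ring_embD(1)[OF \<sigma>]] by blast
  ultimately have nz: "\<delta> w \<noteq> 0" for w by (metis eq_iff_diff_eq_0)
  have "coord_inj n F"
    unfolding coord_inj_def
  proof (intro allI impI)
    fix x y i assume eq: "\<forall>j<n. F j x = F j y" and i: "i < n"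
    show "x i = y i"
    proof (rule keller_map_inj[OF A n _ _ _ _ i])
      show "F i \<in> poly_funs UNIV {..<n}" if "i < n" for i
        using poly_funs_mono[OF F[OF that]] by simp
      show "((\<lambda>t. F i (x(j := t))) has_field_derivative dF i j x) (at (x j))" for i j x
        unfolding F_def dF_def by (rule mpoly_fun_deriv)
      show "Determinant.det (Matrix.mat n n (\<lambda>(i, j). dF i j x)) \<noteq> 0" for x
        using nz by (simp add: \<delta>_def)
    qed (use eq in auto)
  qed
  from inj_polynomial_map_inverse[OF is_subring_image[OF \<sigma>] n F this] show ?thesis
    using that unfolding F_def by metis
qed

text \<open>The complex inverse tells which monomials to use. Its coefficients solve, over
  \<complex>, linear equations with data in \<open>S\<close>, one for each natural point, so a
  solution exists over the original field. For the other composition the coefficients of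
  \<open>P\<close> and \<open>Q\<close> are embedded together: over \<complex> the image of
  \<open>Q\<close> is a left inverse of an invertible map, hence its inverse, and the embedding
  reflects equality.\<close>

theorem keller_map_inverse:
  fixes P :: "nat \<Rightarrow> 'k::field_char_0 mpoly"
  assumes A: spectral_injectivity and n: "n \<ge> 1"
    and P: "\<And>i. i < n \<Longrightarrow> P i \<in> mpolys n"
    and det: "\<And>z. Determinant.det (Matrix.mat n n (\<lambda>(i, j). mpoly_deriv_val j (P i) z)) = C" "C \<noteq> 0"
  obtains Q where "\<And>i. i < n \<Longrightarrow> Q i \<in> mpolys n"
    "\<And>i z. i < n \<Longrightarrow> mpoly_val (Q i) (\<lambda>j. mpoly_val (P j) z) = z i"
    "\<And>i z. i < n \<Longrightarrow> mpoly_val (P i) (\<lambda>j. mpoly_val (Q j) z) = z i"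
proof -
  define coef where "coef P = (\<Union>i<n. Poly_Mapping.lookup (P i) ` Poly_Mapping.keys (P i))" for P :: "nat \<Rightarrow> 'k mpoly"
  have fin_coef: "finite (coef P)" for P by (simp add: coef_def)
  have coef: "Poly_Mapping.lookup (P i) m \<in> S" if "is_subring S" "coef P \<subseteq> S" "i < n" for P i m S
  proof (cases "m \<in> Poly_Mapping.keys (P i)")
    case True
    then have "Poly_Mapping.lookup (P i) m \<in> coef P" unfolding coef_def using that(3) by blast
    then show ?thesis using that(2) by blast
  qed (use is_subringD(2)[OF that(1)] in \<open>simp add: in_keys_iff\<close>)
  let ?F = "\<lambda>z j. mpoly_val (P j) z"
  have F: "mpoly_val (P i) \<in> poly_funs UNIV {..<n}" if "i < n" for i
    using P[OF that] by (intro mpoly_fun_poly_funs) auto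
  obtain S and \<sigma> :: "'k \<Rightarrow> complex" where \<sigma>: "ring_emb S \<sigma>" "coef P \<subseteq> S"
    using exists_ring_emb[OF fin_coef] by metis
  note S = ring_embD(1)[OF \<sigma>(1)]
  have PS: "Poly_Mapping.lookup (P i) m \<in> S" if "i < n" for i m
    by (rule coef[OF S \<sigma>(2) that])
  obtain G where G: "\<And>i. i < n \<Longrightarrow> G i \<in> poly_funs UNIV {..<n}"
    "\<And>z i. i < n \<Longrightarrow> z i = G i (\<lambda>j. mpoly_fun \<sigma> (P j) z)"
    using keller_map_complex_inverse[OF A n \<sigma>(1) P PS det] by metis
  have "\<exists>q\<in>mpolys n. \<forall>z. mpoly_val q (?F z) = z i" if i: "i < n" for i
  proof -
    obtain T c m where m: "\<And>t. t < T \<Longrightarrow> Poly_Mapping.keys (m t) \<subseteq> {..<n}"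
      "\<And>z. G i z = (\<Sum>t<(T::nat). c t * monom_eval (m t) z)"
      using poly_funs_monomials[OF G(1)[OF i]] by metis
    let ?Z = "{z :: nat \<Rightarrow> 'k. \<forall>i. z i \<in> \<nat>}"
    have ZS: "z j \<in> S" if "z \<in> ?Z" for z j
      using that is_subring_Nats[OF S] by blast
    have FS: "?F z j \<in> S" if "z \<in> ?Z" "j < n" for z j
      by (rule ring_emb_mpoly_fun(2)[OF \<sigma>(1) P[OF that(2)] PS[OF that(2)] ZS[OF that(1)]])
    have mS: "\<sigma> (monom_eval (m t) (?F z)) = monom_eval (m t) (\<lambda>j. \<sigma> (?F z j))" "monom_eval (m t) (?F z) \<in> S"
      if "z \<in> ?Z" "t < T" for z t
      using ring_emb_monom_eval[OF \<sigma>(1), of "m t" "?F z"] m(1)[OF that(2)] FS[OF that(1)] by auto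
    \<comment> \<open>The value \<open>0\<close> from \<open>T\<close> on keeps all entries in
      \<open>S\<close>; nothing is known about \<open>m t\<close> there.\<close>
    define M where "M z t = (if t < T then monom_eval (m t) (?F z) else 0)" for z t
    have sys: "(\<Sum>t<T. c t * \<sigma> (M z t)) = \<sigma> (z i)" if z: "z \<in> ?Z" for z
    proof -
      have "(\<Sum>t<T. c t * \<sigma> (M z t)) = (\<Sum>t<T. c t * monom_eval (m t) (\<lambda>j. \<sigma> (?F z j)))"
        using mS(1)[OF z] by (intro sum.cong) (auto simp: M_def)
      also have "\<dots> = G i (\<lambda>j. \<sigma> (?F z j))" by (simp add: m(2))
      also have "\<dots> = G i (\<lambda>j. mpoly_fun \<sigma> (P j) (\<lambda>i. \<sigma> (z i)))"
        using ring_emb_mpoly_fun(1)[OF \<sigma>(1) P PS ZS[OF z]]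
        by (intro poly_funs_cong[OF G(1)[OF i]]) auto
      finally show ?thesis using G(2)[OF i, of "\<lambda>i. \<sigma> (z i)"] by simp
    qed
    have "\<exists>g. \<forall>z\<in>?Z. (\<Sum>t<T. g t * M z t) = z i"
    proof (rule linear_system_descent[OF \<sigma>(1), where Z = ?Z and M = M and e = "\<lambda>z. z i" and T = T and g = c])
      show "M z t \<in> S" if "z \<in> ?Z" for z t
        using mS(2)[OF that] is_subringD(2)[OF S] by (simp add: M_def)
      show "z i \<in> S" if "z \<in> ?Z" for z by (rule ZS[OF that])
      show "\<exists>g. \<forall>z\<in>?Z. (\<Sum>t<T. g t * M z t) = z i"
        if "\<And>z. z \<in> ?Z \<Longrightarrow> (\<Sum>t<T. g t * M z t) = z i" for g
        using that by blast
    qed (rule sys)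
    then obtain g where g: "\<And>z. z \<in> ?Z \<Longrightarrow> (\<Sum>t<T. g t * M z t) = z i" by blast
    define q where "q = (\<Sum>t<T. Poly_Mapping.single (m t) (g t))"
    have q_fun: "mpoly_val q y = (\<Sum>t<T. g t * monom_eval (m t) y)" for y
      by (simp add: q_def mpoly_fun_sum mpoly_fun_single)
    have q: "q \<in> mpolys n"
    proof -
      have "Poly_Mapping.keys q \<subseteq> m ` {..<T}"
        unfolding q_def by (rule order_trans[OF keys_sum]) (auto split: if_splits)
      then show ?thesis using m(1) by (fastforce simp: mpolys_def)
    qed
    have "mpoly_val q (?F z) - z i = 0" for z
    proof (rule poly_funs_eq_0_on_Nats[of "{..<n}" "\<lambda>z. mpoly_val q (?F z) - z i"])
      have qF: "mpoly_val q \<in> poly_funs UNIV {..<n}"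
        using q by (intro mpoly_fun_poly_funs) auto
      show "(\<lambda>z. mpoly_val q (?F z) - z i) \<in> poly_funs UNIV {..<n}"
        using i F by (intro poly_funs_diff is_subring_UNIV poly_funs_subst[OF qF] poly_funs.var) auto
      fix z :: "nat \<Rightarrow> 'k" assume "\<And>i. z i \<in> \<nat>"
      then have "(\<Sum>t<T. g t * M z t) = z i" by (intro g) simp
      moreover have "(\<Sum>t<T. g t * M z t) = mpoly_val q (?F z)"
        unfolding q_fun by (intro sum.cong) (auto simp: M_def)
      ultimately show "mpoly_val q (?F z) - z i = 0" by simp
    qed simp
    then show ?thesis using q by auto
  qed
  then have "\<forall>i. \<exists>q. i < n \<longrightarrow> q \<in> mpolys n \<and> (\<forall>z. mpoly_val q (?F z) = z i)" by blast
  from choice[OF this] obtain Q where Q: "\<And>i. i < n \<Longrightarrow> Q i \<in> mpolys n"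
    "\<And>i z. i < n \<Longrightarrow> mpoly_val (Q i) (?F z) = z i" by blast
  let ?G = "\<lambda>z j. mpoly_val (Q j) z"
  \<comment> \<open>A new embedding is taken because the coefficients of \<open>Q\<close> need not
    lie in \<open>S\<close>.\<close>
  obtain S2 and \<sigma>2 :: "'k \<Rightarrow> complex" where \<sigma>2: "ring_emb S2 \<sigma>2" "coef P \<union> coef Q \<subseteq> S2"
    using exists_ring_emb[of "coef P \<union> coef Q"] fin_coef by (metis finite_UnI)
  note S2 = ring_embD(1)[OF \<sigma>2(1)]
  have PS2: "Poly_Mapping.lookup (P i) m \<in> S2" and QS2: "Poly_Mapping.lookup (Q i) m \<in> S2" if "i < n" for i m
    using coef[OF S2 _ that] \<sigma>2(2) by auto
  obtain G2 where G2: "\<And>i. i < n \<Longrightarrow> G2 i \<in> poly_funs UNIV {..<n}"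
    "\<And>y i. i < n \<Longrightarrow> mpoly_fun \<sigma>2 (P i) (\<lambda>j. G2 j y) = y i"
    using keller_map_complex_inverse[OF A n \<sigma>2(1) P PS2 det] by metis
  have F2: "mpoly_fun \<sigma>2 (P i) \<in> poly_funs UNIV {..<n}" "mpoly_fun \<sigma>2 (Q i) \<in> poly_funs UNIV {..<n}" if "i < n" for i
    using P[OF that] Q(1)[OF that] by (intro mpoly_fun_poly_funs; simp)+
  have left2: "mpoly_fun \<sigma>2 (Q i) (\<lambda>j. mpoly_fun \<sigma>2 (P j) w) - w i = 0" if i: "i < n" for i w
  proof (rule poly_funs_eq_0_on_Nats[of "{..<n}" "\<lambda>w. mpoly_fun \<sigma>2 (Q i) (\<lambda>j. mpoly_fun \<sigma>2 (P j) w) - w i"])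
    show "(\<lambda>w. mpoly_fun \<sigma>2 (Q i) (\<lambda>j. mpoly_fun \<sigma>2 (P j) w) - w i) \<in> poly_funs UNIV {..<n}"
      using i by (intro poly_funs_diff is_subring_UNIV poly_funs_subst[OF F2(2)[OF i]] F2(1) poly_funs.var) auto
    fix w :: "nat \<Rightarrow> complex" assume "\<And>i. w i \<in> \<nat>"
    then obtain z where z: "\<And>i. z i \<in> S2" "w = (\<lambda>i. \<sigma>2 (z i))" using ring_emb_Nats_point[OF \<sigma>2(1)] by metis
    note FP = ring_emb_mpoly_fun(1,2)[OF \<sigma>2(1) P PS2 z(1)]
    have "w i = \<sigma>2 (mpoly_val (Q i) (?F z))" using Q(2)[OF i] z(2) by simp
    also have "\<dots> = mpoly_fun \<sigma>2 (Q i) (\<lambda>j. \<sigma>2 (?F z j))"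
      using FP(2) by (intro ring_emb_mpoly_fun(1)[OF \<sigma>2(1) Q(1)[OF i] QS2[OF i]])
    also have "\<dots> = mpoly_fun \<sigma>2 (Q i) (\<lambda>j. mpoly_fun \<sigma>2 (P j) w)"
      using FP(1) by (intro poly_funs_cong[OF F2(2)[OF i]]) (simp add: z(2))
    finally show "mpoly_fun \<sigma>2 (Q i) (\<lambda>j. mpoly_fun \<sigma>2 (P j) w) - w i = 0" by simp
  qed simp
  have QG2: "mpoly_fun \<sigma>2 (Q i) y = G2 i y" if i: "i < n" for i y
  proof -
    have "mpoly_fun \<sigma>2 (Q i) y = mpoly_fun \<sigma>2 (Q i) (\<lambda>j. mpoly_fun \<sigma>2 (P j) (\<lambda>j. G2 j y))"
      using G2(2) by (intro poly_funs_cong[OF F2(2)[OF i]]) simp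
    then show ?thesis using left2[OF i, of "\<lambda>j. G2 j y"] by simp
  qed
  have "mpoly_val (P i) (?G z) - z i = 0" if i: "i < n" for i z
  proof (rule poly_funs_eq_0_on_Nats[of "{..<n}" "\<lambda>z. mpoly_val (P i) (?G z) - z i"])
    have "mpoly_val (Q j) \<in> poly_funs UNIV {..<n}" if "j < n" for j
      using Q(1)[OF that] by (intro mpoly_fun_poly_funs) auto
    then show "(\<lambda>z. mpoly_val (P i) (?G z) - z i) \<in> poly_funs UNIV {..<n}"
      using i by (intro poly_funs_diff is_subring_UNIV poly_funs_subst[OF F[OF i]] poly_funs.var) auto
    fix z :: "nat \<Rightarrow> 'k" assume "\<And>i. z i \<in> \<nat>"
    then have z: "z i \<in> S2" for i using is_subring_Nats[OF S2] by blast
    note FQ = ring_emb_mpoly_fun(1,2)[OF \<sigma>2(1) Q(1) QS2 z]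
    have "\<sigma>2 (mpoly_val (P i) (?G z)) = mpoly_fun \<sigma>2 (P i) (\<lambda>j. \<sigma>2 (?G z j))"
      using FQ(2) by (intro ring_emb_mpoly_fun(1)[OF \<sigma>2(1) P[OF i] PS2[OF i]])
    also have "\<dots> = mpoly_fun \<sigma>2 (P i) (\<lambda>j. G2 j (\<lambda>i. \<sigma>2 (z i)))"
      using FQ(1) QG2 by (intro poly_funs_cong[OF F2(1)[OF i]]) simp
    also have "\<dots> = \<sigma>2 (z i)" using G2(2)[OF i] by simp
    finally have "\<sigma>2 (mpoly_val (P i) (?G z)) = \<sigma>2 (z i)" .
    moreover have "mpoly_val (P i) (?G z) \<in> S2"
      using FQ(2) by (intro ring_emb_mpoly_fun(2)[OF \<sigma>2(1) P[OF i] PS2[OF i]])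
    ultimately have "mpoly_val (P i) (?G z) = z i"
      using ring_emb_inj[OF \<sigma>2(1)] z by blast
    then show "mpoly_val (P i) (?G z) - z i = 0" by simp
  qed simp
  then show ?thesis using that[of Q] Q by simp
qed

theorem proposition1p3:
  assumes A:
    "\<forall>n\<ge>1. \<forall>F.
       C1_map n F \<and>
       (\<exists>\<epsilon>>0. \<forall>x\<in>carrier_vec n. \<forall>\<mu>::complex.
          eigenvalue (map_mat complex_of_real (jacobian n F x)) \<mu> \<longrightarrow> cmod \<mu> \<ge> \<epsilon>)
       \<longrightarrow> inj_on F (carrier_vec n)"
  shows
    "\<forall>n\<ge>1. \<forall>(P :: nat \<Rightarrow> 'k::field_char_0 mpoly) F.
       polynomial_map_by n P F \<and>
       (\<exists>C. C \<noteq> 0 \<and> (\<forall>x\<in>carrier_vec n. Determinant.det (polynomial_jacobian n P x) = C))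
       \<longrightarrow> (\<exists>Q G. polynomial_map_by n Q G \<and>
              (\<forall>x\<in>carrier_vec n. G (F x) = x \<and> F (G x) = x))"
proof (intro allI impI)
  fix n and P :: "nat \<Rightarrow> 'k mpoly" and F
  assume n: "n \<ge> 1"
    and "polynomial_map_by n P F \<and>
      (\<exists>C. C \<noteq> 0 \<and> (\<forall>x\<in>carrier_vec n. Determinant.det (polynomial_jacobian n P x) = C))"
  then obtain C where P: "\<And>i. i < n \<Longrightarrow> P i \<in> mpolys n"
    and F: "\<And>x. x \<in> carrier_vec n \<Longrightarrow> F x = Matrix.vec n (\<lambda>i. mpoly_eval (P i) x)"
    and C: "C \<noteq> 0" "\<And>x. x \<in> carrier_vec n \<Longrightarrow> Determinant.det (polynomial_jacobian n P x) = C"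
    by (auto simp: polynomial_map_by_def)
  have SI: spectral_injectivity using A by (simp only: spectral_injectivity_def)
  have "Determinant.det (Matrix.mat n n (\<lambda>(i, j). mpoly_deriv_val j (P i) z)) = C" for z
  proof -
    \<comment> \<open>The entries of the vector agree with \<open>z\<close> only below
      \<open>n\<close>; members of \<open>mpolys n\<close> involve no further coordinates.\<close>
    have "mpoly_eval (mpoly_pderiv j (P i)) (Matrix.vec n z) = mpoly_deriv_val j (P i) z" if "i < n" for i j
      unfolding mpoly_eval_eq mpoly_fun_pderiv
      by (rule poly_funs_cong[OF mpoly_fun_poly_funs(2)[OF is_subring_UNIV P[OF that]]]) auto
    then have "polynomial_jacobian n P (Matrix.vec n z) = Matrix.mat n n (\<lambda>(i, j). mpoly_deriv_val j (P i) z)"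
      by (auto simp: polynomial_jacobian_def)
    then show ?thesis using C(2)[of "Matrix.vec n z"] by simp
  qed
  from keller_map_inverse[OF SI n P this C(1)]
  obtain Q where Q: "\<And>i. i < n \<Longrightarrow> Q i \<in> mpolys n"
    "\<And>i z. i < n \<Longrightarrow> mpoly_val (Q i) (\<lambda>j. mpoly_val (P j) z) = z i"
    "\<And>i z. i < n \<Longrightarrow> mpoly_val (P i) (\<lambda>j. mpoly_val (Q j) z) = z i"
    by metis
  define G where "G x = Matrix.vec n (\<lambda>i. mpoly_eval (Q i) x)" for x
  have comp: "Matrix.vec n (\<lambda>i. mpoly_eval (p i) (Matrix.vec n (\<lambda>j. mpoly_eval (q j) x))) = x"
    if p: "\<And>i. i < n \<Longrightarrow> p i \<in> mpolys n" and x: "x \<in> carrier_vec n"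
      and inv: "\<And>i z. i < n \<Longrightarrow> mpoly_val (p i) (\<lambda>j. mpoly_val (q j) z) = z i"
    for p q :: "nat \<Rightarrow> 'k mpoly" and x
  proof (rule eq_vecI)
    fix i assume "i < dim_vec x"
    then have i: "i < n" using x by simp
    have "mpoly_eval (p i) (Matrix.vec n (\<lambda>j. mpoly_eval (q j) x)) =
        mpoly_val (p i) (\<lambda>j. mpoly_val (q j) (Matrix.vec_index x))"
      unfolding mpoly_eval_eq
      by (rule poly_funs_cong[OF mpoly_fun_poly_funs(1)[OF is_subring_UNIV p[OF i]]]) auto
    then show "Matrix.vec n (\<lambda>i. mpoly_eval (p i) (Matrix.vec n (\<lambda>j. mpoly_eval (q j) x))) $ i = x $ i"
      using i inv by simp
  qed (use x in simp)
  show "\<exists>Q G. polynomial_map_by n Q G \<and> (\<forall>x\<in>carrier_vec n. G (F x) = x \<and> F (G x) = x)"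
  proof (intro exI conjI ballI)
    show "polynomial_map_by n Q G" using Q(1) by (simp add: polynomial_map_by_def G_def)
    fix x :: "'k Matrix.vec" assume x: "x \<in> carrier_vec n"
    show "G (F x) = x" using comp[OF Q(1) x Q(2)] F[OF x] by (simp add: G_def)
    have "G x \<in> carrier_vec n" by (simp add: G_def)
    then show "F (G x) = x" using comp[OF P x Q(3)] F by (simp add: G_def)
  qed
qed

end
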